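(* Let $X$ be a compact connected abelian group with $\dim X<\infty$ and normalized Haar measure $m$. For any finite set $\{T_1,\ldots,T_s\}$ of epimorphisms of $X$, there exists $l\ge 1$ such that for every $k\in\mathbb{Z}/l\mathbb{Z}$ and all $f_1,\ldots,f_s\in L^\infty(X)$, the limit $$\lim_{\substack{n\to\infty\\ n\equiv k\ (\mathrm{mod}\ l)}}\int_X f_1(T_1^n x)\cdots f_s(T_s^n x)\,dm(x)$$ exists.
   Context: An epimorphism of $X$ is a continuous surjective homomorphism $X\to X$. $L^\infty(X)$ is taken with respect to $m$. The limit is over positive integers $n$ in the residue class $k$ modulo $l$. *)

theory Defs
  imports "HOL-Analysis.Analysis" "HOL-Number_Theory.Cong"
begin

text \<open>
  Lebesgue covering dimension at most \<open>n\<close>: every open cover has an open refinement in which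
  each point lies in at most \<open>n + 1\<close> members. On compact spaces, this is equivalent to the
  version that quantifies over finite covers only.
\<close>

definition covering_dim_le :: "'a topology \<Rightarrow> nat \<Rightarrow> bool" where
  "covering_dim_le X n \<longleftrightarrow>
     (\<forall>\<U>. (\<forall>U\<in>\<U>. openin X U) \<and> \<Union>\<U> = topspace X \<longrightarrow>
        (\<exists>\<V>. (\<forall>V\<in>\<V>. openin X V \<and> (\<exists>U\<in>\<U>. V \<subseteq> U)) \<and> \<Union>\<V> = topspace X \<and>
             (\<forall>x\<in>topspace X. finite {V \<in> \<V>. x \<in> V} \<and> card {V \<in> \<V>. x \<in> V} \<le> n + 1)))"

definition finite_covering_dim :: "'a topology \<Rightarrow> bool" where
  "finite_covering_dim X \<longleftrightarrow> (\<exists>n. covering_dim_le X n)"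

text \<open>
  Inner regularity is part of the definition of a Haar measure. It is stated for all Borel sets,
  as is appropriate for finite measures.
\<close>

definition normalized_haar :: "'a::topological_ab_group_add measure \<Rightarrow> bool" where
  "normalized_haar m \<longleftrightarrow>
     sets m = sets borel \<and> emeasure m UNIV = 1 \<and>
     (\<forall>a. \<forall>A\<in>sets borel. emeasure m ((\<lambda>x. a + x) ` A) = emeasure m A) \<and>
     (\<forall>A\<in>sets borel. emeasure m A = (SUP K\<in>{K. K \<subseteq> A \<and> compact K}. emeasure m K))"

definition epimorphism :: "('a::topological_ab_group_add \<Rightarrow> 'a) \<Rightarrow> bool" where
  "epimorphism T \<longleftrightarrow> continuous_on UNIV T \<and> (\<forall>x y. T (x + y) = T x + T y) \<and> surj T"

text \<open>
  Representatives of the classes in complex \<open>L\<^sup>\<infinity>(m)\<close>; functions that agree almost everywhere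
  are not identified.
\<close>

definition L_inf :: "'a measure \<Rightarrow> ('a \<Rightarrow> complex) set" where
  "L_inf m = {f \<in> borel_measurable m. \<exists>C::real. AE x in m. norm (f x) \<le> C}"

text \<open>The filter of \<open>n \<rightarrow> \<infinity>\<close> along the residue class of \<open>k\<close> modulo \<open>l\<close>.\<close>

definition at_top_residue :: "nat \<Rightarrow> nat \<Rightarrow> nat filter" where
  "at_top_residue k l = inf sequentially (principal {n. [n = k] (mod l)})"

end

theory Submission
  imports Defs "HOL-Computational_Algebra.Polynomial"
begin

text \<open>
  The characters of \<open>X\<close> form a group \<open>\<Gamma>\<close> that is torsion-free because \<open>X\<close> is connected, and of
  finite rank because \<open>n + 1\<close> independent characters produce, through one-parameter subgroups, an
  \<open>(n + 1)\<close>-dimensional cube in \<open>X\<close>, which is excluded by Lebesgue's covering theorem if \<open>X\<close> has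
  covering dimension \<open>n\<close>. When the \<open>f\<^sub>i\<close> are characters \<open>\<gamma>\<^sub>i\<close>, the integral is \<open>1\<close> or \<open>0\<close> according to
  whether \<open>\<Sum>\<^sub>i A\<^sub>i\<^sup>n \<gamma>\<^sub>i = 0\<close>, where \<open>A\<^sub>i\<close> is the injective endomorphism of \<open>\<Gamma>\<close> dual to \<open>T\<^sub>i\<close>. On a
  lattice \<open>\<Lambda>\<close> in \<open>\<Gamma>\<close>, after multiplication by an integer, all \<open>A\<^sub>i\<^sup>N\<close> are congruent to the identity modulo
  \<open>p\<^sup>2\<close> for a suitable prime \<open>p\<close>, and the Skolem--Mahler--Lech argument shows that on each residue class
  modulo \<open>N\<close> the sum vanishes either always or only finitely often. As \<open>N\<close> depends only on the \<open>A\<^sub>i\<close>, it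
  serves as \<open>l\<close>. The general case follows since trigonometric polynomials are dense in \<open>L\<^sup>1\<close>
  and epimorphisms preserve \<open>m\<close>.
\<close>

subsection \<open>Zeros of binomial series\<close>

text \<open>No facts about characters are presupposed, and two of them carry the topological half:
  characters separate points, which yields density, and every homomorphism from \<Gamma> to the
  circle is evaluation at a point, which turns real-valued homomorphisms of \<Gamma> into
  one-parameter subgroups. Characters arise as multiplicative extreme points of a compact set of
  positive definite functions. Positive definiteness ignores the topology of \<open>X\<close>, so
  the set is cut down by spectral conditions that force continuity and nontriviality at a given
  point; a power method for a convolution operator shows that it stays nonempty. On the algebraic
  side \<Gamma> need not be finitely generated, so the endomorphisms act on a lattice only after
  scaling; a common scale for all of them multiplies the whole sum by a nonzero integer. The square
  of the prime pays for factorials: \<open>2 ^ (n - 1)\<close> may divide \<open>n!\<close>, whereas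
  \<open>p ^ (2 * j) / j!\<close> tends to 0 \<open>p\<close>-adically for every prime
  \<open>p\<close>.\<close>

lemma fact_prime_power_split:
  fixes p :: nat
  assumes "prime p"
  shows "\<exists>v u. fact n = p ^ v * u \<and> v \<le> n \<and> \<not> p dvd u"
proof -
  have p1: "p > 1" using assms prime_gt_1_nat by blast
  \<comment> \<open>Legendre's formula in recursive form: the multiples of \<open>p\<close> up to
    \<open>i\<close> contribute \<open>p ^ (i div p)\<close> and the factorial of
    \<open>i div p\<close>, and the other factors are prime to \<open>p\<close>.\<close>
  have step: "\<exists>u. fact i = p ^ (i div p) * fact (i div p) * u \<and> \<not> p dvd u" for i
  proof (induction i)
    case 0
    show ?case using p1 by (intro exI[of _ 1]) auto
  next
    case (Suc i)
    then obtain u where u: "fact i = p ^ (i div p) * fact (i div p) * u" "\<not> p dvd u" by blast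
    show ?case
    proof (cases "p dvd Suc i")
      case True
      then have d: "Suc i div p = Suc (i div p)"
        using p1 by (metis div_Suc mod_0_imp_dvd dvd_imp_mod_0)
      have "Suc i = p * Suc (i div p)" using True d by (metis dvd_mult_div_cancel)
      then have "fact (Suc i) = (p * Suc (i div p)) * fact i" by (metis fact_Suc of_nat_id)
      also have "\<dots> = p ^ (Suc i div p) * fact (Suc i div p) * u"
        unfolding d u(1) by (simp add: algebra_simps)
      finally show ?thesis using u(2) by blast
    next
      case False
      then have d: "Suc i div p = i div p" by (simp add: div_Suc dvd_eq_mod_eq_0)
      have "fact (Suc i) = p ^ (Suc i div p) * fact (Suc i div p) * (Suc i * u)"
        unfolding d by (simp add: u(1) algebra_simps)
      moreover have "\<not> p dvd Suc i * u" using False u(2) assms prime_dvd_mult_iff by blast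
      ultimately show ?thesis by blast
    qed
  qed
  show ?thesis
  proof (induction n rule: less_induct)
    case (less n)
    show ?case
    proof (cases "n = 0")
      case True
      then show ?thesis using p1 by (intro exI[of _ 0] exI[of _ 1]) auto
    next
      case False
      have lt: "n div p < n" using False p1 by simp
      obtain v u where vu: "fact (n div p) = p ^ v * u" "v \<le> n div p" "\<not> p dvd u"
        using less[OF lt] by blast
      obtain w where w: "fact n = p ^ (n div p) * fact (n div p) * w" "\<not> p dvd w"
        using step by blast
      \<comment> \<open>Both \<open>n div p\<close> and, by induction, \<open>v\<close> are at most
        half of \<open>n\<close>, because \<open>p\<close> is at least 2.\<close>
      have "2 * (n div p) \<le> p * (n div p)" using p1 by (intro mult_right_mono) auto
      also have "\<dots> \<le> n" by simp
      finally have "n div p + v \<le> n" using vu(2) by simp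
      moreover have "fact n = p ^ (n div p + v) * (u * w)"
        by (simp add: w vu(1) power_add algebra_simps)
      moreover have "\<not> p dvd u * w" using vu(3) w(2) assms prime_dvd_mult_iff by blast
      ultimately show ?thesis by blast
    qed
  qed
qed

text \<open>Dividing by a monic linear factor preserves divisibility of the high-order coefficients,
  one place lower.\<close>

lemma dvd_poly_of_roots:
  fixes S :: "int poly"
  assumes "finite A" "\<And>a. a \<in> A \<Longrightarrow> poly S a = 0" "\<And>j. j \<ge> card A \<Longrightarrow> m dvd coeff S j"
  shows "m dvd poly S t"
  using assms
proof (induction A arbitrary: S rule: finite_induct)
  case empty
  then show ?case unfolding poly_altdef by (intro dvd_sum dvd_mult2) auto
next
  case (insert a B)
  have "poly S a = 0" using insert.prems by blast
  then obtain Q where Q: "S = [:-a, 1:] * Q" unfolding poly_eq_0_iff_dvd by (auto elim: dvdE)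
  have rootQ: "poly Q b = 0" if "b \<in> B" for b
  proof -
    have "poly S b = 0" using insert.prems(1) that by blast
    then show ?thesis using Q that insert.hyps(2) by auto
  qed
  have cS: "coeff S (Suc j) = coeff Q j - a * coeff Q (Suc j)" for j
    unfolding Q by (simp add: coeff_pCons)
  \<comment> \<open>Solved for \<open>coeff Q j\<close>, the relation \<open>cS\<close> is a
    recursion that descends from the degree of \<open>Q\<close>.\<close>
  have cQ: "m dvd coeff Q j" if "j \<ge> card B" for j
  proof (cases "j \<le> degree Q")
    case True
    then show ?thesis using that
    proof (induction j rule: inc_induct)
      case base
      have "coeff Q (degree Q) = coeff S (Suc (degree Q))"
        using cS[of "degree Q"] by (simp add: coeff_eq_0)
      then show ?case using insert.prems(2)[of "Suc (degree Q)"] insert.hyps base by simp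
    next
      case (step n)
      have "coeff Q n = coeff S (Suc n) + a * coeff Q (Suc n)" using cS[of n] by simp
      moreover have "m dvd coeff S (Suc n)" using insert.prems(2)[of "Suc n"] insert.hyps step by simp
      ultimately show ?case using step by simp
    qed
  qed (simp add: coeff_eq_0)
  have "m dvd poly Q t" by (rule insert.IH) (use rootQ cQ in auto)
  then show ?case unfolding Q by simp
qed

lemma prod_diff_eq_fact_binomial:
  "(\<Prod>m<i. (int t - int m)) = fact i * int (t choose i)"
proof (induction i)
  case (Suc i)
  have "int (Suc i) * int (t choose Suc i) = int (t choose i) * (int t - int i)"
  proof (cases "i \<le> t")
    case True
    have "Suc i * (t choose Suc i) = (t choose i) * (t - i)"
      using binomial_absorb_comp binomial_absorption
      by (metis Suc_times_binomial_eq binomial_absorb_comp mult.commute diff_Suc_1 True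
          times_binomial_minus1_eq zero_less_Suc)
    then show ?thesis using True by (metis of_nat_diff of_nat_mult)
  qed (simp add: binomial_eq_0)
  then have "fact i * (int (t choose i) * (int t - int i)) = fact (Suc i) * int (t choose Suc i)"
    by simp
  then show ?case using Suc by simp
qed auto

text \<open>Hansel's elementary form of the \<open>p\<close>-adic step in the Skolem--Mahler--Lech theorem.\<close>

lemma binomial_series_zeros:
  fixes p :: nat and d :: "nat \<Rightarrow> int"
  defines "b \<equiv> \<lambda>n. \<Sum>j\<le>n. int (n choose j) * ((int p)\<^sup>2) ^ j * d j"
  assumes p: "prime p" and inf: "infinite {n. b n = 0}"
  shows "b t = 0"
proof (rule ccontr)
  assume bt: "b t \<noteq> 0"
  have pk: "int p ^ k dvd b t" for k
  proof -
    obtain Z where Z: "finite Z" "card Z = k" "Z \<subseteq> {n. b n = 0}"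
      using infinite_arbitrarily_large[OF inf] by blast
    define n where "n = Max (insert t Z)"
    have tn: "t \<le> n" and Zn: "\<And>z. z \<in> Z \<Longrightarrow> z \<le> n"
      using Z(1) by (auto simp: n_def)
    \<comment> \<open>Newton's form of a polynomial with the values \<open>fact n * b r\<close> at
      all \<open>r \<le> n\<close>; the factor \<open>fact n\<close> clears the denominators of the
      binomial coefficients.\<close>
    define S :: "int poly" where
      "S = (\<Sum>i\<le>n. smult (d i * ((int p)\<^sup>2) ^ i * (fact n div fact i)) (\<Prod>m<i. [:- int m, 1:]))"
    have fdiv: "fact n div fact i * fact i = (fact n :: int)" if "i \<le> n" for i
      using that by (simp add: fact_dvd)
    have pS: "poly S (int r) = fact n * b r" if "r \<le> n" for r
    proof -
      have "poly S (int r) = (\<Sum>i\<le>n. (d i * ((int p)\<^sup>2) ^ i * (fact n div fact i)) * (fact i * int (r choose i)))"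
        unfolding S_def by (simp add: poly_sum poly_prod prod_diff_eq_fact_binomial)
      also have "\<dots> = (\<Sum>i\<le>n. fact n * (int (r choose i) * ((int p)\<^sup>2) ^ i * d i))"
      proof (rule sum.cong)
        fix i assume "i \<in> {..n}"
        then have "fact n = fact n div fact i * (fact i :: int)" using fdiv by simp
        then show "d i * ((int p)\<^sup>2) ^ i * (fact n div fact i) * (fact i * int (r choose i)) =
           fact n * (int (r choose i) * ((int p)\<^sup>2) ^ i * d i)"
          by (metis (no_types, lifting) mult.assoc mult.commute mult.left_commute)
      qed auto
      also have "\<dots> = fact n * (\<Sum>i\<le>n. int (r choose i) * ((int p)\<^sup>2) ^ i * d i)"
        by (simp add: sum_distrib_left)
      also have "(\<Sum>i\<le>n. int (r choose i) * ((int p)\<^sup>2) ^ i * d i) = b r"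
        unfolding b_def by (rule sum.mono_neutral_right) (use that in auto)
      finally show ?thesis .
    qed
    obtain e u where eu: "fact n = p ^ e * u" "\<not> p dvd u" using fact_prime_power_split[OF p] by blast
    \<comment> \<open>Only terms with \<open>i \<ge> k\<close> reach degree
      \<open>j \<ge> k\<close>. There the square of \<open>p\<close> gives \<open>2 * i\<close>
      factors \<open>p\<close>, and \<open>fact n div fact i\<close> at least \<open>e - i\<close>
      more, since \<open>fact i\<close> holds at most \<open>i\<close> of them: together at least
      \<open>k + e\<close>.\<close>
    have cdvd: "int p ^ (k + e) dvd coeff S j" if "j \<ge> k" for j
    proof -
      have "int p ^ (k + e) dvd coeff (smult (d i * ((int p)\<^sup>2) ^ i * (fact n div fact i)) (\<Prod>m<i. [:- int m, 1:])) j"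
        if i: "i \<le> n" for i
      proof (cases "j \<le> i")
        case False
        have "degree (\<Prod>m<i. [:- int m, 1:]) \<le> i"
          using degree_prod_sum_le[of "{..<i}" "\<lambda>m. [:- int m, 1:]"] by simp
        then show ?thesis using False by (simp add: coeff_eq_0)
      next
        case True
        obtain v w where vw: "fact i = p ^ v * w" "v \<le> i" "\<not> p dvd w"
          using fact_prime_power_split[OF p] by blast
        define c :: nat where "c = fact n div fact i"
        have "c * fact i = fact n" unfolding c_def using i by (simp add: fact_dvd)
        then have "p ^ e dvd (c * p ^ v) * w" using eu vw by (metis dvd_triv_left mult.assoc)
        moreover have "coprime (p ^ e) w" using vw(3) p by (simp add: prime_imp_coprime)
        ultimately have "p ^ e dvd c * p ^ v" by (simp add: coprime_dvd_mult_left_iff)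
        also have "c * p ^ v dvd c * p ^ i" using vw(2) by (simp add: le_imp_power_dvd)
        finally have "p ^ e dvd c * p ^ i" .
        moreover have "p ^ k dvd p ^ i" using True \<open>k \<le> j\<close> by (simp add: le_imp_power_dvd)
        ultimately have "p ^ (k + e) dvd p ^ i * (c * p ^ i)" unfolding power_add by (rule mult_dvd_mono[rotated])
        also have "p ^ i * (c * p ^ i) = (p\<^sup>2) ^ i * c" by (simp add: power2_eq_square power_mult_distrib)
        finally have "int (p ^ (k + e)) dvd int ((p\<^sup>2) ^ i * c)" by (simp only: of_nat_dvd_iff)
        moreover have "int ((p\<^sup>2) ^ i * c) = ((int p)\<^sup>2) ^ i * (fact n div fact i)"
          by (simp add: c_def zdiv_int)
        ultimately have "int (p ^ (k + e)) dvd ((int p)\<^sup>2) ^ i * (fact n div fact i)" by (simp only:)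
        then have "int p ^ (k + e) dvd ((int p)\<^sup>2) ^ i * (fact n div fact i)" by (simp only: of_nat_power)
        then have "int p ^ (k + e) dvd ((int p)\<^sup>2) ^ i * (fact n div fact i) * (d i * coeff (\<Prod>m<i. [:- int m, 1:]) j)"
          by (rule dvd_mult2)
        moreover have rearrange: "x * y * c * z = y * c * (x * z)" for x y c z :: int by simp
        ultimately show ?thesis by (subst coeff_smult, subst rearrange)
      qed
      then show ?thesis unfolding S_def coeff_sum by (intro dvd_sum) auto
    qed
    \<comment> \<open>The \<open>k\<close> zeros of \<open>b\<close> in \<open>Z\<close> are roots
      of \<open>S\<close>, so divisibility of the coefficients from degree \<open>k\<close> on
      extends to every value; cancelling the \<open>p ^ e\<close> in \<open>fact n\<close> leaves
      \<open>p ^ k\<close>.\<close>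
    have "int p ^ (k + e) dvd poly S (int t)"
    proof (rule dvd_poly_of_roots[of "int ` Z"])
      show "poly S a = 0" if a: "a \<in> int ` Z" for a
        using a pS Zn Z(3) by auto
      show "int p ^ (k + e) dvd coeff S j" if "card (int ` Z) \<le> j" for j
        using that cdvd Z by (simp add: card_image)
    qed (use Z in auto)
    then have "int p ^ (k + e) dvd int (fact n) * b t" using pS[OF tn] by simp
    also have "int (fact n) * b t = int p ^ e * (int u * b t)" unfolding eu by simp
    finally have "int p ^ e * int p ^ k dvd int p ^ e * (int u * b t)" by (simp add: power_add mult.commute)
    moreover have "int p ^ e \<noteq> 0" using prime_gt_0_nat[OF p] by simp
    ultimately have "int p ^ k dvd int u * b t" by (metis dvd_mult_cancel_left)
    moreover have "coprime (p ^ k) u" using eu(2) p by (simp add: prime_imp_coprime)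
    then have "coprime (int p ^ k) (int u)" by (simp only: coprime_int_iff flip: of_nat_power)
    ultimately show ?thesis by (simp add: coprime_dvd_mult_right_iff)
  qed
  define k where "k = nat \<bar>b t\<bar>"
  have "\<bar>int p ^ k\<bar> \<le> \<bar>b t\<bar>" by (rule dvd_imp_le_int[OF bt pk])
  then have "int p ^ k \<le> int k" by (simp add: k_def)
  moreover have "k < p ^ k" using prime_gt_1_nat[OF p] by (simp add: power_gt_expt)
  then have "int k < int p ^ k" by (simp only: of_nat_less_iff flip: of_nat_power)
  ultimately show False by simp
qed

subsection \<open>Lattices in torsion-free groups of finite rank\<close>

text \<open>The module structure over the integers that every abelian group carries; it will be used
  on the additively written group of characters.\<close>

definition zmul :: "int \<Rightarrow> 'g::ab_group_add \<Rightarrow> 'g" where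
  "zmul k x = (if 0 \<le> k then \<Sum>i<nat k. x else - (\<Sum>i<nat (- k). x))"

lemma zmul_of_nat: "zmul (int n) x = (\<Sum>i<n. x)"
  by (simp add: zmul_def)

lemma zmul_0 [simp]: "zmul 0 x = 0" and zmul_1 [simp]: "zmul 1 x = x"
  by (simp_all add: zmul_def)

lemma zmul_minus_left: "zmul (- k) x = - zmul k x"
  by (auto simp: zmul_def)

lemma zmul_succ: "zmul (k + 1) x = zmul k x + x"
proof (cases "k \<ge> 0")
  case True
  then have "nat (k + 1) = Suc (nat k)" by simp
  then show ?thesis using True by (simp add: zmul_def)
next
  case False
  then obtain n where k: "k = - int (Suc n)" by (metis int_cases not_less of_nat_0_le_iff)
  have "zmul (k + 1) x = - zmul (int n) x" by (simp add: k flip: zmul_minus_left)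
  moreover have "zmul k x = - zmul (int (Suc n)) x" by (simp only: k zmul_minus_left)
  ultimately show ?thesis by (simp only: zmul_of_nat) simp
qed

lemma zmul_add_left: "zmul (j + k) x = zmul j x + zmul k x"
proof (induction j rule: int_induct[where k = 0])
  case (step1 i)
  have "zmul (i + 1 + k) x = zmul (i + k + 1) x" by (simp add: algebra_simps)
  then have "zmul (i + 1 + k) x = zmul (i + k) x + x" by (simp only: zmul_succ)
  then show ?case using step1(2) by (simp only: zmul_succ) (simp add: add_ac)
next
  case (step2 i)
  have "zmul (i + k) x = zmul (i - 1 + k + 1) x" "zmul i x = zmul (i - 1 + 1) x"
    by (simp_all add: algebra_simps)
  then have "zmul (i + k) x = zmul (i - 1 + k) x + x" "zmul i x = zmul (i - 1) x + x"
    by (simp_all only: zmul_succ)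
  then show ?case using step2(2) by (metis add.assoc add.commute add_right_imp_eq)
qed simp

lemma zmul_add_right: "zmul k (x + y) = zmul k x + zmul k y"
  by (simp add: zmul_def sum.distrib)

lemma zmul_0_right [simp]: "zmul k 0 = 0"
  by (simp add: zmul_def)

lemma zmul_diff_left: "zmul (j - k) x = zmul j x - zmul k x"
  using zmul_add_left[of j "- k" x] by (simp add: zmul_minus_left)

lemma zmul_mult: "zmul (j * k) x = zmul j (zmul k x)"
proof (induction j rule: int_induct[where k = 0])
  case (step1 i)
  then show ?case by (simp add: zmul_add_left distrib_right)
next
  case (step2 i)
  have "zmul (i * k) x = zmul ((i - 1) * k + k) x" "zmul i (zmul k x) = zmul (i - 1 + 1) (zmul k x)"
    by (simp_all add: algebra_simps)
  then have "zmul (i * k) x = zmul ((i - 1) * k) x + zmul k x"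
    "zmul i (zmul k x) = zmul (i - 1) (zmul k x) + zmul k x"
    by (simp_all only: zmul_succ[of "i - 1" "zmul k x"] zmul_add_left[of "(i - 1) * k" k x])
  then show ?case using step2(2) by (metis add_right_imp_eq)
qed simp

lemma zmul_sum_right: "zmul k (sum f A) = (\<Sum>a\<in>A. zmul k (f a))"
  by (induction A rule: infinite_finite_induct) (auto simp: zmul_add_right)

lemma zmul_sum_left: "zmul (sum f A) x = (\<Sum>a\<in>A. zmul (f a) x)"
  by (induction A rule: infinite_finite_induct) (auto simp: zmul_add_left)

lemma additive_0:
  fixes A :: "'g::ab_group_add \<Rightarrow> 'h::ab_group_add"
  assumes "\<And>x y. A (x + y) = A x + A y"
  shows "A 0 = 0"
  using assms[of 0 0] by simp

lemma additive_sum: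
  fixes A :: "'g::ab_group_add \<Rightarrow> 'h::ab_group_add"
  assumes "\<And>x y. A (x + y) = A x + A y"
  shows "A (sum f I) = (\<Sum>i\<in>I. A (f i))"
  by (induction I rule: infinite_finite_induct) (auto simp: assms additive_0[OF assms])

lemma additive_minus:
  fixes A :: "'g::ab_group_add \<Rightarrow> 'h::ab_group_add"
  assumes "\<And>x y. A (x + y) = A x + A y"
  shows "A (- x) = - A x"
  using assms[of x "- x"] additive_0[of A, OF assms] by (simp add: eq_neg_iff_add_eq_0 add.commute)

lemma additive_zmul:
  fixes A :: "'g::ab_group_add \<Rightarrow> 'h::ab_group_add"
  assumes "\<And>x y. A (x + y) = A x + A y"
  shows "A (zmul k x) = zmul k (A x)"
  by (simp add: zmul_def additive_sum[of A, OF assms] additive_minus[of A, OF assms])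

lemma additive_funpow:
  fixes A :: "'g::ab_group_add \<Rightarrow> 'g"
  assumes "\<And>x y. A (x + y) = A x + A y"
  shows "(A ^^ n) (x + y) = (A ^^ n) x + (A ^^ n) y"
  by (induction n) (simp_all add: assms)

section \<open>Independence, spans and denominators over the integers\<close>

definition zindep :: "nat \<Rightarrow> (nat \<Rightarrow> 'g::ab_group_add) \<Rightarrow> bool" where
  "zindep n e \<longleftrightarrow> (\<forall>c. (\<Sum>i<n. zmul (c i) (e i)) = 0 \<longrightarrow> (\<forall>i<n. c i = 0))"

definition zspan :: "nat \<Rightarrow> (nat \<Rightarrow> 'g::ab_group_add) \<Rightarrow> 'g set" where
  "zspan n e = range (\<lambda>c. \<Sum>i<n. zmul (c i) (e i))"

lemma zspanI: "(\<Sum>i<n. zmul (c i) (e i)) \<in> zspan n e"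
  by (simp add: zspan_def)

lemma zspan_0: "0 \<in> zspan n e"
  using zspanI[where n = n and c = "\<lambda>_. 0" and e = e] by simp

lemma zspan_add: "x \<in> zspan n e \<Longrightarrow> y \<in> zspan n e \<Longrightarrow> x + y \<in> zspan n e"
proof -
  assume "x \<in> zspan n e" "y \<in> zspan n e"
  then obtain c d where cd: "x = (\<Sum>i<n. zmul (c i) (e i))" "y = (\<Sum>i<n. zmul (d i) (e i))"
    by (auto simp: zspan_def)
  show ?thesis using zspanI[where n = n and c = "\<lambda>i. c i + d i" and e = e] unfolding cd by (simp add: zmul_add_left sum.distrib)
qed

lemma zspan_zmul: "x \<in> zspan n e \<Longrightarrow> zmul k x \<in> zspan n e"
proof -
  assume "x \<in> zspan n e"
  then obtain c where c: "x = (\<Sum>i<n. zmul (c i) (e i))" by (auto simp: zspan_def)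
  show ?thesis using zspanI[where n = n and c = "\<lambda>i. k * c i" and e = e] unfolding c by (simp add: zmul_sum_right zmul_mult)
qed

lemma zspan_minus: "x \<in> zspan n e \<Longrightarrow> - x \<in> zspan n e"
  using zspan_zmul[of x n e "-1"] by (simp add: zmul_minus_left)

lemma zspan_sum: "(\<And>i. i \<in> I \<Longrightarrow> f i \<in> zspan n e) \<Longrightarrow> sum f I \<in> zspan n e"
  by (induction I rule: infinite_finite_induct) (auto simp: zspan_0 zspan_add)

lemma zspan_base:
  assumes "j < n"
  shows "e j \<in> zspan n e"
proof -
  have "(\<Sum>i<n. zmul (if i = j then 1 else 0) (e i)) = (\<Sum>i<n. if i = j then e i else 0)"
    by (intro sum.cong) auto
  also have "\<dots> = e j" using assms by simp
  finally show ?thesis using zspanI[where c = "\<lambda>i. if i = j then 1 else 0" and n = n and e = e] by simp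
qed

text \<open>Adjoining \<open>x\<close> to a maximal independent family creates a relation, and
  independence of the family makes the coefficient of \<open>x\<close> in it nonzero.\<close>

lemma zindep_maximal_multiple_in_zspan:
  fixes e :: "nat \<Rightarrow> 'g::ab_group_add"
  assumes ind: "zindep d e" and max: "\<And>f :: nat \<Rightarrow> 'g. \<not> zindep (Suc d) f"
  shows "\<exists>k>0. zmul k x \<in> zspan d e"
proof -
  define f where "f i = (if i < d then e i else x)" for i
  obtain c i0 where c: "(\<Sum>i<Suc d. zmul (c i) (f i)) = 0" and i0: "i0 < Suc d" "c i0 \<noteq> 0"
    using max[of f] by (auto simp: zindep_def)
  have split: "(\<Sum>i<d. zmul (c i) (e i)) + zmul (c d) x = 0"
    using c by (simp add: f_def)
  have cd: "c d \<noteq> 0"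
  proof
    assume "c d = 0"
    then have "\<forall>i<d. c i = 0" using split ind by (auto simp: zindep_def)
    then show False using i0 \<open>c d = 0\<close> less_Suc_eq by auto
  qed
  have "zmul (c d) x = - (\<Sum>i<d. zmul (c i) (e i))"
    using split by (simp add: eq_neg_iff_add_eq_0 add.commute)
  then have in1: "zmul (c d) x \<in> zspan d e" by (metis zspanI zspan_minus)
  then have in2: "zmul (- c d) x \<in> zspan d e" by (simp add: zmul_minus_left zspan_minus)
  show ?thesis
  proof (cases "c d > 0")
    case False
    then have "- c d > 0" using cd by simp
    then show ?thesis using in2 by blast
  qed (use in1 in blast)
qed

text \<open>Clears finitely many denominators at once: \<open>P i k\<close> is read as
  "\<open>k\<close> is a denominator for \<open>i\<close>", and multiples of denominators are
  denominators.\<close>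

lemma common_multiple:
  fixes P :: "'b \<Rightarrow> int \<Rightarrow> bool"
  assumes "finite I" "\<And>i. i \<in> I \<Longrightarrow> \<exists>k>0. P i k" "\<And>i k j. i \<in> I \<Longrightarrow> P i k \<Longrightarrow> P i (j * k)"
  shows "\<exists>k>0. \<forall>i\<in>I. P i k"
  using assms
proof (induction I rule: finite_induct)
  case empty
  show ?case by (intro exI[of _ 1]) auto
next
  case (insert a I)
  then obtain k where k: "k > 0" "\<forall>i\<in>I. P i k" by blast
  obtain l where l: "l > 0" "P a l" using insert.prems(1) by blast
  have "P a (k * l)" using insert.prems(2)[of a] l(2) by blast
  moreover have "\<forall>i\<in>I. P i (l * k)" using insert.prems(2) k(2) by blast
  ultimately show ?case using k(1) l(1) by (intro exI[of _ "k * l"]) (auto simp: mult.commute)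
qed

text \<open>Pascal's rule, as the inductive step in expanding \<open>(1 + q M) ^ n\<close>. The
  sequence \<open>w\<close> is arbitrary, so that it may consist of the iterates of a map
  \<open>M\<close> that is merely chosen pointwise.\<close>

lemma sum_binomial_Suc:
  fixes w :: "nat \<Rightarrow> 'g::ab_group_add"
  shows "(\<Sum>j\<le>Suc n. zmul (int (Suc n choose j) * q ^ j) (w j)) =
    (\<Sum>j\<le>n. zmul (int (n choose j) * q ^ j) (w j)) +
    zmul q (\<Sum>j\<le>n. zmul (int (n choose j) * q ^ j) (w (Suc j)))"
proof -
  have ext: "(\<Sum>j\<le>n. zmul (int (n choose j) * q ^ j) (w j)) =
      w 0 + (\<Sum>j\<le>n. zmul (int (n choose Suc j) * q ^ Suc j) (w (Suc j)))"
    using sum.atMost_Suc_shift[of "\<lambda>j. zmul (int (n choose j) * q ^ j) (w j)" n] by (simp add: binomial_eq_0)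
  have "(\<Sum>j\<le>Suc n. zmul (int (Suc n choose j) * q ^ j) (w j)) =
      w 0 + (\<Sum>j\<le>n. zmul (int (Suc n choose Suc j) * q ^ Suc j) (w (Suc j)))"
    by (subst sum.atMost_Suc_shift) simp
  also have "\<dots> = w 0 + (\<Sum>j\<le>n. zmul (int (n choose Suc j) * q ^ Suc j) (w (Suc j))
       + zmul (q * (int (n choose j) * q ^ j)) (w (Suc j)))"
    by (intro arg_cong2[where f = "(+)"] sum.cong refl)
       (simp add: algebra_simps flip: zmul_add_left)
  finally show ?thesis unfolding ext by (simp add: sum.distrib zmul_sum_right zmul_mult add.assoc)
qed

lemma zspan_hom:
  assumes add: "\<And>x y. B (x + y) = B x + B y" and "\<And>j. j < d \<Longrightarrow> B (e j) \<in> zspan d' e'"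
    and "x \<in> zspan d e"
  shows "B x \<in> zspan d' e'"
proof -
  obtain c where c: "x = (\<Sum>i<d. zmul (c i) (e i))" using assms(3) by (auto simp: zspan_def)
  have "B x = (\<Sum>i<d. zmul (c i) (B (e i)))"
    unfolding c additive_sum[of B, OF add] additive_zmul[of B, OF add] ..
  then show ?thesis using assms(2) by (auto intro: zspan_sum zspan_zmul)
qed

lemma zspan_zmul_iff: "x \<in> zspan d (\<lambda>i. zmul q (e i)) \<longleftrightarrow> (\<exists>y\<in>zspan d e. x = zmul q y)"
proof -
  have "(\<Sum>i<d. zmul (c i) (zmul q (e i))) = zmul q (\<Sum>i<d. zmul (c i) (e i))" for c
    by (simp add: zmul_sum_right flip: zmul_mult) (simp add: mult.commute)
  then show ?thesis by (auto simp: zspan_def)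
qed

text \<open>Injectivity enters through reduction modulo \<open>q\<close>: an injective endomorphism
  of a lattice has finite cokernel, hence is invertible modulo \<open>q\<close> once the prime
  avoids the cokernel, and invertible maps of a finite quotient have periodic powers.\<close>

theorem additive_orbit_sum_zeros:
  fixes A :: "'i \<Rightarrow> 'g::ab_group_add \<Rightarrow> 'g"
  assumes tf: "\<And>k (x::'g). zmul k x = 0 \<Longrightarrow> k = 0 \<or> x = 0"
    and rank: "\<And>f :: nat \<Rightarrow> 'g. \<not> zindep r f"
    and fin: "finite I"
    and add: "\<And>i x y. i \<in> I \<Longrightarrow> A i (x + y) = A i x + A i y"
    and inj: "\<And>i. i \<in> I \<Longrightarrow> inj (A i)"
  shows "\<exists>N\<ge>1. \<forall>k v. (\<forall>n. (\<Sum>i\<in>I. (A i ^^ (k + n * N)) (v i)) = 0) \<or>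
    finite {n. (\<Sum>i\<in>I. (A i ^^ (k + n * N)) (v i)) = 0}"
proof -
  have "\<exists>d e. zindep d (e :: nat \<Rightarrow> 'g) \<and> (\<forall>f :: nat \<Rightarrow> 'g. \<not> zindep (Suc d) f)"
  proof (rule ccontr)
    assume none: "\<not> ?thesis"
    have "\<exists>e :: nat \<Rightarrow> 'g. zindep d e" for d
    proof (induction d)
      case 0
      show ?case by (auto simp: zindep_def)
    qed (use none in blast)
    then show False using rank by blast
  qed
  then obtain d and e :: "nat \<Rightarrow> 'g"
    where ind: "zindep d e" and max: "\<And>f :: nat \<Rightarrow> 'g. \<not> zindep (Suc d) f" by blast
  define L where "L = zspan d e"

  \<comment> \<open>The maps \<open>A i\<close> may leave the lattice. One denominator
    \<open>D\<close> for all \<open>i\<close> makes every \<open>C i\<close> preserve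
    \<open>L\<close>, and its powers can later be pulled out of the whole sum.\<close>
  have "\<exists>D>0. \<forall>ij\<in>I \<times> {..<d}. zmul D (A (fst ij) (e (snd ij))) \<in> L"
  proof (rule common_multiple)
    fix ij assume "ij \<in> I \<times> {..<d}"
    show "\<exists>k>0. zmul k (A (fst ij) (e (snd ij))) \<in> L"
      unfolding L_def by (rule zindep_maximal_multiple_in_zspan[OF ind max])
  qed (use fin in \<open>auto simp: L_def zmul_mult zspan_zmul\<close>)
  then obtain D where D: "D > 0" "\<And>i j. i \<in> I \<Longrightarrow> j < d \<Longrightarrow> zmul D (A i (e j)) \<in> L" by auto
  define C where "C i x = zmul D (A i x)" for i x
  have Cadd: "C i (x + y) = C i x + C i y" if "i \<in> I" for i x y
    using that by (simp add: C_def add zmul_add_right)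
  note Czmul = additive_zmul[of "C i" for i, OF Cadd]
  note Csum = additive_sum[of "C i" for i, OF Cadd]
  have CL: "C i x \<in> L" if "i \<in> I" "x \<in> L" for i x
    using zspan_hom[of "C i" d e d e x] that D(2) Cadd by (auto simp: L_def C_def)
  have CnL: "(C i ^^ n) x \<in> L" if "i \<in> I" "x \<in> L" for i x n
    using that by (induction n) (auto simp: CL)
  have Cnadd: "(C i ^^ n) (x + y) = (C i ^^ n) x + (C i ^^ n) y" if "i \<in> I" for i x y n
    using additive_funpow[of "C i"] Cadd[OF that] by blast
  note Cnzmul = additive_zmul[of "C i ^^ n" for i n, OF Cnadd]
  have C0: "x = 0" if "i \<in> I" "C i x = 0" for i x
  proof -
    have "A i x = 0" using that(2) tf D(1) unfolding C_def by fastforce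
    also have "0 = A i 0" using additive_0[of "A i"] add[OF that(1)] by simp
    finally show ?thesis using inj[OF that(1)] by (simp add: inj_eq)
  qed

  have sumC: "(\<Sum>l<d. zmul (c l) (C i (e l))) = C i (\<Sum>l<d. zmul (c l) (e l))" if "i \<in> I" for i c
    by (simp add: Csum[OF that] Czmul[OF that])
  have image: "zspan d (\<lambda>l. C i (e l)) = C i ` L" if "i \<in> I" for i
    unfolding zspan_def L_def sumC[OF that] by auto
  \<comment> \<open>Since \<open>C i\<close> is injective, the image of \<open>L\<close> has full
    rank and contains \<open>E\<close> times each basis vector. A prime above \<open>E\<close> then
    makes \<open>C i\<close> surjective modulo its square.\<close>
  have "\<exists>E>0. \<forall>ij\<in>I \<times> {..<d}. zmul E (e (snd ij)) \<in> C (fst ij) ` L"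
  proof (rule common_multiple)
    fix ij assume ij: "ij \<in> I \<times> {..<d}"
    obtain i j where [simp]: "ij = (i, j)" by force
    have i: "i \<in> I" using ij by simp
    have "zindep d (\<lambda>l. C i (e l))"
      using ind C0[OF i] unfolding zindep_def sumC[OF i] by blast
    then have "\<exists>k>0. zmul k (e j) \<in> zspan d (\<lambda>l. C i (e l))"
      by (rule zindep_maximal_multiple_in_zspan[OF _ max])
    then show "\<exists>k>0. zmul k (e (snd ij)) \<in> C (fst ij) ` L" by (simp add: image[OF i])
  next
    fix ij k j assume "ij \<in> I \<times> {..<d}" "zmul k (e (snd ij)) \<in> C (fst ij) ` L"
    then obtain y where "fst ij \<in> I" "y \<in> L" "zmul k (e (snd ij)) = C (fst ij) y" by auto
    then have "zmul (j * k) (e (snd ij)) = C (fst ij) (zmul j y)" "zmul j y \<in> L"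
      by (auto simp: zmul_mult Czmul L_def zspan_zmul)
    then show "zmul (j * k) (e (snd ij)) \<in> C (fst ij) ` L" by blast
  qed (use fin in auto)
  then obtain E where E: "E > 0" "\<And>i j. i \<in> I \<Longrightarrow> j < d \<Longrightarrow> zmul E (e j) \<in> C i ` L" by auto
  obtain p :: nat where p: "prime p" "nat E < p" using bigger_prime by blast
  define q where "q = (int p)\<^sup>2"
  have "\<not> p dvd nat E" using p E(1) by (auto dest!: dvd_imp_le)
  then have "coprime (int p) E" using p(1) E(1)
    by (metis coprime_int_iff int_nat_eq less_imp_le prime_imp_coprime)
  then have "coprime E q" by (simp add: q_def coprime_commute)
  then obtain u w where uw: "u * E + w * q = 1" using bezout_int[of E q] by auto
  have q0: "q > 0" using p(1) prime_gt_0_nat by (simp add: q_def)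

  define qL where "qL = zspan d (\<lambda>i. zmul q (e i))"
  have qL_iff: "x \<in> qL \<longleftrightarrow> (\<exists>y\<in>L. x = zmul q y)" for x
    unfolding qL_def L_def by (rule zspan_zmul_iff)
  have qL_add: "x + y \<in> qL" if "x \<in> qL" "y \<in> qL" for x y using that unfolding qL_def by (rule zspan_add)
  have qL_minus: "- x \<in> qL" if "x \<in> qL" for x using that unfolding qL_def by (rule zspan_minus)
  have CqL: "C i x \<in> qL" if "i \<in> I" "x \<in> qL" for i x
    using that CL unfolding qL_iff by (auto simp: Czmul)
  have CnqL: "(C i ^^ n) x \<in> qL" if "i \<in> I" "x \<in> qL" for i x n
    using that by (induction n) (auto simp: CqL)
  have surj1: "\<exists>y\<in>L. x - C i y \<in> qL" if i: "i \<in> I" and x: "x \<in> L" for i x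
  proof -
    have hom: "zmul E (x + y) = zmul E x + zmul E y" for x y :: 'g by (rule zmul_add_right)
    have im: "zspan d (\<lambda>l. C i (e l)) = C i ` L"
      by (rule image[OF i])
    have "zmul E x \<in> zspan d (\<lambda>l. C i (e l))"
      by (rule zspan_hom[of "zmul E", OF hom]) (use E(2)[OF i] x in \<open>auto simp: im L_def\<close>)
    then obtain y where y: "y \<in> L" "zmul E x = C i y" unfolding im by blast
    have "x = zmul (u * E + w * q) x" using uw by simp
    also have "\<dots> = C i (zmul u y) + zmul q (zmul w x)"
      by (simp add: zmul_add_left zmul_mult y(2) Czmul[OF i] mult.commute[of w])
    finally have "x - C i (zmul u y) = zmul q (zmul w x)" by (simp add: algebra_simps)
    moreover have "zmul u y \<in> L" "zmul w x \<in> L" using x y(1) by (auto simp: L_def zspan_zmul)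
    ultimately show ?thesis using qL_iff by blast
  qed
  have surj: "\<exists>y\<in>L. x - (C i ^^ a) y \<in> qL" if i: "i \<in> I" and x: "x \<in> L" for i x a
    using x
  proof (induction a arbitrary: x)
    case 0
    then show ?case by (intro bexI[of _ x]) (auto simp: qL_def zspan_0)
  next
    case (Suc a)
    obtain y where y: "y \<in> L" "x - C i y \<in> qL" using surj1[OF i Suc.prems] by blast
    obtain z where z: "z \<in> L" "y - (C i ^^ a) z \<in> qL" using Suc.IH[OF y(1)] by blast
    have "C i y = C i (y - (C i ^^ a) z) + (C i ^^ Suc a) z"
      using Cadd[OF i, of "y - (C i ^^ a) z" "(C i ^^ a) z"] by simp
    then have "x - (C i ^^ Suc a) z = (x - C i y) + C i (y - (C i ^^ a) z)" by (simp add: algebra_simps)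
    then show ?case using qL_add[OF y(2) CqL[OF i z(2)]] z(1) by (metis (no_types))
  qed

  define cf where "cf x = (SOME c. x = (\<Sum>l<d. zmul (c l) (e l)))" for x
  have cf: "x = (\<Sum>l<d. zmul (cf x l) (e l))" if "x \<in> L" for x
  proof -
    have "\<exists>c. x = (\<Sum>l<d. zmul (c l) (e l))" using that by (auto simp: L_def zspan_def)
    then show ?thesis unfolding cf_def by (rule someI_ex)
  qed
  define J where "J = I \<times> {..<d} \<times> {..<d}"
  \<comment> \<open>The matrices of \<open>C i ^^ a\<close> modulo \<open>q\<close>, for all
    \<open>i\<close> at once: there are finitely many such tuples, so two exponents agree
    simultaneously for every \<open>i\<close>.\<close>
  define F where "F a = restrict (\<lambda>(i, j, l). cf ((C i ^^ a) (e j)) l mod q) J" for a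
  have "F ` UNIV \<subseteq> J \<rightarrow>\<^sub>E {0..<q}" using q0 by (auto simp: F_def)
  moreover have "finite (J \<rightarrow>\<^sub>E {0..<q})" using fin by (auto simp: J_def intro!: finite_PiE)
  ultimately have "finite (F ` UNIV)" by (rule finite_subset)
  then have "\<not> inj F" using finite_imageD infinite_UNIV_nat by blast
  then obtain a0 b0 where "F a0 = F b0" "a0 \<noteq> b0" unfolding inj_def by blast
  then obtain a b where ab: "a < b" "F a = F b" by (metis linorder_neqE_nat)
  have Cab: "(C i ^^ b) x - (C i ^^ a) x \<in> qL" if i: "i \<in> I" and x: "x \<in> L" for i x
    unfolding qL_def
  proof (rule zspan_hom[where d = d and e = e and B = "\<lambda>x. (C i ^^ b) x - (C i ^^ a) x"])
    fix j assume j: "j < d"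
    have ejL: "e j \<in> L" using j by (simp add: L_def zspan_base)
    have "q dvd cf ((C i ^^ b) (e j)) l - cf ((C i ^^ a) (e j)) l" if "l < d" for l
    proof -
      have "F a (i, j, l) = F b (i, j, l)" using ab by simp
      then have "cf ((C i ^^ a) (e j)) l mod q = cf ((C i ^^ b) (e j)) l mod q"
        using i j that by (simp add: F_def J_def)
      then show ?thesis by (metis mod_eq_dvd_iff)
    qed
    then have "\<forall>l. \<exists>t. l < d \<longrightarrow> cf ((C i ^^ b) (e j)) l - cf ((C i ^^ a) (e j)) l = t * q"
      by (metis dvd_def mult.commute)
    then obtain t where t: "\<And>l. l < d \<Longrightarrow> cf ((C i ^^ b) (e j)) l - cf ((C i ^^ a) (e j)) l = t l * q"
      by metis
    have "(C i ^^ b) (e j) - (C i ^^ a) (e j) =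
      (\<Sum>l<d. zmul (cf ((C i ^^ b) (e j)) l - cf ((C i ^^ a) (e j)) l) (e l))"
      using cf[OF CnL[OF i ejL, of b]] cf[OF CnL[OF i ejL, of a]]
      by (simp add: zmul_diff_left sum_subtractf)
    also have "\<dots> = (\<Sum>l<d. zmul (t l) (zmul q (e l)))" by (simp add: t zmul_mult)
    finally show "(C i ^^ b) (e j) - (C i ^^ a) (e j) \<in> zspan d (\<lambda>i. zmul q (e i))"
      by (simp add: zspanI)
  qed (use x i Cnadd in \<open>auto simp: L_def algebra_simps\<close>)
  define N where "N = b - a"
  have N: "N \<ge> 1" "b = N + a" using ab by (auto simp: N_def)
  \<comment> \<open>Surjectivity of \<open>C i ^^ a\<close> modulo \<open>q\<close> allows
    cancelling it in the congruence between \<open>C i ^^ b\<close> and \<open>C i ^^ a\<close>: up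
    to an element of \<open>qL\<close>, \<open>x\<close> is of the form
    \<open>(C i ^^ a) y\<close>.\<close>
  have "\<exists>y. y \<in> L \<and> (C i ^^ N) x = x + zmul q y" if i: "i \<in> I" and x: "x \<in> L" for i x
  proof -
    obtain y where y: "y \<in> L" "x - (C i ^^ a) y \<in> qL" using surj[OF i x] by blast
    define z where "z = x - (C i ^^ a) y"
    have xz: "x = z + (C i ^^ a) y" by (simp add: z_def)
    have "(C i ^^ N) x = (C i ^^ N) z + (C i ^^ b) y"
      by (subst xz) (simp add: Cnadd[OF i] N(2) funpow_add)
    then have "(C i ^^ N) x - x = (C i ^^ N) z + ((C i ^^ b) y - (C i ^^ a) y) + (- z)"
      by (simp add: xz)
    also have "\<dots> \<in> qL" using y(2) unfolding z_def[symmetric]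
      by (intro qL_add qL_minus CnqL Cab i y(1))
    finally obtain t where "t \<in> L" "(C i ^^ N) x - x = zmul q t" unfolding qL_iff by blast
    then show ?thesis by (intro exI[of _ t]) (auto simp: algebra_simps)
  qed
  then obtain M where M: "\<And>i x. i \<in> I \<Longrightarrow> x \<in> L \<Longrightarrow> M i x \<in> L \<and> (C i ^^ N) x = x + zmul q (M i x)"
    by metis
  have MnL: "(M i ^^ j) x \<in> L" if "i \<in> I" "x \<in> L" for i j x
    using that M by (induction j) auto
  \<comment> \<open>Binomial expansion of the powers of \<open>1 + q M\<close>. As \<open>M\<close>
    is only a choice function, the induction peels off the innermost application and relies on
    additivity of \<open>C i\<close>.\<close>
  have CNn: "((C i ^^ N) ^^ n) x = (\<Sum>j\<le>n. zmul (int (n choose j) * q ^ j) ((M i ^^ j) x))"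
    if i: "i \<in> I" and x: "x \<in> L" for i n x
    using x
  proof (induction n arbitrary: x)
    case (Suc n)
    have CNadd: "((C i ^^ N) ^^ n) (x + y) = ((C i ^^ N) ^^ n) x + ((C i ^^ N) ^^ n) y" for x y
      using Cnadd[OF i] by (simp add: funpow_mult)
    have "((C i ^^ N) ^^ Suc n) x = ((C i ^^ N) ^^ n) (x + zmul q (M i x))"
      using M[OF i Suc.prems] by (simp only: funpow_Suc_right comp_apply)
    also have "\<dots> = ((C i ^^ N) ^^ n) x + zmul q (((C i ^^ N) ^^ n) (M i x))"
      using additive_zmul[of "(C i ^^ N) ^^ n", OF CNadd] by (simp add: CNadd)
    also have "\<dots> = (\<Sum>j\<le>n. zmul (int (n choose j) * q ^ j) ((M i ^^ j) x))
       + zmul q (\<Sum>j\<le>n. zmul (int (n choose j) * q ^ j) ((M i ^^ Suc j) x))"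
      using M[OF i Suc.prems] Suc.prems by (simp only: Suc.IH funpow_Suc_right comp_apply)
    finally show ?case by (simp only: sum_binomial_Suc)
  qed simp

  have "(\<forall>n. (\<Sum>i\<in>I. (A i ^^ (k + n * N)) (v i)) = 0) \<or>
    finite {n. (\<Sum>i\<in>I. (A i ^^ (k + n * N)) (v i)) = 0}" for k v
  proof -
    have "\<exists>K>0. \<forall>i\<in>I. zmul K (v i) \<in> L"
    proof (rule common_multiple)
      show "\<exists>k>0. zmul k (v i) \<in> L" for i
        unfolding L_def by (rule zindep_maximal_multiple_in_zspan[OF ind max])
    qed (use fin in \<open>auto simp: L_def zmul_mult zspan_zmul\<close>)
    then obtain K where K: "K > 0" "\<And>i. i \<in> I \<Longrightarrow> zmul K (v i) \<in> L" by auto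
    define x where "x i = (C i ^^ k) (zmul K (v i))" for i
    have xL: "x i \<in> L" if "i \<in> I" for i using that K(2) CnL by (simp add: x_def)
    define U where "U n = (\<Sum>i\<in>I. ((C i ^^ N) ^^ n) (x i))" for n
    have CA: "(C i ^^ n) y = zmul (D ^ n) ((A i ^^ n) y)" if "i \<in> I" for i n y
    proof (induction n)
      case (Suc n)
      then show ?case using additive_zmul[of "A i", OF add[OF that]]
        by (simp add: C_def zmul_mult)
    qed simp
    have "U n = zmul (D ^ (k + n * N) * K) (\<Sum>i\<in>I. (A i ^^ (k + n * N)) (v i))" for n
    proof -
      have "((C i ^^ N) ^^ n) (x i) = zmul (D ^ (k + n * N) * K) ((A i ^^ (k + n * N)) (v i))"
        if i: "i \<in> I" for i
      proof -
        have "((C i ^^ N) ^^ n) (x i) = (C i ^^ (N * n + k)) (zmul K (v i))"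
          by (simp add: x_def funpow_mult funpow_add)
        also have "N * n + k = k + n * N" by simp
        also have "(C i ^^ (k + n * N)) (zmul K (v i)) = zmul K ((C i ^^ (k + n * N)) (v i))"
          by (rule Cnzmul[OF i])
        also have "\<dots> = zmul (D ^ (k + n * N) * K) ((A i ^^ (k + n * N)) (v i))"
          by (simp add: CA[OF i] flip: zmul_mult) (simp add: mult.commute)
        finally show ?thesis .
      qed
      then show ?thesis by (simp add: U_def zmul_sum_right)
    qed
    moreover have "D ^ (k + n * N) * K \<noteq> 0" for n using D(1) K(1) by simp
    ultimately have U0: "U n = 0 \<longleftrightarrow> (\<Sum>i\<in>I. (A i ^^ (k + n * N)) (v i)) = 0" for n
      using tf by (metis zmul_0_right)
    define w where "w j = (\<Sum>i\<in>I. (M i ^^ j) (x i))" for j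
    have wL: "w j \<in> L" for j unfolding w_def L_def by (rule zspan_sum) (use MnL xL L_def in blast)
    \<comment> \<open>The coordinates of \<open>U n\<close> have the shape treated in
      \<open>binomial_series_zeros\<close>, and independence of \<open>e\<close> makes
      \<open>U n\<close> vanish exactly when all of them do.\<close>
    define B where "B l n = (\<Sum>j\<le>n. int (n choose j) * q ^ j * cf (w j) l)" for l n
    have UB: "U n = (\<Sum>l<d. zmul (B l n) (e l))" for n
    proof -
      have "U n = (\<Sum>i\<in>I. \<Sum>j\<le>n. zmul (int (n choose j) * q ^ j) ((M i ^^ j) (x i)))"
        unfolding U_def using CNn xL by simp
      also have "\<dots> = (\<Sum>j\<le>n. zmul (int (n choose j) * q ^ j) (w j))"
        by (subst sum.swap) (simp add: w_def zmul_sum_right)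
      also have "\<dots> = (\<Sum>j\<le>n. \<Sum>l<d. zmul (int (n choose j) * q ^ j * cf (w j) l) (e l))"
        by (subst cf[OF wL]) (simp add: zmul_sum_right zmul_mult)
      also have "\<dots> = (\<Sum>l<d. zmul (B l n) (e l))"
        by (subst sum.swap) (simp add: B_def zmul_sum_left)
      finally show ?thesis .
    qed
    have UB0: "U n = 0 \<longleftrightarrow> (\<forall>l<d. B l n = 0)" for n
      using ind unfolding zindep_def UB by auto
    show ?thesis
    proof (cases "finite {n. U n = 0}")
      case True
      then show ?thesis by (simp add: U0)
    next
      case False
      have "B l t = 0" if "l < d" for l t
        unfolding B_def q_def
      proof (rule binomial_series_zeros[OF p(1)])
        have "{n. U n = 0} \<subseteq> {n. B l n = 0}" using that UB0 by auto
        then show "infinite {n. (\<Sum>j\<le>n. int (n choose j) * (int p)\<^sup>2 ^ j * cf (w j) l) = 0}"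
          using False finite_subset unfolding B_def q_def by blast
      qed
      then show ?thesis using UB0 U0 by blast
    qed
  qed
  then show ?thesis using N(1) by blast
qed

subsection \<open>Covering dimension\<close>

lemma compact_Pi_UNIV:
  fixes S :: "'i \<Rightarrow> 'b::topological_space set"
  assumes "\<And>i. compact (S i)"
  shows "compact {f. \<forall>i. f i \<in> S i}"
proof -
  have "compactin (product_topology (\<lambda>i. euclidean) UNIV) (PiE UNIV S)"
    unfolding compactin_PiE using assms by (auto simp: compactin_euclidean_iff)
  moreover have "PiE UNIV S = {f. \<forall>i. f i \<in> S i}" by auto
  ultimately show ?thesis by (simp add: euclidean_product_topology compactin_euclidean_iff)
qed

text \<open>The weights \<open>(1/2) ^ n\<close> of the product metric add up to 2.\<close>

lemma dist_fun_le_const: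
  fixes x y :: "'i::countable \<Rightarrow> 'b::metric_space"
  assumes "\<And>i. dist (x i) (y i) \<le> e"
  shows "dist x y \<le> 2 * e"
proof -
  have "dist x y \<le> (\<Sum>n. (1/2) ^ n * e)"
    unfolding dist_fun_def
  proof (rule suminf_le)
    show "summable (\<lambda>n. (1/2) ^ n * min (dist (x (from_nat n)) (y (from_nat n))) 1)"
      by (rule summable_comparison_test'[of "\<lambda>n. (1/2)^n"]) (auto simp: summable_geometric_iff)
    show "summable (\<lambda>n. (1/2::real) ^ n * e)"
      by (intro summable_mult2) (simp add: summable_geometric_iff)
  qed (use assms in \<open>auto intro!: mult_left_mono min.coboundedI1\<close>)
  also have "\<dots> = 2 * e"
    by (subst suminf_mult2[symmetric]) (auto simp: summable_geometric_iff suminf_geometric)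
  finally show ?thesis .
qed

text \<open>Lebesgue's covering theorem for the cube \<open>[0,1]\<^sup>N\<close>. The cube is embedded in \<open>[0,1]\<close>-valued
  sequences because \<open>N\<close> is not available as a type; only the first \<open>N\<close> coordinates matter.\<close>

lemma covering_dim_opposite_faces:
  fixes g :: "(nat \<Rightarrow> real) \<Rightarrow> 'a::topological_space"
  assumes dim: "covering_dim_le (euclidean :: 'a topology) n"
    and cont: "continuous_on {t. \<forall>i. t i \<in> {0..1}} g"
    and closed: "\<And>i. closed (F i)" "\<And>i. closed (G i)"
    and disj: "\<And>i. F i \<inter> G i = {}"
    and F: "\<And>t i. i \<le> n \<Longrightarrow> (\<forall>j. t j \<in> {0..1}) \<Longrightarrow> t i = 0 \<Longrightarrow> g t \<in> F i"
    and G: "\<And>t i. i \<le> n \<Longrightarrow> (\<forall>j. t j \<in> {0..1}) \<Longrightarrow> t i = 1 \<Longrightarrow> g t \<in> G i"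
  shows False
proof -
  \<comment> \<open>One more than the dimension bound: a simplex carrying all labels has
    \<open>N + 1 = n + 2\<close> vertices, which exceeds the allowed multiplicity
    \<open>n + 1\<close>.\<close>
  define N where "N = Suc n"
  define Q :: "(nat \<Rightarrow> real) set" where "Q = {t. \<forall>i. t i \<in> {0..1}}"
  \<comment> \<open>For each pair of opposite faces \<open>\<epsilon>\<close> decides which one to
    avoid; disjointness of \<open>F i\<close> and \<open>G i\<close> makes these sets a
    cover.\<close>
  define U where "U \<epsilon> = (\<Inter>i<N. if \<epsilon> i then - F i else - G i)" for \<epsilon> :: "nat \<Rightarrow> bool"
  have "open (U \<epsilon>)" for \<epsilon> unfolding U_def using closed by (intro open_INT) auto
  moreover have "x \<in> U (\<lambda>i. x \<notin> F i)" for x unfolding U_def using disj by auto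
  ultimately have "(\<forall>W\<in>range U. openin euclidean W) \<and> \<Union> (range U) = topspace (euclidean :: 'a topology)"
    by auto
  then obtain \<V> where \<V>: "\<And>V. V \<in> \<V> \<Longrightarrow> open V" "\<And>V. V \<in> \<V> \<Longrightarrow> \<exists>\<epsilon>. V \<subseteq> U \<epsilon>" "\<Union>\<V> = UNIV"
      "\<And>x. finite {V \<in> \<V>. x \<in> V}" "\<And>x. card {V \<in> \<V>. x \<in> V} \<le> n + 1"
  proof -
    assume cov: "(\<forall>W\<in>range U. openin euclidean W) \<and> \<Union> (range U) = topspace (euclidean :: 'a topology)"
    assume that: "\<And>\<V>. \<lbrakk>\<And>V. V \<in> \<V> \<Longrightarrow> open V; \<And>V. V \<in> \<V> \<Longrightarrow> \<exists>\<epsilon>. V \<subseteq> U \<epsilon>; \<Union>\<V> = UNIV;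
      \<And>x. finite {V \<in> \<V>. x \<in> V}; \<And>x. card {V \<in> \<V>. x \<in> V} \<le> n + 1\<rbrakk> \<Longrightarrow> thesis"
    have "\<exists>\<V>. (\<forall>V\<in>\<V>. openin euclidean V \<and> (\<exists>W\<in>range U. V \<subseteq> W)) \<and>
        \<Union>\<V> = topspace (euclidean :: 'a topology) \<and>
        (\<forall>x\<in>topspace (euclidean :: 'a topology). finite {V \<in> \<V>. x \<in> V} \<and> card {V \<in> \<V>. x \<in> V} \<le> n + 1)"
      by (rule mp[OF spec[OF dim[unfolded covering_dim_le_def], of "range U"] cov])
    then show thesis
    proof (elim exE conjE, goal_cases)
      case (1 \<V>)
      show thesis
      proof (rule that[of \<V>])
        show "open V" if "V \<in> \<V>" for V using 1(1) that by simp
        show "\<exists>\<epsilon>. V \<subseteq> U \<epsilon>" if "V \<in> \<V>" for V using 1(1) that by fast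
        show "\<Union>\<V> = UNIV" using 1(2) by simp
        show "finite {V \<in> \<V>. x \<in> V}" "card {V \<in> \<V>. x \<in> V} \<le> n + 1" for x using 1(3) by simp_all
      qed
    qed
  qed
  have miss: "V \<inter> F i = {} \<or> V \<inter> G i = {}" if Vi: "V \<in> \<V>" "i < N" for V i
  proof -
    obtain \<epsilon> where "V \<subseteq> U \<epsilon>" using \<V>(2)[OF Vi(1)] by blast
    then have "V \<subseteq> (if \<epsilon> i then - F i else - G i)" using Vi(2) unfolding U_def by blast
    then show ?thesis by (auto split: if_splits)
  qed
  have "\<exists>A. open A \<and> A \<inter> Q = g -` V \<inter> Q" if "V \<in> \<V>" for V
    using cont \<V>(1)[OF that] unfolding continuous_on_open_invariant Q_def by blast
  then obtain O' where O': "\<And>V. V \<in> \<V> \<Longrightarrow> open (O' V)" "\<And>V. V \<in> \<V> \<Longrightarrow> O' V \<inter> Q = g -` V \<inter> Q"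
    by metis
  have comp: "compact Q" unfolding Q_def by (rule compact_Pi_UNIV) auto
  have ne: "O' ` \<V> \<noteq> {}" using \<V>(3) UNIV_not_empty by (metis Union_empty image_is_empty)
  have cov: "Q \<subseteq> \<Union> (O' ` \<V>)"
  proof
    fix t assume t: "t \<in> Q"
    have "g t \<in> \<Union>\<V>" unfolding \<V>(3) by simp
    then obtain V where "V \<in> \<V>" "g t \<in> V" by (rule UnionE)
    then show "t \<in> \<Union> (O' ` \<V>)" using O'(2)[of V] t by blast
  qed
  obtain \<delta> where \<delta>: "0 < \<delta>" "\<And>T. T \<subseteq> Q \<Longrightarrow> diameter T < \<delta> \<Longrightarrow> \<exists>B\<in>O' ` \<V>. T \<subseteq> B"
    by (rule Lebesgue_number_lemma[OF comp ne cov]) (use O'(1) in auto)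
  \<comment> \<open>Cells of radius \<open>1 / p\<close> have width at most \<open>2 / p\<close> in
    each coordinate, hence diameter at most \<open>4 / p\<close> in the product metric.\<close>
  obtain p :: nat where p: "4 / \<delta> < p" using reals_Archimedean2 by blast
  have p0: "0 < p" using p \<delta>(1) by (metis divide_pos_pos gr0I less_asym of_nat_0 zero_less_numeral)
  have p\<delta>: "4 / p < \<delta>" using p \<delta>(1) p0 by (simp add: field_simps)
  define pt where "pt v = (\<lambda>i. real (v i) / real p)" for v :: "nat \<Rightarrow> nat"
  have ptQ: "pt v \<in> Q" if "\<forall>i. v i \<le> p" for v using that p0 by (auto simp: pt_def Q_def)
  define T where "T v = {y \<in> Q. \<forall>i. \<bar>y i - pt v i\<bar> \<le> 1 / p}" for v
  have "\<exists>V\<in>\<V>. g ` T v \<subseteq> V" if v: "\<forall>i. v i \<le> p" for v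
  proof -
    have "dist y z \<le> 2 * (2 / p)" if "y \<in> T v" "z \<in> T v" for y z
    proof (rule dist_fun_le_const)
      fix i
      have "\<bar>y i - pt v i\<bar> \<le> 1 / p" "\<bar>z i - pt v i\<bar> \<le> 1 / p" using that by (auto simp: T_def)
      then have "\<bar>y i - z i\<bar> \<le> 1 / p + 1 / p" by linarith
      then show "dist (y i) (z i) \<le> 2 / p" by (simp add: dist_real_def)
    qed
    moreover have ne: "pt v \<in> T v" using ptQ[OF v] by (simp add: T_def)
    ultimately have "diameter (T v) \<le> 4 / p"
      unfolding diameter_def by (auto intro!: cSUP_least)
    then have "diameter (T v) < \<delta>" using p\<delta> by linarith
    moreover have "T v \<subseteq> Q" by (auto simp: T_def)
    ultimately obtain V where "V \<in> \<V>" "T v \<subseteq> O' V" using \<delta>(2) by blast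
    then show ?thesis using O'(2) \<open>T v \<subseteq> Q\<close> by blast
  qed
  then obtain V where V: "\<And>v. \<forall>i. v i \<le> p \<Longrightarrow> V v \<in> \<V>" "\<And>v. \<forall>i. v i \<le> p \<Longrightarrow> g ` T v \<subseteq> V v"
    by metis
  have gV: "g (pt v) \<in> V v" if "\<forall>i. v i \<le> p" for v
    using V(2)[OF that] ptQ[OF that] by (auto simp: T_def)
  \<comment> \<open>The label of a cover member is the first \<open>G j\<close> that it meets, or
    \<open>N\<close> if it meets none. As the label depends on the member alone, different labels
    certify different members.\<close>
  define cl where "cl W = (LEAST j. j = N \<or> W \<inter> G j \<noteq> {})" for W
  have cl_le: "cl W \<le> N" for W unfolding cl_def by (rule Least_le) simp
  have cl_less: "W \<inter> G j = {}" if "j < cl W" for W j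
    using not_less_Least[of j "\<lambda>j. j = N \<or> W \<inter> G j \<noteq> {}"] that by (auto simp: cl_def)
  have cl_eq: "W \<inter> G (cl W) \<noteq> {}" if "cl W < N" for W
    using LeastI[of "\<lambda>j. j = N \<or> W \<inter> G j \<noteq> {}" N] that by (auto simp: cl_def)
  define c where "c v = cl (V v)" for v
  \<comment> \<open>Kuhn's labels are binary vectors; these are built so that \<open>reduced\<close>
    returns \<open>c v\<close>. Entries beyond \<open>c v\<close> do not affect it and are set to
    obey the boundary conditions.\<close>
  define lab where "lab v j =
    (if j < c v then 0 else if j = c v then 1 else if v j = 0 then 0 else (1::nat))" for v :: "nat \<Rightarrow> nat" and j
  have c0: "x j \<noteq> 0" if x: "\<forall>i. x i \<le> p" and j: "j < N" "j = c x" for x j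
  proof
    assume "x j = 0"
    then have "g (pt x) \<in> F j" using F[of j "pt x"] ptQ[OF x] j(1) by (auto simp: pt_def Q_def N_def)
    then have "V x \<inter> G j = {}" using miss[OF V(1)[OF x] j(1)] gV[OF x] by blast
    then show False using cl_eq[of "V x"] j by (auto simp: c_def)
  qed
  have c1: "x j \<noteq> p" if x: "\<forall>i. x i \<le> p" and j: "j < N" "j < c x" for x j
  proof
    assume "x j = p"
    then have "g (pt x) \<in> G j" using G[of j "pt x"] ptQ[OF x] j(1) p0 by (auto simp: pt_def Q_def N_def)
    then show False using cl_less[of j "V x"] gV[OF x] j by (auto simp: c_def)
  qed
  have "odd (card {s. ksimplex p N s \<and> (reduced N \<circ> lab) ` s = {..N}})"
  proof (rule kuhn_combinatorial[OF p0])
    show "\<forall>x j. (\<forall>j. x j \<le> p) \<and> j < N \<and> x j = 0 \<longrightarrow> lab x j = 0"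
    proof (intro allI impI, elim conjE)
      fix x j assume x: "\<forall>i. x i \<le> p" "j < N" "x j = 0"
      then have "j \<noteq> c x" using c0[of x j] by blast
      then show "lab x j = 0" using x(3) by (simp add: lab_def)
    qed
    show "\<forall>x j. (\<forall>j. x j \<le> p) \<and> j < N \<and> x j = p \<longrightarrow> lab x j = 1"
    proof (intro allI impI, elim conjE)
      fix x j assume x: "\<forall>i. x i \<le> p" "j < N" "x j = p"
      then have "\<not> j < c x" using c1[of x j] by blast
      then show "lab x j = 1" using x(3) p0 by (simp add: lab_def)
    qed
  qed
  then have "{s. ksimplex p N s \<and> (reduced N \<circ> lab) ` s = {..N}} \<noteq> {}"
    by (metis card.empty even_zero)
  then obtain s where s: "ksimplex p N s" "(reduced N \<circ> lab) ` s = {..N}" by blast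
  have red: "reduced N (lab v) = c v" for v
    by (rule reduced_labelling_unique) (use cl_le in \<open>auto simp: lab_def c_def\<close>)
  from s(1) obtain b u where "kuhn_simplex p N b u s" by (auto elim: ksimplex.cases)
  then interpret kuhn_simplex p N b u s .
  obtain v0 where v0: "v0 \<in> s" using base_in_s by blast
  have sp: "\<forall>i. v i \<le> p" if "v \<in> s" for v using s_le_p[OF that] by blast
  \<comment> \<open>Vertices of one simplex differ by at most one grid step, so \<open>pt v0\<close>
    lies in the cell of every vertex and \<open>g (pt v0)\<close> in the member chosen for each of
    them.\<close>
  have "\<exists>W. W \<in> \<V> \<and> g (pt v0) \<in> W \<and> cl W = k" if "k \<le> N" for k
  proof -
    have "k \<in> c ` s" using s(2) that by (auto simp: red image_iff)
    then obtain v where v: "v \<in> s" "c v = k" by blast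
    have "\<bar>real (v0 i) - real (v i)\<bar> \<le> 1" for i
      using le_Suc_base[OF v(1), of i] le_Suc_base[OF v0, of i] base_le[OF v(1), of i] base_le[OF v0, of i]
      by linarith
    then have "\<bar>pt v0 i - pt v i\<bar> \<le> 1 / p" for i
      using p0 by (simp add: pt_def flip: diff_divide_distrib) (simp add: divide_simps)
    then have "pt v0 \<in> T v" using ptQ[OF sp[OF v0]] by (simp add: T_def)
    then show ?thesis using V sp v by (auto simp: c_def intro!: exI[of _ "V v"])
  qed
  then obtain W where W: "\<And>k. k \<le> N \<Longrightarrow> W k \<in> \<V> \<and> g (pt v0) \<in> W k \<and> cl (W k) = k" by metis
  have "inj_on W {..N}" by (rule inj_on_inverseI[of _ cl]) (use W in auto)
  then have "card {..N} \<le> card {V \<in> \<V>. g (pt v0) \<in> V}"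
    using W \<V>(4) by (intro card_inj_on_le[of W]) auto
  then show False using \<V>(5)[of "g (pt v0)"] by (simp add: N_def)
qed

subsection \<open>Positive definite functions\<close>

lemma open_eval_vimage:
  fixes W :: "'b::topological_space set"
  assumes "open W"
  shows "open ((\<lambda>h. h x) -` W)"
  using assms continuous_on_product_coordinates[of x] continuous_on_open_vimage[of UNIV "\<lambda>h. h x"]
  by auto

instance "fun" :: (type, t0_space) t0_space
proof
  fix f g :: "'a \<Rightarrow> 'b"
  assume "f \<noteq> g"
  then obtain x where x: "f x \<noteq> g x" by auto
  obtain U where "open U" "\<not> (f x \<in> U \<longleftrightarrow> g x \<in> U)" using t0_space_class.t0_space[OF x] by blast
  then show "\<exists>U. open U \<and> \<not> (f \<in> U \<longleftrightarrow> g \<in> U)"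
    using open_eval_vimage[of U x] by (intro exI[of _ "(\<lambda>h. h x) -` U"]) auto
qed

instance "fun" :: (type, t1_space) t1_space
proof
  fix f g :: "'a \<Rightarrow> 'b"
  assume "f \<noteq> g"
  then obtain x where x: "f x \<noteq> g x" by auto
  obtain U where "open U" "f x \<in> U" "g x \<notin> U" using t1_space_class.t1_space[OF x] by blast
  then show "\<exists>U. open U \<and> f \<in> U \<and> g \<notin> U"
    using open_eval_vimage[of U x] by (intro exI[of _ "(\<lambda>h. h x) -` U"]) auto
qed

text \<open>Makes compact sets of functions closed, which the search for a minimal face relies
  on.\<close>

instance "fun" :: (type, t2_space) t2_space
proof
  fix f g :: "'a \<Rightarrow> 'b"
  assume "f \<noteq> g"
  then obtain x where x: "f x \<noteq> g x" by auto
  obtain U V where "open U" "open V" "f x \<in> U" "g x \<in> V" "U \<inter> V = {}"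
    using hausdorff[OF x] by blast
  then show "\<exists>U V. open U \<and> open V \<and> f \<in> U \<and> g \<in> V \<and> U \<inter> V = {}"
    using open_eval_vimage[of U x] open_eval_vimage[of V x]
    by (intro exI[of _ "(\<lambda>h. h x) -` U"] exI[of _ "(\<lambda>h. h x) -` V"]) auto
qed

section \<open>Extreme points of compact sets of functions\<close>

lemma chain_finite_Inter_mem:
  assumes "finite B" "B \<noteq> {}" "B \<subseteq> \<C>" "\<And>X Y. X \<in> \<C> \<Longrightarrow> Y \<in> \<C> \<Longrightarrow> X \<subseteq> Y \<or> Y \<subseteq> X"
  shows "\<Inter>B \<in> \<C>"
  using assms(1-3)
proof (induction B rule: finite_ne_induct)
  case (insert X B)
  then show ?case using assms(4)[of X "\<Inter>B"] by (auto simp: Int_absorb1 Int_absorb2)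
qed auto

text \<open>The existence part of the Krein--Milman theorem for the topology of pointwise convergence:
  a minimal closed face is a singleton, since maximising a coordinate cuts out a smaller face.\<close>

lemma compact_extreme_point:
  fixes S :: "('x \<Rightarrow> complex) set"
  assumes "compact S" "S \<noteq> {}"
  obtains \<phi> where "\<phi> \<in> S"
    "\<And>\<phi>1 \<phi>2 t. \<phi>1 \<in> S \<Longrightarrow> \<phi>2 \<in> S \<Longrightarrow> 0 < t \<Longrightarrow> t < 1 \<Longrightarrow>
      \<phi> = (\<lambda>x. of_real t * \<phi>1 x + of_real (1 - t) * \<phi>2 x) \<Longrightarrow> \<phi>1 = \<phi>"
proof -
  define mix :: "real \<Rightarrow> ('x \<Rightarrow> complex) \<Rightarrow> ('x \<Rightarrow> complex) \<Rightarrow> 'x \<Rightarrow> complex" where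
    "mix t \<phi>1 \<phi>2 = (\<lambda>x. of_real t * \<phi>1 x + of_real (1 - t) * \<phi>2 x)" for t \<phi>1 \<phi>2
  define face where "face F \<longleftrightarrow> F \<subseteq> S \<and> closed F \<and> F \<noteq> {} \<and>
    (\<forall>\<phi>1\<in>S. \<forall>\<phi>2\<in>S. \<forall>t. 0 < t \<and> t < 1 \<and> mix t \<phi>1 \<phi>2 \<in> F \<longrightarrow> \<phi>1 \<in> F \<and> \<phi>2 \<in> F)" for F
  have "closed S" using assms(1) by (rule compact_imp_closed)
  then have faceS: "face S" using assms(2) by (auto simp: face_def)
  \<comment> \<open>Zorn's lemma is applied to complements, so that a maximal element is the
    complement of a minimal face; compactness keeps the intersection of a chain of faces
    nonempty.\<close>
  have "\<exists>M\<in>uminus ` Collect face. \<forall>X\<in>uminus ` Collect face. M \<subseteq> X \<longrightarrow> X = M"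
  proof (rule subset_Zorn)
    fix \<C> assume ch: "subset.chain (uminus ` Collect face) \<C>"
    show "\<exists>U\<in>uminus ` Collect face. \<forall>X\<in>\<C>. X \<subseteq> U"
    proof (cases "\<C> = {}")
      case True
      then show ?thesis using faceS by auto
    next
      case False
      define \<F> where "\<F> = uminus ` \<C>"
      have \<F>: "face F" if "F \<in> \<F>" for F
        using ch that unfolding subset.chain_def \<F>_def by auto
      have tot: "X \<subseteq> Y \<or> Y \<subseteq> X" if "X \<in> \<F>" "Y \<in> \<F>" for X Y
        using ch that unfolding subset_chain_def \<F>_def by (auto; blast)
      have ne: "\<F> \<noteq> {}" using False by (simp add: \<F>_def)
      have "S \<inter> \<Inter>\<F> \<noteq> {}"
      proof (rule compact_imp_fip[OF assms(1)])
        show "closed T" if "T \<in> \<F>" for T using \<F>[OF that] by (simp add: face_def)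
        show "S \<inter> \<Inter>B \<noteq> {}" if B: "finite B" "B \<subseteq> \<F>" for B
        proof (cases "B = {}")
          case False
          then have "face (\<Inter>B)" using \<F> chain_finite_Inter_mem[OF B(1) False B(2) tot] by blast
          then show ?thesis unfolding face_def by blast
        qed (use assms(2) in auto)
      qed
      then have "\<Inter>\<F> \<noteq> {}" by blast
      moreover have "\<Inter>\<F> \<subseteq> S" using \<F> ne unfolding face_def by (metis Inf_lower2 all_not_in_conv)
      moreover have "closed (\<Inter>\<F>)" using \<F> unfolding face_def by (blast intro: closed_Inter)
      ultimately have "face (\<Inter>\<F>)"
        unfolding face_def using \<F>[unfolded face_def] by (intro conjI ballI allI impI InterI) blast+
      moreover have "X \<subseteq> - \<Inter>\<F>" if "X \<in> \<C>" for X using that by (auto simp: \<F>_def)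
      ultimately show ?thesis by (intro bexI[of _ "- \<Inter>\<F>"]) auto
    qed
  qed
  then obtain F where F: "face F" "\<And>X. face X \<Longrightarrow> X \<subseteq> F \<Longrightarrow> X = F" by (fastforce simp: image_iff)
  have const: "l \<phi> = l \<psi>"
    if lin: "\<And>t \<phi>1 \<phi>2. l (mix t \<phi>1 \<phi>2) = t * l \<phi>1 + (1 - t) * l \<phi>2"
      and cont: "continuous_on UNIV l" and in_F: "\<phi> \<in> F" "\<psi> \<in> F"
    for l :: "('x \<Rightarrow> complex) \<Rightarrow> real" and \<phi> \<psi>
  proof -
    have compF: "compact F" using F(1) assms(1) unfolding face_def
      by (metis closed_Int_compact inf.absorb1)
    obtain \<mu> where \<mu>: "\<mu> \<in> F" "\<And>\<psi>. \<psi> \<in> F \<Longrightarrow> l \<psi> \<le> l \<mu>"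
      using continuous_attains_sup[OF compF _ continuous_on_subset[OF cont subset_UNIV]] F(1)
      unfolding face_def by metis
    define F' where "F' = F \<inter> {\<phi>. l \<mu> \<le> l \<phi>}"
    have "closed F'" unfolding F'_def using F(1) cont
      by (intro closed_Int closed_Collect_le) (auto simp: face_def)
    moreover have "\<phi>1 \<in> F' \<and> \<phi>2 \<in> F'"
      if in_S: "\<phi>1 \<in> S" "\<phi>2 \<in> S" and t: "0 < t" "t < 1" and mx: "mix t \<phi>1 \<phi>2 \<in> F'" for \<phi>1 \<phi>2 t
    proof -
      have "\<phi>1 \<in> F" "\<phi>2 \<in> F" using F(1) in_S t mx unfolding face_def F'_def by blast+
      moreover have le: "l \<mu> \<le> t * l \<phi>1 + (1 - t) * l \<phi>2" using mx lin by (simp add: F'_def)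
      moreover have "l \<mu> \<le> l \<phi>1"
      proof -
        have "(1 - t) * l \<phi>2 \<le> (1 - t) * l \<mu>" using \<mu>(2)[OF \<open>\<phi>2 \<in> F\<close>] t by (intro mult_left_mono) auto
        then have "t * l \<mu> \<le> t * l \<phi>1" using le by (simp add: algebra_simps)
        then show ?thesis using t by simp
      qed
      moreover have "l \<mu> \<le> l \<phi>2"
      proof -
        have "t * l \<phi>1 \<le> t * l \<mu>" using \<mu>(2)[OF \<open>\<phi>1 \<in> F\<close>] t by (intro mult_left_mono) auto
        then have "(1 - t) * l \<mu> \<le> (1 - t) * l \<phi>2" using le by (simp add: algebra_simps)
        then show ?thesis using t by simp
      qed
      ultimately show ?thesis by (simp add: F'_def)
    qed
    ultimately have "face F'" using F(1) \<mu>(1) unfolding face_def by (auto simp: F'_def)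
    then have "F' = F" using F(2)[of F'] by (simp add: F'_def)
    then show ?thesis using in_F \<mu>(2) unfolding F'_def by (metis (mono_tags, lifting) IntE antisym mem_Collect_eq order_trans)
  qed
  have single: "\<phi> = \<psi>" if "\<phi> \<in> F" "\<psi> \<in> F" for \<phi> \<psi>
  proof
    fix x
    have "Re (\<phi> x) = Re (\<psi> x)"
      by (rule const[where l = "\<lambda>\<phi>. Re (\<phi> x)"]) (use that in \<open>auto simp: mix_def intro!: continuous_intros\<close>)
    moreover have "Im (\<phi> x) = Im (\<psi> x)"
      by (rule const[where l = "\<lambda>\<phi>. Im (\<phi> x)"]) (use that in \<open>auto simp: mix_def intro!: continuous_intros\<close>)
    ultimately show "\<phi> x = \<psi> x" by (rule complex_eqI)
  qed
  obtain \<phi> where \<phi>: "\<phi> \<in> F" using F(1) by (auto simp: face_def)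
  show thesis
  proof (rule that[of \<phi>])
    show "\<phi> \<in> S" using \<phi> F(1) by (auto simp: face_def)
    fix \<phi>1 \<phi>2 t
    assume h: "\<phi>1 \<in> S" "\<phi>2 \<in> S" "0 < t" "t < 1" "\<phi> = (\<lambda>x. of_real t * \<phi>1 x + of_real (1 - t) * \<phi>2 x)"
    then have "mix t \<phi>1 \<phi>2 \<in> F" using \<phi> by (simp add: mix_def)
    then have "\<phi>1 \<in> F" using F(1) h unfolding face_def by blast
    then show "\<phi>1 = \<phi>" using single \<phi> by blast
  qed
qed

section \<open>Positive definite functions and spectral conditions\<close>

definition pd_form :: "('a::ab_group_add \<Rightarrow> complex) \<Rightarrow> nat \<Rightarrow> (nat \<Rightarrow> 'a) \<Rightarrow> (nat \<Rightarrow> complex) \<Rightarrow> complex" where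
  "pd_form \<phi> n b \<beta> = (\<Sum>i<n. \<Sum>j<n. \<beta> i * cnj (\<beta> j) * \<phi> (b i - b j))"

definition pos_def :: "('a::ab_group_add \<Rightarrow> complex) \<Rightarrow> bool" where
  "pos_def \<phi> \<longleftrightarrow> (\<forall>n b \<beta>. 0 \<le> Re (pd_form \<phi> n b \<beta>) \<and> Im (pd_form \<phi> n b \<beta>) = 0)"

lemma pos_def_zero:
  assumes "pos_def \<phi>"
  shows "Im (\<phi> 0) = 0" "0 \<le> Re (\<phi> 0)"
  using assms[unfolded pos_def_def, rule_format, of 1 "\<lambda>_. 0" "\<lambda>_. 1"] by (auto simp: pd_form_def)

text \<open>The form at the points \<open>a\<close> and \<open>0\<close> with weights
  \<open>1\<close> and \<open>z\<close>. Taking \<open>z\<close> to be \<i> or 1 gives Hermitian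
  symmetry, and the negated phase of \<open>\<phi> a\<close> gives the bound by
  \<open>\<phi> 0\<close>.\<close>

lemma pos_def_pair:
  fixes a :: "'a::ab_group_add"
  assumes "pos_def \<phi>"
  defines "S \<equiv> \<lambda>z. (1 + z * cnj z) * \<phi> 0 + cnj z * \<phi> a + z * \<phi> (- a)"
  shows "0 \<le> Re (S z)" "Im (S z) = 0"
proof -
  have "pd_form \<phi> 2 (\<lambda>i. if i = 0 then a else 0) (\<lambda>i. if i = 0 then 1 else z) = S z"
    by (simp add: pd_form_def S_def numeral_2_eq_2 algebra_simps)
  then show "0 \<le> Re (S z)" "Im (S z) = 0" using assms(1) unfolding pos_def_def by metis+
qed

lemma pos_def_hermitian:
  assumes "pos_def \<phi>"
  shows "\<phi> (- a) = cnj (\<phi> a)"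
proof (rule complex_eqI)
  show "Re (\<phi> (- a)) = Re (cnj (\<phi> a))"
    using pos_def_pair(2)[OF assms, where z = \<i> and a = a] pos_def_zero[OF assms] by simp
  show "Im (\<phi> (- a)) = Im (cnj (\<phi> a))"
    using pos_def_pair(2)[OF assms, where z = 1 and a = a] pos_def_zero[OF assms] by simp
qed

lemma pos_def_bound:
  assumes "pos_def \<phi>"
  shows "norm (\<phi> a) \<le> Re (\<phi> 0)"
proof (cases "\<phi> a = 0")
  case True
  then show ?thesis using pos_def_zero[OF assms] by simp
next
  case False
  define z where "z = - \<phi> a / of_real (norm (\<phi> a))"
  have n: "norm z = 1" using False by (simp add: z_def norm_divide)
  then have zz: "z * cnj z = 1" by (metis complex_norm_square of_real_1 power_one)
  have "cnj z * \<phi> a = - of_real (norm (\<phi> a))"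
    using False by (simp add: z_def complex_norm_square[symmetric] power2_eq_square mult.commute[of "cnj _"])
  moreover from this have "z * cnj (\<phi> a) = - of_real (norm (\<phi> a))"
    by (metis complex_cnj_cnj complex_cnj_complex_of_real complex_cnj_minus complex_cnj_mult)
  ultimately show ?thesis
    using pos_def_pair(1)[OF assms, where z = z and a = a] zz by (simp add: pos_def_hermitian[OF assms])
qed

lemma pos_def_comb:
  assumes "pos_def \<phi>" "pos_def \<psi>" "0 \<le> u" "0 \<le> v"
  shows "pos_def (\<lambda>x. of_real u * \<phi> x + of_real v * \<psi> x)"
proof -
  have "pd_form (\<lambda>x. of_real u * \<phi> x + of_real v * \<psi> x) n b \<beta> =
    of_real u * pd_form \<phi> n b \<beta> + of_real v * pd_form \<psi> n b \<beta>" for n b \<beta>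
    by (simp add: pd_form_def sum_distrib_left algebra_simps sum.distrib)
  then show ?thesis using assms by (simp add: pos_def_def)
qed

lemma sum_lessThan_double: "(\<Sum>i<2 * (n::nat). f i) = (\<Sum>i<n. f (2 * i) + f (2 * i + 1) :: 'b::comm_monoid_add)"
  by (induction n) (simp_all add: add_ac)

text \<open>If \<open>\<phi>\<close> is the Fourier transform of a measure on characters, the
  measure gets multiplied by \<open>|1 + \<alpha> \<gamma>(a)|^2\<close>. Concretely, each sample
  point \<open>b i\<close> is doubled to \<open>b i\<close> and \<open>b i + a\<close>, with weights
  \<open>\<beta> i\<close> and \<open>\<alpha> * \<beta> i\<close>.\<close>

lemma pos_def_shift:
  assumes "pos_def \<phi>" "norm \<alpha> = 1"
  shows "pos_def (\<lambda>x. 2 * \<phi> x + \<alpha> * \<phi> (x + a) + cnj \<alpha> * \<phi> (x - a))"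
proof -
  have aa: "\<alpha> * cnj \<alpha> = 1" using assms(2) by (metis complex_norm_square of_real_1 power_one)
  have "pd_form (\<lambda>x. 2 * \<phi> x + \<alpha> * \<phi> (x + a) + cnj \<alpha> * \<phi> (x - a)) n b \<beta> =
     pd_form \<phi> (2 * n) (\<lambda>i. if even i then b (i div 2) else b (i div 2) + a)
       (\<lambda>i. if even i then \<beta> (i div 2) else \<alpha> * \<beta> (i div 2))" for n b \<beta>
  proof -
    have "\<beta> i * cnj (\<beta> j) * (2 * \<phi> (b i - b j) + \<alpha> * \<phi> (b i - b j + a) + cnj \<alpha> * \<phi> (b i - b j - a)) =
      \<beta> i * cnj (\<beta> j) * \<phi> (b i - b j) + \<beta> i * cnj (\<alpha> * \<beta> j) * \<phi> (b i - (b j + a)) +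
      (\<alpha> * \<beta> i * cnj (\<beta> j) * \<phi> (b i + a - b j) + \<alpha> * \<beta> i * cnj (\<alpha> * \<beta> j) * \<phi> (b i + a - (b j + a)))" for i j
    proof -
      have "\<alpha> * \<beta> i * cnj (\<alpha> * \<beta> j) = \<beta> i * cnj (\<beta> j)" using aa by (simp add: algebra_simps)
      moreover have "b i - (b j + a) = b i - b j - a" "b i + a - b j = b i - b j + a"
        "b i + a - (b j + a) = b i - b j" by (simp_all add: algebra_simps)
      ultimately show ?thesis by (auto simp: algebra_simps)
    qed
    then show ?thesis by (simp add: pd_form_def sum_lessThan_double sum.distrib)
  qed
  then show ?thesis using assms(1) by (simp add: pos_def_def)
qed

definition sym_shift :: "real \<Rightarrow> real \<Rightarrow> 'a::ab_group_add \<Rightarrow> ('a \<Rightarrow> complex) \<Rightarrow> 'a \<Rightarrow> complex" where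
  "sym_shift s t a \<phi> = (\<lambda>x. of_real s * \<phi> x + of_real t * (\<phi> (x + a) + \<phi> (x - a)))"

text \<open>A triple \<open>(s, t, a)\<close> encodes the condition \<open>s + 2 t Re \<gamma> a \<ge> 0\<close> on the
  characters \<open>\<gamma>\<close> in the spectral support of a positive definite function.\<close>

definition pd_states :: "(real \<times> real \<times> 'a::ab_group_add) set \<Rightarrow> ('a \<Rightarrow> complex) set" where
  "pd_states W = {\<phi>. pos_def \<phi> \<and> \<phi> 0 = 1 \<and> (\<forall>(s, t, a)\<in>W. pos_def (sym_shift s t a \<phi>))}"

lemma closed_pos_def_sym_shift: "closed {\<phi>. pos_def (sym_shift s t a \<phi>)}"
  unfolding pos_def_def pd_form_def sym_shift_def
  by (intro closed_Collect_all closed_Collect_conj closed_Collect_le closed_Collect_eq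
      continuous_intros continuous_on_product_coordinates)

lemma sym_shift_1_0: "sym_shift 1 0 a \<phi> = \<phi>"
  by (simp add: sym_shift_def)

text \<open>Positive definiteness bounds all values by \<open>\<phi> 0 = 1\<close>, and every
  inequality involved concerns finitely many values: a closed subset of a product of discs.\<close>

lemma compact_pd_states: "compact (pd_states W)"
proof -
  have eq: "pd_states W = {\<phi>. \<forall>x. \<phi> x \<in> cball 0 1} \<inter>
    ({\<phi>. pos_def (sym_shift 1 0 0 \<phi>)} \<inter> {\<phi>. \<phi> 0 = 1} \<inter>
     (\<Inter>(s, t, a)\<in>W. {\<phi>. pos_def (sym_shift s t a \<phi>)}))"
    using pos_def_bound by (fastforce simp: pd_states_def sym_shift_1_0)
  have "closed {\<phi> :: 'a \<Rightarrow> complex. \<phi> 0 = 1}"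
    by (intro closed_Collect_eq continuous_intros continuous_on_product_coordinates)
  then show ?thesis
    unfolding eq by (intro compact_Int_closed compact_Pi_UNIV closed_Int closed_INT)
      (auto simp: closed_pos_def_sym_shift)
qed

text \<open>Shifts commute, so the new function keeps every condition in \<open>W\<close> and only
  its value \<open>c\<close> at 0 has to be divided out. For \<open>c = 0\<close> the bound by the
  value at 0 makes it vanish.\<close>

lemma pd_states_shift:
  fixes \<phi> :: "'a::ab_group_add \<Rightarrow> complex" and a :: 'a
  assumes \<phi>: "\<phi> \<in> pd_states W" and \<alpha>: "norm \<alpha> = 1"
  defines "\<psi> \<equiv> \<lambda>x. 2 * \<phi> x + \<alpha> * \<phi> (x + a) + cnj \<alpha> * \<phi> (x - a)"
  defines "c \<equiv> 2 + 2 * Re (\<alpha> * \<phi> a)"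
  shows "\<psi> 0 = of_real c" "0 \<le> c" "c = 0 \<Longrightarrow> \<psi> = (\<lambda>x. 0)"
    "c > 0 \<Longrightarrow> (\<lambda>x. \<psi> x / of_real c) \<in> pd_states W"
proof -
  have pd: "pos_def \<phi>" "\<phi> 0 = 1" using \<phi> by (auto simp: pd_states_def)
  have pd\<psi>: "pos_def \<psi>" unfolding \<psi>_def by (rule pos_def_shift[OF pd(1) \<alpha>])
  have "\<psi> 0 = 2 + (\<alpha> * \<phi> a + cnj (\<alpha> * \<phi> a))"
    using pos_def_hermitian[OF pd(1), of a] pd(2) by (simp add: \<psi>_def)
  then show \<psi>0: "\<psi> 0 = of_real c" unfolding complex_add_cnj by (simp add: c_def)
  then show "0 \<le> c" using pos_def_zero(2)[OF pd\<psi>] by simp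
  show "\<psi> = (\<lambda>x. 0)" if "c = 0"
    using pos_def_bound[OF pd\<psi>] \<psi>0 that by auto
  assume c: "c > 0"
  have scale: "pos_def (\<lambda>x. f x / of_real c)" if "pos_def f" for f :: "'a \<Rightarrow> complex"
    using pos_def_comb[OF that that, of "1 / c" 0] c by (simp add: divide_simps)
  have "pos_def (sym_shift s t b (\<lambda>x. \<psi> x / of_real c))" if "(s, t, b) \<in> W" for s t b
  proof -
    have "pos_def (sym_shift s t b \<phi>)" using \<phi> that by (auto simp: pd_states_def)
    then have "pos_def (\<lambda>x. (2 * sym_shift s t b \<phi> x + \<alpha> * sym_shift s t b \<phi> (x + a)
        + cnj \<alpha> * sym_shift s t b \<phi> (x - a)) / of_real c)"
      by (intro scale pos_def_shift \<alpha>)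
    moreover have "(2 * sym_shift s t b \<phi> x + \<alpha> * sym_shift s t b \<phi> (x + a)
        + cnj \<alpha> * sym_shift s t b \<phi> (x - a)) / of_real c = sym_shift s t b (\<lambda>x. \<psi> x / of_real c) x" for x
    proof -
      have "x + a + b = x + b + a" "x + a - b = x - b + a" "x - a + b = x + b - a" "x - a - b = x - b - a"
        by (simp_all add: algebra_simps)
      then have "2 * sym_shift s t b \<phi> x + \<alpha> * sym_shift s t b \<phi> (x + a)
        + cnj \<alpha> * sym_shift s t b \<phi> (x - a) = sym_shift s t b \<psi> x"
        unfolding sym_shift_def \<psi>_def by (simp only:) (simp add: algebra_simps)
      moreover have "sym_shift s t b (\<lambda>x. \<psi> x / of_real c) x = sym_shift s t b \<psi> x / of_real c"
        by (simp add: sym_shift_def add_divide_distrib distrib_left)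
      ultimately show ?thesis by simp
    qed
    ultimately show ?thesis by simp
  qed
  then show "(\<lambda>x. \<psi> x / of_real c) \<in> pd_states W"
    using scale[OF pd\<psi>] \<psi>0 c by (auto simp: pd_states_def)
qed

text \<open>The functions of \<open>pd_states_shift\<close> for \<open>\<alpha>\<close> and
  \<open>- \<alpha>\<close> add up to \<open>4 \<phi>\<close>, so at an extreme point each is a
  multiple of \<open>\<phi>\<close>. Spectrally, multiplying by
  \<open>|1 + \<alpha> \<gamma>(a)|^2\<close> only rescales the measure, which therefore sits at a
  single character.\<close>

lemma pd_states_character:
  fixes W :: "(real \<times> real \<times> 'a::ab_group_add) set"
  assumes "pd_states W \<noteq> {}"
  obtains \<gamma> where "\<gamma> \<in> pd_states W" "\<And>x y. \<gamma> (x + y) = \<gamma> x * \<gamma> y"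
proof -
  obtain \<phi> where \<phi>: "\<phi> \<in> pd_states W"
    and ext: "\<And>\<phi>1 \<phi>2 t. \<phi>1 \<in> pd_states W \<Longrightarrow> \<phi>2 \<in> pd_states W \<Longrightarrow> 0 < t \<Longrightarrow> t < 1 \<Longrightarrow>
      \<phi> = (\<lambda>x. of_real t * \<phi>1 x + of_real (1 - t) * \<phi>2 x) \<Longrightarrow> \<phi>1 = \<phi>"
    using compact_extreme_point[OF compact_pd_states assms] by blast
  have key: "\<alpha> * \<phi> (x + a) + cnj \<alpha> * \<phi> (x - a) = of_real (2 * Re (\<alpha> * \<phi> a)) * \<phi> x"
    if \<alpha>: "norm \<alpha> = 1" for \<alpha> a x
  proof -
    define \<psi> where "\<psi> = (\<lambda>\<alpha> x. 2 * \<phi> x + \<alpha> * \<phi> (x + a) + cnj \<alpha> * \<phi> (x - a))"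
    define c where "c = (\<lambda>\<alpha>. 2 + 2 * Re (\<alpha> * \<phi> a))"
    have n\<alpha>: "norm (- \<alpha>) = 1" using \<alpha> by simp
    have \<psi>: "\<psi> \<alpha> x = 2 * \<phi> x + \<alpha> * \<phi> (x + a) + cnj \<alpha> * \<phi> (x - a)" for \<alpha> x by (simp add: \<psi>_def)
    have c: "c \<alpha> = 2 + 2 * Re (\<alpha> * \<phi> a)" for \<alpha> by (simp add: c_def)
    note p = pd_states_shift[OF \<phi> \<alpha>, of a, folded \<psi> c]
    note q = pd_states_shift[OF \<phi> n\<alpha>, of a, folded \<psi> c]
    have cc: "c \<alpha> + c (- \<alpha>) = 4" by (simp add: c)
    have sum: "\<psi> \<alpha> x + \<psi> (- \<alpha>) x = 4 * \<phi> x" for x by (simp add: \<psi>)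
    have "\<psi> \<alpha> x = of_real (c \<alpha>) * \<phi> x"
    proof (cases "c \<alpha> = 0 \<or> c (- \<alpha>) = 0")
      case True
      then show ?thesis
      proof
        assume "c (- \<alpha>) = 0"
        then show ?thesis using q(3) sum[of x] cc by simp
      qed (use p(3) in simp)
    next
      case False
      then have pos: "c \<alpha> > 0" "c (- \<alpha>) > 0" using p(2) q(2) by auto
      have "(\<lambda>x. \<psi> \<alpha> x / of_real (c \<alpha>)) = \<phi>"
      proof (rule ext[OF p(4)[OF pos(1)] q(4)[OF pos(2)]])
        show "0 < c \<alpha> / 4" "c \<alpha> / 4 < 1" using pos cc by auto
        have c': "1 - c \<alpha> / 4 = c (- \<alpha>) / 4" using cc by simp
        show "\<phi> = (\<lambda>x. of_real (c \<alpha> / 4) * (\<psi> \<alpha> x / of_real (c \<alpha>)) +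
          of_real (1 - c \<alpha> / 4) * (\<psi> (- \<alpha>) x / of_real (c (- \<alpha>))))"
          unfolding c'
        proof
          fix x
          have "of_real (c \<alpha> / 4) * (\<psi> \<alpha> x / of_real (c \<alpha>)) = \<psi> \<alpha> x / 4"
            "of_real (c (- \<alpha>) / 4) * (\<psi> (- \<alpha>) x / of_real (c (- \<alpha>))) = \<psi> (- \<alpha>) x / 4"
            using pos by (simp_all add: field_simps)
          then show "\<phi> x = of_real (c \<alpha> / 4) * (\<psi> \<alpha> x / of_real (c \<alpha>)) +
              of_real (c (- \<alpha>) / 4) * (\<psi> (- \<alpha>) x / of_real (c (- \<alpha>)))"
            using sum[of x] by (simp only:) (simp flip: add_divide_distrib)
        qed
      qed
      then have "\<psi> \<alpha> x / of_real (c \<alpha>) = \<phi> x" by (rule fun_cong)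
      then show ?thesis using pos by (simp add: field_simps)
    qed
    then show ?thesis by (simp add: \<psi> c algebra_simps)
  qed
  have "\<phi> (x + a) = \<phi> x * \<phi> a" for x a
  proof -
    \<comment> \<open>The choice \<open>\<alpha> = 1\<close> gives the sum and
      \<open>\<alpha> = \<i>\<close> the difference of the two translates.\<close>
    have 1: "\<phi> (x + a) + \<phi> (x - a) = of_real (2 * Re (\<phi> a)) * \<phi> x" using key[of 1 x a] by simp
    have "\<i> * (\<phi> (x + a) - \<phi> (x - a)) = - of_real (2 * Im (\<phi> a)) * \<phi> x"
      using key[of \<i> x a] by (simp add: algebra_simps)
    moreover have "z = - (\<i> * w)" if "\<i> * z = w" for z w :: complex using that by auto
    ultimately have 2: "\<phi> (x + a) - \<phi> (x - a) = - (\<i> * (- of_real (2 * Im (\<phi> a)) * \<phi> x))" by blast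
    have "2 * \<phi> (x + a) = (\<phi> (x + a) + \<phi> (x - a)) + (\<phi> (x + a) - \<phi> (x - a))" by simp
    also have "\<dots> = 2 * (\<phi> x * (of_real (Re (\<phi> a)) + \<i> * of_real (Im (\<phi> a))))"
      unfolding 1 2 by (simp add: distrib_left distrib_right)
    finally show ?thesis by (simp flip: complex_eq)
  qed
  then show thesis using \<phi> that by blast
qed

subsection \<open>Haar measure on a compact abelian group\<close>

text \<open>Without second countability the Borel sets of a square may not be generated by
  rectangles; iterated integrals of continuous functions are therefore exchanged by uniform
  approximation with sums of products.\<close>

inductive tensor :: "('a::topological_space \<times> 'b::topological_space \<Rightarrow> real) \<Rightarrow> bool" where
  base: "continuous_on UNIV u \<Longrightarrow> continuous_on UNIV v \<Longrightarrow> tensor (\<lambda>p. u (fst p) * v (snd p))"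
| add: "tensor F \<Longrightarrow> tensor G \<Longrightarrow> tensor (\<lambda>p. F p + G p)"

lemma tensor_mult:
  assumes "tensor F" "tensor G"
  shows "tensor (\<lambda>p. F p * G p)"
  using assms(1)
proof induction
  case (base u v)
  from assms(2) show ?case
  proof induction
    case (base u' v')
    have "tensor (\<lambda>p. (u (fst p) * u' (fst p)) * (v (snd p) * v' (snd p)))"
      by (rule tensor.base) (intro continuous_intros base \<open>continuous_on UNIV u\<close> \<open>continuous_on UNIV v\<close>)+
    then show ?case by (simp add: mult_ac)
  next
    case (add F G)
    then show ?case using tensor.add[OF add.IH] by (simp add: distrib_left)
  qed
next
  case (add F G)
  then show ?case using tensor.add[OF add.IH] by (simp add: distrib_right)
qed

lemma tensor_continuous: "tensor F \<Longrightarrow> continuous_on UNIV F"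
proof (induction rule: tensor.induct)
  case (base u v)
  then show ?case
    by (intro continuous_intros continuous_on_compose2[of UNIV u UNIV fst] continuous_on_compose2[of UNIV v UNIV snd]) auto
qed (intro continuous_intros)

locale compact_haar =
  fixes m :: "'a::{topological_ab_group_add, t2_space} measure"
  assumes compact_UNIV: "compact (UNIV :: 'a set)" and haar: "normalized_haar m"
begin

lemma sets_m: "sets m = sets borel"
  using haar by (simp add: normalized_haar_def)

lemma space_m [simp]: "space m = UNIV"
  using sets_eq_imp_space_eq[OF sets_m] by simp

lemma emeasure_UNIV [simp]: "emeasure m UNIV = 1"
  using haar by (simp add: normalized_haar_def)

lemma emeasure_translate:
  assumes "A \<in> sets borel"
  shows "emeasure m ((\<lambda>x. a + x) ` A) = emeasure m A"
  using haar assms unfolding normalized_haar_def by blast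

sublocale finite_measure m
  by standard simp

lemma measure_UNIV [simp]: "measure m UNIV = 1"
  by (simp add: measure_def)

lemma measurable_continuous:
  fixes f :: "'a \<Rightarrow> 'b::topological_space"
  assumes "continuous_on UNIV f"
  shows "f \<in> borel_measurable m"
  using borel_measurable_continuous_onI[OF assms] by (simp add: measurable_cong_sets[OF sets_m refl])

lemma continuous_bounded:
  fixes f :: "'a \<Rightarrow> 'b::real_normed_vector"
  assumes "continuous_on UNIV f"
  obtains B where "B > 0" "\<And>x. norm (f x) \<le> B"
  using compact_continuous_image[OF assms compact_UNIV, THEN compact_imp_bounded]
  unfolding bounded_pos by auto

lemma integrable_continuous:
  fixes f :: "'a \<Rightarrow> 'b::{banach, second_countable_topology}"
  assumes "continuous_on UNIV f"
  shows "integrable m f"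
proof -
  obtain B where "\<And>x. norm (f x) \<le> B" using continuous_bounded[OF assms] by blast
  then show ?thesis by (intro integrable_const_bound[where B = B] measurable_continuous assms) auto
qed

lemma integral_const [simp]: "(\<integral>x. c \<partial>m) = (c :: 'b::{banach, second_countable_topology})"
  by (simp add: lebesgue_integral_const)

lemma distr_translate: "distr m m ((+) a) = m"
proof (rule measure_eqI)
  have meas: "(+) a \<in> measurable m m"
    using measurable_continuous[of "(+) a"] by (simp add: measurable_cong_sets[OF refl sets_m] continuous_intros)
  fix A assume "A \<in> sets (distr m m ((+) a))"
  then have A: "A \<in> sets borel" by (simp add: sets_m)
  have "(+) a -` A = (\<lambda>x. - a + x) ` A" by (force simp: image_iff algebra_simps)
  then have "emeasure m ((+) a -` A) = emeasure m A" using emeasure_translate[OF A, of "- a"] by (simp only:)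
  then show "emeasure (distr m m ((+) a)) A = emeasure m A"
    using A meas by (simp add: emeasure_distr sets_m)
qed simp

lemma integral_translate:
  fixes f :: "'a \<Rightarrow> 'b::{banach, second_countable_topology}"
  assumes "f \<in> borel_measurable m"
  shows "(\<integral>x. f (x + a) \<partial>m) = (\<integral>x. f x \<partial>m)"
proof -
  have meas: "(+) a \<in> measurable m m"
    using measurable_continuous[of "(+) a"] by (simp add: measurable_cong_sets[OF refl sets_m] continuous_intros)
  have "(\<integral>x. f x \<partial>m) = (\<integral>x. f x \<partial>distr m m ((+) a))" by (simp add: distr_translate)
  also have "\<dots> = (\<integral>x. f (a + x) \<partial>m)" by (rule integral_distr[OF meas assms])
  finally show ?thesis by (simp add: add.commute)
qed

text \<open>Finitely many translates of \<open>U\<close> cover the compact group, and all have the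
  same measure.\<close>

lemma emeasure_open_pos:
  assumes "open U" "U \<noteq> {}"
  shows "emeasure m U > 0"
proof (rule ccontr)
  assume "\<not> ?thesis"
  then have U0: "emeasure m U = 0" by simp
  obtain u where u: "u \<in> U" using assms by blast
  have op: "open ((\<lambda>x. a + x) ` U)" for a
  proof -
    have "(\<lambda>x. a + x) ` U = (\<lambda>x. x - a) -` U" by (force simp: image_iff algebra_simps)
    then show ?thesis using assms(1) by (simp add: open_vimage continuous_intros)
  qed
  have "UNIV \<subseteq> (\<Union>a\<in>UNIV. (\<lambda>x. a + x) ` U)"
  proof
    fix x :: 'a
    have "x = (x - u) + u" by simp
    then show "x \<in> (\<Union>a\<in>UNIV. (\<lambda>x. a + x) ` U)" using u by blast
  qed
  then obtain D where D: "finite D" "UNIV \<subseteq> (\<Union>a\<in>D. (\<lambda>x. a + x) ` U)"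
    using compactE_image[OF compact_UNIV, of UNIV "\<lambda>a. (\<lambda>x. a + x) ` U"] op by metis
  have "emeasure m UNIV \<le> emeasure m (\<Union>a\<in>D. (\<lambda>x. a + x) ` U)"
    using D(2) op by (intro emeasure_mono) (auto simp: sets_m intro!: borel_open)
  also have "\<dots> \<le> (\<Sum>a\<in>D. emeasure m ((\<lambda>x. a + x) ` U))"
    using D(1) op by (intro emeasure_subadditive_finite) (auto simp: sets_m)
  also have "\<dots> = 0" using assms(1) U0 by (simp add: emeasure_translate)
  finally show False by simp
qed

lemma integral_pos:
  fixes f :: "'a \<Rightarrow> real"
  assumes "continuous_on UNIV f" "\<And>x. f x \<ge> 0" "f x0 > 0"
  shows "(\<integral>x. f x \<partial>m) > 0"
proof (rule ccontr)
  assume "\<not> ?thesis"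
  moreover have "(\<integral>x. f x \<partial>m) \<ge> 0" using assms(2) by simp
  ultimately have "(\<integral>x. f x \<partial>m) = 0" by simp
  then have "AE x in m. f x = 0"
    using integral_nonneg_eq_0_iff_AE[OF integrable_continuous[OF assms(1)]] assms(2) by simp
  moreover have op: "open {x. f x \<noteq> 0}"
    using assms(1) by (intro open_Collect_neq continuous_intros)
  ultimately have "emeasure m {x. f x \<noteq> 0} = 0"
    using AE_iff_measurable[of "{x. f x \<noteq> 0}" m "\<lambda>x. f x = 0"] by (simp add: sets_m)
  moreover have "{x. f x \<noteq> 0} \<noteq> {}" using assms(3) by force
  ultimately show False using emeasure_open_pos[OF op] by simp
qed

lemma urysohn:
  assumes "closed S" "closed T" "S \<inter> T = {}"
  obtains f :: "'a \<Rightarrow> real" where "continuous_on UNIV f" "\<And>x. 0 \<le> f x" "\<And>x. f x \<le> 1"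
    "\<And>x. x \<in> S \<Longrightarrow> f x = 0" "\<And>x. x \<in> T \<Longrightarrow> f x = 1"
proof -
  have "\<exists>U V. open U \<and> open V \<and> x \<in> U \<and> y \<in> V \<and> U \<inter> V = {}" if "x \<noteq> y" for x y :: 'a
    using hausdorff[OF that] .
  then have "Hausdorff_space (euclidean :: 'a topology)"
    unfolding Hausdorff_space_def by (simp add: disjnt_def)
  moreover have "compact_space (euclidean :: 'a topology)"
    using compact_UNIV by (simp add: compact_space_def)
  ultimately have "normal_space (euclidean :: 'a topology)"
    by (intro compact_Hausdorff_or_regular_imp_normal_space) auto
  then obtain f where f: "continuous_map euclidean (top_of_set {0..1::real}) f" "f ` S \<subseteq> {0}" "f ` T \<subseteq> {1}"
    using Urysohn_lemma[of "euclidean :: 'a topology" S T 0 1] assms by (auto simp: disjnt_def)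
  have "continuous_on UNIV f" "\<And>x. f x \<in> {0..1}"
    using f(1) by (auto simp: continuous_map_in_subtopology)
  then show thesis by (intro that[of f]) (use f(2,3) in auto)
qed

lemma integral_close:
  fixes f g :: "'a \<Rightarrow> real"
  assumes "continuous_on UNIV f" "continuous_on UNIV g" "\<And>x. \<bar>f x - g x\<bar> \<le> e"
  shows "\<bar>(\<integral>x. f x \<partial>m) - (\<integral>x. g x \<partial>m)\<bar> \<le> e"
proof -
  have "\<bar>(\<integral>x. f x \<partial>m) - (\<integral>x. g x \<partial>m)\<bar> = \<bar>\<integral>x. f x - g x \<partial>m\<bar>"
    using assms by (simp add: integrable_continuous)
  also have "\<dots> \<le> (\<integral>x. \<bar>f x - g x\<bar> \<partial>m)" by (rule integral_abs_bound)
  also have "\<dots> \<le> (\<integral>x. e \<partial>m)"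
    using assms by (intro integral_mono integrable_continuous continuous_intros) auto
  finally show ?thesis by simp
qed

lemma tensor_approx:
  fixes F :: "'a \<times> 'a \<Rightarrow> real"
  assumes "continuous_on UNIV F" "e > 0"
  obtains G where "tensor G" "\<And>p. \<bar>F p - G p\<bar> < e"
proof -
  have "\<exists>G. tensor G \<and> (\<forall>p\<in>UNIV. \<bar>F p - G p\<bar> < e)"
  proof (rule Stone_Weierstrass_HOL[where P = tensor])
    show "compact (UNIV :: ('a \<times> 'a) set)" using compact_Times[OF compact_UNIV compact_UNIV] by simp
    show "tensor (\<lambda>x. c)" for c using tensor.base[of "\<lambda>_. c" "\<lambda>_. 1"] by simp
    fix x y :: "'a \<times> 'a"
    assume "x \<in> UNIV \<and> y \<in> UNIV \<and> x \<noteq> y"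
    then consider "fst x \<noteq> fst y" | "snd x \<noteq> snd y" by (auto simp: prod_eq_iff)
    then show "\<exists>f. tensor f \<and> f x \<noteq> f y"
    proof cases
      case 1
      obtain f :: "'a \<Rightarrow> real" where "continuous_on UNIV f" "f (fst x) = 0" "f (fst y) = 1"
        by (rule urysohn[of "{fst x}" "{fst y}"]) (use 1 in auto)
      then show ?thesis using tensor.base[of f "\<lambda>_. 1"]
        by (intro exI[of _ "\<lambda>p. f (fst p) * 1"]) auto
    next
      case 2
      obtain f :: "'a \<Rightarrow> real" where "continuous_on UNIV f" "f (snd x) = 0" "f (snd y) = 1"
        by (rule urysohn[of "{snd x}" "{snd y}"]) (use 2 in auto)
      then show ?thesis using tensor.base[of "\<lambda>_. 1" f]
        by (intro exI[of _ "\<lambda>p. 1 * f (snd p)"]) auto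
    qed
  qed (use assms tensor_mult in \<open>auto intro: tensor.add tensor_continuous\<close>)
  then show thesis using that by blast
qed

lemma continuous_slices:
  fixes F :: "'a \<times> 'a \<Rightarrow> real"
  assumes "continuous_on UNIV F"
  shows "continuous_on UNIV (\<lambda>y. F (x, y))" "continuous_on UNIV (\<lambda>x. F (x, y))"
  by (auto intro!: continuous_on_compose2[OF assms] continuous_intros)

lemma tensor_integral:
  "tensor F \<Longrightarrow> continuous_on UNIV (\<lambda>x. \<integral>y. F (x, y) \<partial>m) \<and> continuous_on UNIV (\<lambda>y. \<integral>x. F (x, y) \<partial>m) \<and>
    (\<integral>x. (\<integral>y. F (x, y) \<partial>m) \<partial>m) = (\<integral>y. (\<integral>x. F (x, y) \<partial>m) \<partial>m)"
proof (induction rule: tensor.induct)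
  case (base u v)
  then show ?case by (auto intro!: continuous_intros)
next
  case (add F G)
  note c = continuous_slices[OF tensor_continuous[OF add.hyps(1)], THEN integrable_continuous]
    continuous_slices[OF tensor_continuous[OF add.hyps(2)], THEN integrable_continuous]
  show ?case using add.IH c by (auto simp: integrable_continuous intro!: continuous_intros)
qed

lemma continuous_integral:
  fixes F :: "'a \<times> 'a \<Rightarrow> real"
  assumes F: "continuous_on UNIV F"
  shows "continuous_on UNIV (\<lambda>x. \<integral>y. F (x, y) \<partial>m)"
proof -
  obtain G where G: "\<And>n. tensor (G n)" "\<And>n p. \<bar>F p - G n p\<bar> < inverse (real (Suc n))"
  proof -
    have "\<exists>G. tensor G \<and> (\<forall>p. \<bar>F p - G p\<bar> < inverse (real (Suc n)))" for n
      by (rule tensor_approx[OF F, of "inverse (real (Suc n))"]) auto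
    then show thesis using that by metis
  qed
  have "uniform_limit UNIV (\<lambda>n x. \<integral>y. G n (x, y) \<partial>m) (\<lambda>x. \<integral>y. F (x, y) \<partial>m) sequentially"
  proof (rule uniform_limitI)
    fix e :: real assume "e > 0"
    have "\<bar>(\<integral>y. F (x, y) \<partial>m) - (\<integral>y. G n (x, y) \<partial>m)\<bar> \<le> inverse (real (Suc n))" for n x
      by (intro integral_close continuous_slices F tensor_continuous[OF G(1)] less_imp_le[OF G(2)])
    moreover have "\<forall>\<^sub>F n in sequentially. inverse (real (Suc n)) < e"
      using \<open>e > 0\<close> LIMSEQ_inverse_real_of_nat order_tendstoD(2) by blast
    ultimately show "\<forall>\<^sub>F n in sequentially. \<forall>x\<in>UNIV. dist (\<integral>y. G n (x, y) \<partial>m) (\<integral>y. F (x, y) \<partial>m) < e"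
      by (auto elim!: eventually_mono simp: dist_real_def abs_minus_commute intro: le_less_trans)
  qed
  then show ?thesis
    by (rule uniform_limit_theorem[rotated]) (use tensor_integral[OF G(1)] in auto)
qed

lemma fubini_continuous:
  fixes F :: "'a \<times> 'a \<Rightarrow> real"
  assumes F: "continuous_on UNIV F"
  shows "(\<integral>x. (\<integral>y. F (x, y) \<partial>m) \<partial>m) = (\<integral>y. (\<integral>x. F (x, y) \<partial>m) \<partial>m)"
proof -
  have swap: "continuous_on UNIV (\<lambda>p. F (snd p, fst p))"
    by (intro continuous_on_compose2[OF F] continuous_intros) auto
  have cF: "continuous_on UNIV (\<lambda>y. \<integral>x. F (x, y) \<partial>m)" using continuous_integral[OF swap] by simp
  have "\<bar>(\<integral>x. (\<integral>y. F (x, y) \<partial>m) \<partial>m) - (\<integral>y. (\<integral>x. F (x, y) \<partial>m) \<partial>m)\<bar> \<le> 0 + e" if e: "e > 0" for e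
  proof -
    obtain G where G: "tensor G" "\<And>p. \<bar>F p - G p\<bar> < e / 2"
      by (rule tensor_approx[OF F, of "e / 2"]) (use e in auto)
    note t = tensor_integral[OF G(1)]
    note cG = continuous_slices[OF tensor_continuous[OF G(1)]]
    have "\<bar>(\<integral>x. (\<integral>y. F (x, y) \<partial>m) \<partial>m) - (\<integral>x. (\<integral>y. G (x, y) \<partial>m) \<partial>m)\<bar> \<le> e / 2"
      using t G(2) by (intro integral_close continuous_integral F continuous_slices cG tensor_continuous[OF G(1)]) (auto simp: less_imp_le)
    moreover have "\<bar>(\<integral>y. (\<integral>x. F (x, y) \<partial>m) \<partial>m) - (\<integral>y. (\<integral>x. G (x, y) \<partial>m) \<partial>m)\<bar> \<le> e / 2"
      using t G(2) by (intro integral_close cF F continuous_slices cG tensor_continuous[OF G(1)]) (auto simp: less_imp_le)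
    ultimately show ?thesis using t by linarith
  qed
  then show ?thesis using field_le_epsilon by (metis abs_le_zero_iff eq_iff_diff_eq_0)
qed

end

subsection \<open>Convolution operators\<close>

text \<open>A sequence in a compact space that is not metrizable may lack convergent subsequences. A
  point common to all closed sets that eventually contain it suffices to carry closed conditions to
  the limit.\<close>

lemma compact_cluster_point:
  fixes u :: "nat \<Rightarrow> 'b::topological_space"
  assumes "compact K" "\<And>n. u n \<in> K"
  obtains \<psi> where "\<psi> \<in> K" "\<And>P. closed P \<Longrightarrow> \<forall>\<^sub>F n in sequentially. u n \<in> P \<Longrightarrow> \<psi> \<in> P"
proof -
  define \<P> where "\<P> = {P. closed P \<and> (\<forall>\<^sub>F n in sequentially. u n \<in> P)}"
  have "K \<inter> \<Inter>\<P> \<noteq> {}"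
  proof (rule compact_imp_fip[OF assms(1)])
    fix B assume B: "finite B" "B \<subseteq> \<P>"
    then have "\<forall>\<^sub>F n in sequentially. \<forall>P\<in>B. u n \<in> P"
      unfolding \<P>_def by (intro eventually_ball_finite) blast+
    then obtain n where "\<forall>P\<in>B. u n \<in> P" using eventually_happens'[OF sequentially_bot] by blast
    then show "K \<inter> \<Inter>B \<noteq> {}" using assms(2) by blast
  qed (simp add: \<P>_def)
  then obtain \<psi> where "\<psi> \<in> K" "\<psi> \<in> \<Inter>\<P>" by blast
  then show thesis by (intro that[of \<psi>]) (auto simp: \<P>_def)
qed

text \<open>The real and the imaginary parts of the weights contribute one real form each, and
  evenness cancels the cross terms.\<close>

lemma pos_def_of_real:
  fixes \<psi> :: "'a::ab_group_add \<Rightarrow> real"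
  assumes even: "\<And>a. \<psi> (- a) = \<psi> a"
    and form: "\<And>(n::nat) b c. 0 \<le> (\<Sum>i<n. \<Sum>j<n. c i * c j * \<psi> (b i - b j))"
  shows "pos_def (\<lambda>x. of_real (\<psi> x))"
  unfolding pos_def_def
proof (intro allI conjI)
  fix n :: nat and b and \<beta> :: "nat \<Rightarrow> complex"
  have "Re (pd_form (\<lambda>x. of_real (\<psi> x)) n b \<beta>) =
    (\<Sum>i<n. \<Sum>j<n. Re (\<beta> i) * Re (\<beta> j) * \<psi> (b i - b j)) + (\<Sum>i<n. \<Sum>j<n. Im (\<beta> i) * Im (\<beta> j) * \<psi> (b i - b j))"
    by (simp add: pd_form_def flip: sum.distrib) (simp add: algebra_simps)
  then show "0 \<le> Re (pd_form (\<lambda>x. of_real (\<psi> x)) n b \<beta>)" using form[where n = n and c = "\<lambda>i. Re (\<beta> i)" and b = b]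
      form[where n = n and c = "\<lambda>i. Im (\<beta> i)" and b = b] by simp
  have "\<psi> (b i - b j) = \<psi> (b j - b i)" for i j using even[of "b i - b j"] by simp
  then have "(\<Sum>i<n. \<Sum>j<n. Re (\<beta> i) * Im (\<beta> j) * \<psi> (b i - b j)) = (\<Sum>i<n. \<Sum>j<n. Im (\<beta> i) * Re (\<beta> j) * \<psi> (b i - b j))"
    by (subst sum.swap) (simp add: mult_ac)
  moreover have "Im (pd_form (\<lambda>x. of_real (\<psi> x)) n b \<beta>) =
    (\<Sum>i<n. \<Sum>j<n. Im (\<beta> i) * Re (\<beta> j) * \<psi> (b i - b j)) - (\<Sum>i<n. \<Sum>j<n. Re (\<beta> i) * Im (\<beta> j) * \<psi> (b i - b j))"
    by (simp add: pd_form_def flip: sum_subtractf) (simp add: algebra_simps)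
  ultimately show "Im (pd_form (\<lambda>x. of_real (\<psi> x)) n b \<beta>) = 0" by simp
qed

context compact_haar
begin

text \<open>The inner product of \<open>L^2\<close>, applied to continuous functions without passing
  to the completion: approximate eigenvectors replace the eigenvectors of a compact
  operator.\<close>

definition ip :: "('a \<Rightarrow> real) \<Rightarrow> ('a \<Rightarrow> real) \<Rightarrow> real" where
  "ip f g = (\<integral>x. f x * g x \<partial>m)"

definition conv :: "('a \<Rightarrow> real) \<Rightarrow> ('a \<Rightarrow> real) \<Rightarrow> 'a \<Rightarrow> real" where
  "conv k f = (\<lambda>x. \<integral>y. k (x - y) * f y \<partial>m)"

lemma continuous_shift:
  fixes f :: "'a \<Rightarrow> 'b::topological_space"
  assumes "continuous_on UNIV f"
  shows "continuous_on UNIV (\<lambda>x. f (x + a))" "continuous_on UNIV (\<lambda>x. f (x - a))"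
    "continuous_on UNIV (\<lambda>x. f (a - x))" "continuous_on UNIV (\<lambda>x. f (- x))"
  by (auto intro!: continuous_on_compose2[OF assms] continuous_intros)

lemma integral_shift:
  fixes f :: "'a \<Rightarrow> real"
  assumes "continuous_on UNIV f"
  shows "(\<integral>x. f (x + a) \<partial>m) = (\<integral>x. f x \<partial>m)"
  by (rule integral_translate[OF measurable_continuous[OF assms]])

lemma integrable_mult:
  fixes f g :: "'a \<Rightarrow> real"
  shows "continuous_on UNIV f \<Longrightarrow> continuous_on UNIV g \<Longrightarrow> integrable m (\<lambda>x. f x * g x)"
  by (intro integrable_continuous continuous_intros)

lemma ip_nonneg: "0 \<le> ip f f"
  by (simp add: ip_def)

lemma ip_shift:
  assumes "continuous_on UNIV f" "continuous_on UNIV g"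
  shows "ip (\<lambda>x. f (x + a)) (\<lambda>x. g (x + a)) = ip f g"
  unfolding ip_def using assms
  by (intro integral_shift[where f = "\<lambda>x. f x * g x"] continuous_intros)

lemma ip_sum:
  fixes c d :: "nat \<Rightarrow> real"
  assumes "\<And>i. continuous_on UNIV (f i)" "\<And>j. continuous_on UNIV (g j)"
  shows "ip (\<lambda>x. \<Sum>i<n. c i * f i x) (\<lambda>x. \<Sum>j<n'. d j * g j x) =
    (\<Sum>i<n. \<Sum>j<n'. c i * d j * ip (f i) (g j))"
proof -
  have "ip (\<lambda>x. \<Sum>i<n. c i * f i x) (\<lambda>x. \<Sum>j<n'. d j * g j x) =
    (\<integral>x. (\<Sum>i<n. \<Sum>j<n'. c i * d j * (f i x * g j x)) \<partial>m)"
    unfolding ip_def by (intro Bochner_Integration.integral_cong refl) (simp add: sum_product mult_ac)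
  also have "\<dots> = (\<Sum>i<n. \<Sum>j<n'. c i * d j * ip (f i) (g j))"
    using assms by (simp add: ip_def integrable_mult)
  finally show ?thesis .
qed

lemma ip_lincomb:
  assumes "continuous_on UNIV f" "continuous_on UNIV g"
  shows "ip (\<lambda>x. u * f x + v * g x) (\<lambda>x. u * f x + v * g x) = u\<^sup>2 * ip f f + 2 * u * v * ip f g + v\<^sup>2 * ip g g"
proof -
  have "ip (\<lambda>x. u * f x + v * g x) (\<lambda>x. u * f x + v * g x) =
     (\<integral>x. u\<^sup>2 * (f x * f x) + 2 * u * v * (f x * g x) + v\<^sup>2 * (g x * g x) \<partial>m)"
    unfolding ip_def by (intro Bochner_Integration.integral_cong refl) (simp add: power2_eq_square algebra_simps)
  then show ?thesis using assms by (simp add: ip_def integrable_mult)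
qed

lemma ip_cauchy_schwarz:
  assumes "continuous_on UNIV f" "continuous_on UNIV g"
  shows "(ip f g)\<^sup>2 \<le> ip f f * ip g g"
proof (cases "ip g g = 0")
  case True
  have "ip f g = 0"
  proof (rule ccontr)
    assume B: "ip f g \<noteq> 0"
    define v where "v = - (ip f f + 1) / (2 * ip f g)"
    have "0 \<le> ip f f + 2 * v * ip f g"
      using ip_lincomb[OF assms, of 1 v] ip_nonneg[of "\<lambda>x. 1 * f x + v * g x"] True by simp
    also have "2 * v * ip f g = - (ip f f + 1)" using B by (simp add: v_def field_simps)
    finally show False by simp
  qed
  then show ?thesis using True by simp
next
  case False
  then have D: "ip g g > 0" using ip_nonneg[of g] by simp
  have "0 \<le> (ip g g)\<^sup>2 * ip f f + 2 * ip g g * (- ip f g) * ip f g + (- ip f g)\<^sup>2 * ip g g"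
    using ip_lincomb[OF assms, of "ip g g" "- ip f g"] ip_nonneg by metis
  also have "\<dots> = ip g g * (ip f f * ip g g - (ip f g)\<^sup>2)"
    by (simp add: power2_eq_square algebra_simps)
  finally show ?thesis using D by (simp add: zero_le_mult_iff)
qed

lemma continuous_conv:
  assumes "continuous_on UNIV k" "continuous_on UNIV f"
  shows "continuous_on UNIV (conv k f)"
proof -
  have "continuous_on UNIV (\<lambda>p :: 'a \<times> 'a. k (fst p - snd p) * f (snd p))"
    by (intro continuous_intros continuous_on_compose2[OF assms(1)] continuous_on_compose2[OF assms(2)]) auto
  from continuous_integral[OF this] show ?thesis by (simp add: conv_def)
qed

lemma conv_symmetric:
  assumes "continuous_on UNIV k" "continuous_on UNIV f" "continuous_on UNIV g" "\<And>x. k (- x) = k x"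
  shows "ip (conv k f) g = ip f (conv k g)"
proof -
  have k: "k (x - y) = k (y - x)" for x y using assms(4)[of "x - y"] by simp
  have "continuous_on UNIV (\<lambda>p :: 'a \<times> 'a. k (fst p - snd p) * f (snd p) * g (fst p))"
    by (intro continuous_intros continuous_on_compose2[OF assms(1)] continuous_on_compose2[OF assms(2)]
        continuous_on_compose2[OF assms(3)]) auto
  from fubini_continuous[OF this]
  have "(\<integral>x. (\<integral>y. k (x - y) * f y * g x \<partial>m) \<partial>m) = (\<integral>y. (\<integral>x. k (x - y) * f y * g x \<partial>m) \<partial>m)" by simp
  moreover have "(\<integral>x. k (x - y) * f y * g x \<partial>m) = f y * (\<integral>x. k (y - x) * g x \<partial>m)" for y
  proof -
    have "(\<integral>x. k (x - y) * f y * g x \<partial>m) = (\<integral>x. f y * (k (y - x) * g x) \<partial>m)"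
      by (intro Bochner_Integration.integral_cong refl) (simp add: k[of _ y])
    then show ?thesis by simp
  qed
  ultimately show ?thesis by (simp add: ip_def conv_def)
qed

lemma conv_shift:
  assumes "continuous_on UNIV k" "continuous_on UNIV f"
  shows "conv k (\<lambda>y. f (y + a)) x = conv k f (x + a)"
proof -
  have "(\<integral>y. k (x + a - (y + a)) * f (y + a) \<partial>m) = (\<integral>y. k (x + a - y) * f y \<partial>m)"
    by (rule integral_shift[where f = "\<lambda>y. k (x + a - y) * f y"]) (intro continuous_intros assms continuous_shift)
  then show ?thesis by (simp add: conv_def)
qed

lemma conv_sum:
  fixes c :: "nat \<Rightarrow> real"
  assumes "continuous_on UNIV k" "\<And>i. continuous_on UNIV (f i)"
  shows "conv k (\<lambda>x. \<Sum>i<n. c i * f i x) = (\<lambda>x. \<Sum>i<n. c i * conv k (f i) x)"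
proof
  fix x
  have "conv k (\<lambda>x. \<Sum>i<n. c i * f i x) x = (\<integral>y. (\<Sum>i<n. c i * (k (x - y) * f i y)) \<partial>m)"
    unfolding conv_def by (intro Bochner_Integration.integral_cong refl) (simp add: sum_distrib_left mult_ac)
  also have "\<dots> = (\<Sum>i<n. c i * conv k (f i) x)"
    using assms by (simp add: conv_def integrable_mult continuous_shift)
  finally show "conv k (\<lambda>x. \<Sum>i<n. c i * f i x) x = (\<Sum>i<n. c i * conv k (f i) x)" .
qed

text \<open>A difference of a convolution may be charged to the kernel, here, or to the function, in
  \<open>conv_diff_right\<close>. The first brings in the modulus of continuity of the kernel; both
  together move a difference from kernel to function.\<close>

lemma conv_diff_left:
  assumes "continuous_on UNIV k" "continuous_on UNIV f"
  shows "conv k f x - conv k f (x + a) = conv (\<lambda>z. k z - k (z + a)) f x"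
proof -
  have "continuous_on UNIV (\<lambda>y. k (x - y))" "continuous_on UNIV (\<lambda>y. k (x + a - y))"
    using assms(1) by (auto intro: continuous_shift)
  then have "(\<integral>y. k (x - y) * f y - k (x + a - y) * f y \<partial>m) = conv k f x - conv k f (x + a)"
    unfolding conv_def using assms(2) by (intro Bochner_Integration.integral_diff integrable_mult)
  moreover have "k (x - y) * f y - k (x + a - y) * f y = (k (x - y) - k (x - y + a)) * f y" for y
    by (simp add: left_diff_distrib algebra_simps)
  ultimately show ?thesis by (simp add: conv_def)
qed

lemma conv_diff_right:
  assumes "continuous_on UNIV k" "continuous_on UNIV f"
  shows "conv k (\<lambda>y. f y - f (y + a)) x = conv k f x - conv k f (x + a)"
proof -
  have "conv k (\<lambda>y. f y - f (y + a)) x = conv k f x - conv k (\<lambda>y. f (y + a)) x"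
    using assms by (simp add: conv_def right_diff_distrib integrable_mult continuous_shift)
  then show ?thesis by (simp add: conv_shift[OF assms])
qed

text \<open>The squared \<open>L^2\<close> norm, taken of the reflected function because convolution
  integrates \<open>k (x - y)\<close> over \<open>y\<close>; translation by \<open>x\<close> alone
  leads to this form.\<close>

definition sqn :: "('a \<Rightarrow> real) \<Rightarrow> real" where
  "sqn k = ip (\<lambda>y. k (- y)) (\<lambda>y. k (- y))"

text \<open>Cauchy--Schwarz bounds \<open>conv k f\<close> pointwise, uniformly in \<open>x\<close>
  by translation invariance, and the total mass is 1.\<close>

lemma conv_bound:
  assumes k: "continuous_on UNIV k" and f: "continuous_on UNIV f"
  shows "ip (conv k f) (conv k f) \<le> sqn k * ip f f"
proof -
  have "conv k f x * conv k f x \<le> sqn k * ip f f" for x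
  proof -
    have "(\<lambda>y. k (x - (y + x))) = (\<lambda>y. k (- y))" by (simp add: fun_eq_iff)
    then have "ip (\<lambda>y. k (x - y)) (\<lambda>y. k (x - y)) = sqn k"
      using ip_shift[of "\<lambda>y. k (x - y)" "\<lambda>y. k (x - y)" x] k by (simp add: sqn_def continuous_shift)
    moreover have "conv k f x = ip (\<lambda>y. k (x - y)) f" by (simp add: conv_def ip_def)
    ultimately show ?thesis
      using ip_cauchy_schwarz[of "\<lambda>y. k (x - y)" f] k f by (simp add: continuous_shift power2_eq_square)
  qed
  then have "ip (conv k f) (conv k f) \<le> (\<integral>x. sqn k * ip f f \<partial>m)"
    unfolding ip_def[of "conv k f"]
    by (intro integral_mono integrable_mult integrable_continuous continuous_conv k f) (auto intro: continuous_intros)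
  then show ?thesis by simp
qed

text \<open>The power method for the operator of convolution with \<open>k\<close>: the iterates \<open>h n\<close>
  are approximate eigenvectors of its square, with eigenvalue \<open>\<rho>\<close>.\<close>

lemma power_iterates:
  assumes k: "continuous_on UNIV k" and even: "\<And>x. k (- x) = k x" and k0: "k x0 \<noteq> 0"
  defines "h \<equiv> \<lambda>n. (conv k ^^ n) k"
  obtains \<rho> where "\<rho> > 0" "\<And>n. ip (h n) (h n) > 0"
    "(\<lambda>n. ip (\<lambda>x. h (n + 2) x - \<rho> * h n x) (\<lambda>x. h (n + 2) x - \<rho> * h n x) / ip (h n) (h n)) \<longlonglongrightarrow> 0"
proof -
  define s where "s n = ip (h n) (h n)" for n
  have hc: "continuous_on UNIV (h n)" for n
    by (induction n) (auto simp: h_def k intro: continuous_conv)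
  have hS: "h (Suc n) = conv k (h n)" for n by (simp add: h_def)
  \<comment> \<open>An even kernel gives a self-adjoint operator, which can be moved across the
    product; Cauchy--Schwarz then makes \<open>s\<close> log-convex.\<close>
  have mid: "ip (h (n + 2)) (h n) = s (n + 1)" for n
    using conv_symmetric[OF k hc[of "n + 1"] hc[of n] even] by (simp add: s_def hS)
  have logconv: "(s (n + 1))\<^sup>2 \<le> s (n + 2) * s n" for n
    using ip_cauchy_schwarz[OF hc[of "n + 2"] hc[of n]] unfolding mid by (simp add: s_def)
  have sq_pos: "ip f f > 0" if "continuous_on UNIV f" "f x \<noteq> 0" for f x
    unfolding ip_def using that
    by (intro integral_pos[where ?x0.0 = x] continuous_intros) (auto simp: zero_less_mult_iff linorder_neq_iff)
  have "conv k k 0 = ip k k" by (simp add: conv_def ip_def even)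
  moreover have "ip k k > 0" by (rule sq_pos[OF k k0])
  ultimately have "s 1 > 0" unfolding s_def by (intro sq_pos[OF hc, of _ 0]) (simp add: h_def)
  moreover have "s 0 > 0" using sq_pos[OF k k0] by (simp add: s_def h_def)
  ultimately have pos2: "s n > 0 \<and> s (n + 1) > 0" for n
  proof (induction n)
    case (Suc n)
    then have "0 < (s (n + 1))\<^sup>2" by simp
    then have "0 < s (n + 2) * s n" using logconv[of n] by linarith
    then show ?case using Suc by (simp add: zero_less_mult_iff)
  qed simp
  then have s_pos: "s n > 0" for n by blast
  \<comment> \<open>Log-convexity of \<open>s\<close> makes these ratios increase, and the norm
    bound for the operator stops them. Their limit stands in for an eigenvalue of the squared
    operator.\<close>
  define r where "r n = s (n + 1) / s n" for n
  have "r n \<le> r (Suc n)" for n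
    using logconv[of n] s_pos[of n] s_pos[of "n + 1"] by (simp add: r_def power2_eq_square field_simps)
  then have inc: "incseq r" by (rule incseq_SucI)
  have "s (n + 1) \<le> sqn k * s n" for n
    using conv_bound[OF k hc[of n]] by (simp add: s_def hS)
  then have "r n \<le> sqn k" for n using s_pos[of n] by (simp add: r_def field_simps)
  then obtain \<rho> where \<rho>: "r \<longlonglongrightarrow> \<rho>" "\<And>n. r n \<le> \<rho>" using incseq_convergent[OF inc] by blast
  have "r 0 > 0" using s_pos by (simp add: r_def)
  then have \<rho>0: "\<rho> > 0" using \<rho>(2)[of 0] by linarith
  \<comment> \<open>By \<open>mid\<close> the relative error is a function of the ratios alone, and
    it tends to 0 as they approach \<open>\<rho>\<close>.\<close>
  have "ip (\<lambda>x. h (n + 2) x - \<rho> * h n x) (\<lambda>x. h (n + 2) x - \<rho> * h n x) / s n =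
    r (Suc n) * r n - 2 * \<rho> * r n + \<rho>\<^sup>2" for n
  proof -
    have "ip (\<lambda>x. h (n + 2) x - \<rho> * h n x) (\<lambda>x. h (n + 2) x - \<rho> * h n x) = s (n + 2) - 2 * \<rho> * s (n + 1) + \<rho>\<^sup>2 * s n"
      using ip_lincomb[OF hc[of "n + 2"] hc[of n], of 1 "- \<rho>"] unfolding mid by (simp add: s_def)
    then show ?thesis using s_pos[of n] s_pos[of "n + 1"] by (simp add: r_def field_simps)
  qed
  moreover have "(\<lambda>n. r (Suc n) * r n - 2 * \<rho> * r n + \<rho>\<^sup>2) \<longlonglongrightarrow> \<rho> * \<rho> - 2 * \<rho> * \<rho> + \<rho>\<^sup>2"
    by (intro tendsto_intros \<rho>(1) LIMSEQ_Suc[OF \<rho>(1)])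
  ultimately have "(\<lambda>n. ip (\<lambda>x. h (n + 2) x - \<rho> * h n x) (\<lambda>x. h (n + 2) x - \<rho> * h n x) / s n) \<longlonglongrightarrow> 0"
    by (simp add: power2_eq_square)
  then show thesis using that \<rho>0 s_pos unfolding s_def by blast
qed

lemma ip_shift_diff:
  assumes f: "continuous_on UNIV f"
  shows "ip (\<lambda>x. f x - f (x + a)) (\<lambda>x. f x - f (x + a)) = 2 * ip f f - 2 * ip f (\<lambda>x. f (x + a))"
  using ip_lincomb[OF f continuous_shift(1)[OF f, of a], of 1 "-1"] ip_shift[OF f f, of a] by simp

lemma ip_shift_diff_le:
  assumes f: "continuous_on UNIV f"
  shows "ip (\<lambda>x. f x - f (x + a)) (\<lambda>x. f x - f (x + a)) \<le> 4 * ip f f"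
  using ip_lincomb[OF f continuous_shift(1)[OF f, of a], of 1 1] ip_nonneg[of "\<lambda>x. 1 * f x + 1 * f (x + a)"]
    ip_shift[OF f f, of a] ip_shift_diff[OF f, of a] by simp

text \<open>The right side minus the left is the squared norm of \<open>2 * g - \<rho> * f\<close>.
  Thus the norm of an approximate eigenvector \<open>f\<close> is controlled by that of its image
  \<open>g\<close>.\<close>

lemma ip_parallelogram_le:
  assumes f: "continuous_on UNIV f" and g: "continuous_on UNIV g"
  shows "\<rho>\<^sup>2 * ip f f \<le> 2 * ip g g + 2 * ip (\<lambda>x. g x - \<rho> * f x) (\<lambda>x. g x - \<rho> * f x)"
  using ip_lincomb[OF g f, of 1 "- \<rho>"] ip_lincomb[OF g f, of 2 "- \<rho>"]
    ip_nonneg[of "\<lambda>x. 2 * g x + (- \<rho>) * f x"] by (simp add: algebra_simps)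

text \<open>The normalised autocorrelations of the iterates cluster at a state whose spectral support
  consists of characters \<open>\<gamma>\<close> that are controlled by the moduli of continuity of \<open>k\<close>
  and, because \<open>k\<close> is a difference \<open>l - l(\<sqdot> + c)\<close>, satisfy \<open>\<gamma> c \<noteq> 1\<close>.\<close>

lemma kernel_pd_states:
  assumes k: "continuous_on UNIV k" and even: "\<And>x. k (- x) = k x" and k0: "k x0 \<noteq> 0"
    and l: "continuous_on UNIV l" and kl: "\<And>x. k x = l x - l (x + c)"
  obtains A B where
    "pd_states (insert (2 * B - 1, - B, c) (range (\<lambda>a. (A * sqn (\<lambda>z. k z - k (z + a)) - 2, 1, a)))) \<noteq> {}"
proof -
  define h where "h = (\<lambda>n. (conv k ^^ n) k)"
  obtain \<rho> where \<rho>: "\<rho> > 0" and s_pos: "\<And>n. ip (h n) (h n) > 0"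
    and \<delta>0: "(\<lambda>n. ip (\<lambda>x. h (n + 2) x - \<rho> * h n x) (\<lambda>x. h (n + 2) x - \<rho> * h n x) / ip (h n) (h n)) \<longlonglongrightarrow> 0"
    using power_iterates[OF k even k0] unfolding h_def by blast
  define s where "s n = ip (h n) (h n)" for n
  define \<delta> where "\<delta> n = ip (\<lambda>x. h (n + 2) x - \<rho> * h n x) (\<lambda>x. h (n + 2) x - \<rho> * h n x) / s n" for n
  have \<delta>_lim: "\<delta> \<longlonglongrightarrow> 0" using \<delta>0 unfolding \<delta>_def[abs_def] s_def .
  have s0: "s n > 0" for n using s_pos by (simp add: s_def)
  have hc: "continuous_on UNIV (h n)" for n
    by (induction n) (auto simp: h_def k intro: continuous_conv)
  have hS: "h (Suc n) = conv k (h n)" for n by (simp add: h_def)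
  define \<psi> where "\<psi> n a = ip (\<lambda>x. h n (x + a)) (h n) / s n" for n a
  have corr: "ip (\<lambda>x. h n (x + p)) (\<lambda>x. h n (x + q)) = s n * \<psi> n (p - q)" for n p q
    using ip_shift[OF continuous_shift(1)[OF hc[of n], of "p - q"] hc[of n], of q] s0[of n]
    by (simp add: \<psi>_def add.assoc)
  have \<psi>0: "\<psi> n 0 = 1" for n using s0[of n] by (simp add: \<psi>_def s_def)
  have \<psi>_even: "\<psi> n (- a) = \<psi> n a" for n a
  proof -
    have "ip (\<lambda>x. h n (x + 0)) (\<lambda>x. h n (x + a)) = ip (\<lambda>x. h n (x + a)) (\<lambda>x. h n (x + 0))"
      by (simp add: ip_def mult.commute)
    then have "s n * \<psi> n (0 - a) = s n * \<psi> n (a - 0)" unfolding corr .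
    then show ?thesis using s0[of n] by simp
  qed
  have \<psi>_bound: "\<psi> n a \<in> {-1..1}" for n a
  proof -
    have "(ip (\<lambda>x. h n (x + a)) (h n))\<^sup>2 \<le> (s n)\<^sup>2"
      using ip_cauchy_schwarz[OF continuous_shift(1)[OF hc[of n], of a] hc[of n]] ip_shift[OF hc hc, of n a]
      by (simp add: s_def power2_eq_square)
    then have "\<bar>ip (\<lambda>x. h n (x + a)) (h n)\<bar> \<le> s n" using s0[of n] by (simp add: abs_le_square_iff[symmetric])
    then show ?thesis using s0[of n] by (auto simp: \<psi>_def field_simps abs_le_iff)
  qed
  have comp: "compact {\<psi> :: 'a \<Rightarrow> real. \<forall>a. \<psi> a \<in> {-1..1}}" by (rule compact_Pi_UNIV) auto
  have mem: "\<psi> n \<in> {\<psi>. \<forall>a. \<psi> a \<in> {-1..1}}" for n using \<psi>_bound by blast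
  obtain \<Psi> where \<Psi>: "\<And>P. closed P \<Longrightarrow> \<forall>\<^sub>F n in sequentially. \<psi> n \<in> P \<Longrightarrow> \<Psi> \<in> P"
    using compact_cluster_point[where u = \<psi>, OF comp mem] by metis
  have coord: "continuous_on UNIV (\<lambda>\<psi> :: 'a \<Rightarrow> real. \<psi> a)" for a
    by (rule continuous_on_product_coordinates)
  have "\<Psi> \<in> {\<psi>. \<psi> 0 = 1}"
  proof (rule \<Psi>)
    show "closed {\<psi> :: 'a \<Rightarrow> real. \<psi> 0 = 1}" by (intro closed_Collect_eq coord continuous_on_const)
    show "\<forall>\<^sub>F n in sequentially. \<psi> n \<in> {\<psi>. \<psi> 0 = 1}" by (simp add: \<psi>0)
  qed
  then have \<Psi>0: "\<Psi> 0 = 1" by simp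
  have "\<Psi> \<in> {\<psi>. \<psi> (- a) = \<psi> a}" for a
  proof (rule \<Psi>)
    show "closed {\<psi> :: 'a \<Rightarrow> real. \<psi> (- a) = \<psi> a}" by (intro closed_Collect_eq coord)
    show "\<forall>\<^sub>F n in sequentially. \<psi> n \<in> {\<psi>. \<psi> (- a) = \<psi> a}" by (simp add: \<psi>_even)
  qed
  then have \<Psi>_even: "\<Psi> (- a) = \<Psi> a" for a by simp

  \<comment> \<open>The real quadratic form of \<open>sym_shift s t a \<psi>\<close>. It involves
    finitely many values of \<open>\<psi>\<close>, so a lower bound up to multiples of
    \<open>\<delta> n\<close> becomes nonnegativity at the cluster point.\<close>
  define form where "form s t a \<psi> N b d = (\<Sum>i<N. \<Sum>j<N. d i * d j *
      (s * \<psi> (b i - b j) + t * (\<psi> (b i - b j + a) + \<psi> (b i - b j - a))))"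
    for s t a and \<psi> :: "'a \<Rightarrow> real" and N :: nat and b :: "nat \<Rightarrow> 'a" and d :: "nat \<Rightarrow> real"
  have form_limit: "0 \<le> form s t a \<Psi> N b d" if ev: "\<And>n. - (K * \<delta> n) \<le> form s t a (\<psi> n) N b d" for s t a N b d K
  proof (rule field_le_epsilon)
    fix e :: real assume e: "e > 0"
    have "(\<lambda>n. - (K * \<delta> n)) \<longlonglongrightarrow> - (K * 0)" by (intro tendsto_intros \<delta>_lim)
    then have "\<forall>\<^sub>F n in sequentially. - e < - (K * \<delta> n)" using e by (intro order_tendstoD) auto
    then have "\<forall>\<^sub>F n in sequentially. \<psi> n \<in> {\<psi>. - e \<le> form s t a \<psi> N b d}"
    proof (rule eventually_mono)
      fix n assume "- e < - (K * \<delta> n)"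
      with ev[of n] show "\<psi> n \<in> {\<psi>. - e \<le> form s t a \<psi> N b d}" by simp
    qed
    moreover have "closed {\<psi>. - e \<le> form s t a \<psi> N b d}"
      unfolding form_def by (intro closed_Collect_le continuous_intros coord)
    ultimately have "- e \<le> form s t a \<Psi> N b d" using \<Psi> by blast
    then show "0 \<le> form s t a \<Psi> N b d + e" by simp
  qed
  have pd_limit: "pos_def (sym_shift s t a (\<lambda>x. of_real (\<Psi> x)))"
    if "\<And>N b d. \<exists>K. \<forall>n. - (K * \<delta> n) \<le> form s t a (\<psi> n) N b d" for s t a
  proof -
    have "pos_def (\<lambda>x. of_real (s * \<Psi> x + t * (\<Psi> (x + a) + \<Psi> (x - a))))"
    proof (rule pos_def_of_real)
      fix x
      have "\<Psi> (- x + a) = \<Psi> (x - a)" "\<Psi> (- x - a) = \<Psi> (x + a)"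
        using \<Psi>_even[of "x - a"] \<Psi>_even[of "x + a"] by (simp_all add: add.commute[of "- x"])
      then show "s * \<Psi> (- x) + t * (\<Psi> (- x + a) + \<Psi> (- x - a)) = s * \<Psi> x + t * (\<Psi> (x + a) + \<Psi> (x - a))"
        by (simp add: \<Psi>_even)
    next
      fix N :: nat and d :: "nat \<Rightarrow> real" and b
      show "0 \<le> (\<Sum>i<N. \<Sum>j<N. d i * d j *
          (s * \<Psi> (b i - b j) + t * (\<Psi> (b i - b j + a) + \<Psi> (b i - b j - a))))"
        using form_limit that unfolding form_def by blast
    qed
    then show ?thesis by (simp add: sym_shift_def)
  qed

  \<comment> \<open>Combinations of translates of an iterate. By \<open>H0\<close> and
    \<open>H1\<close> the forms for \<open>(1, 0)\<close> and \<open>(2, -1)\<close> are normalised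
    squared norms of \<open>H\<close> and of its difference by \<open>a\<close>, so spectral
    inequalities become norm inequalities.\<close>
  define H where "H N b d n = (\<lambda>x. \<Sum>i<N. d i * h n (x + b i))"
    for N :: nat and b :: "nat \<Rightarrow> 'a" and d :: "nat \<Rightarrow> real" and n
  have Hc: "continuous_on UNIV (H N b d n)" for N b d n
    unfolding H_def by (intro continuous_intros continuous_shift hc)
  have HS: "conv k (H N b d n) = H N b d (Suc n)" for N b d n
    unfolding H_def by (subst conv_sum[OF k]) (auto simp: continuous_shift hc conv_shift[OF k hc] hS)
  have H0: "ip (H N b d n) (H N b d n) = s n * form 1 0 a (\<psi> n) N b d" for N b d n a
    unfolding H_def by (subst ip_sum) (auto simp: continuous_shift hc corr form_def sum_distrib_left mult_ac)
  have H1: "ip (\<lambda>x. H N b d n x - H N b d n (x + a)) (\<lambda>x. H N b d n x - H N b d n (x + a))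
      = s n * form 2 (-1) a (\<psi> n) N b d" for N b d n a
  proof -
    have "ip (H N b d n) (\<lambda>x. H N b d n (x + a)) = (\<Sum>i<N. \<Sum>j<N. d i * d j * (s n * \<psi> n (b i - b j - a)))"
      unfolding H_def add.assoc
      by (subst ip_sum) (auto simp: continuous_shift hc corr diff_diff_eq add.commute[of a])
    moreover from this have "ip (H N b d n) (\<lambda>x. H N b d n (x + a)) = (\<Sum>i<N. \<Sum>j<N. d i * d j * (s n * \<psi> n (b i - b j + a)))"
    proof -
      have "\<psi> n (b i - b j - a) = \<psi> n (b j - b i + a)" for i j
        using \<psi>_even[of n "b j - b i + a"] by (simp add: algebra_simps)
      then show ?thesis using calculation by (subst sum.swap) (simp add: mult_ac)
    qed
    ultimately have "2 * ip (H N b d n) (\<lambda>x. H N b d n (x + a)) =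
      (\<Sum>i<N. \<Sum>j<N. d i * d j * (s n * \<psi> n (b i - b j - a))) + (\<Sum>i<N. \<Sum>j<N. d i * d j * (s n * \<psi> n (b i - b j + a)))"
      by linarith
    then show ?thesis unfolding ip_shift_diff[OF Hc] H0[of _ _ _ _ a] form_def
      by (simp add: sum_distrib_left flip: sum.distrib sum_subtractf) (simp add: algebra_simps)
  qed
  \<comment> \<open>Cauchy--Schwarz for a sum of \<open>N\<close> translates: the error of the
    iterate grows at most by this factor, which is independent of \<open>n\<close>.\<close>
  define M where "M N d = N * (\<Sum>i<N. (d i)\<^sup>2)" for N :: nat and d :: "nat \<Rightarrow> real"
  have Herr: "ip (\<lambda>x. H N b d (n + 2) x - \<rho> * H N b d n x) (\<lambda>x. H N b d (n + 2) x - \<rho> * H N b d n x)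
      \<le> M N d * (s n * \<delta> n)" for N b d n
  proof -
    define g where "g x = h (n + 2) x - \<rho> * h n x" for x
    have gc: "continuous_on UNIV g" unfolding g_def by (intro continuous_intros hc)
    have diff: "H N b d (n + 2) x - \<rho> * H N b d n x = (\<Sum>i<N. d i * g (x + b i))" for x
      by (simp add: H_def g_def sum_distrib_left algebra_simps sum_subtractf)
    have "ip (\<lambda>x. \<Sum>i<N. d i * g (x + b i)) (\<lambda>x. \<Sum>i<N. d i * g (x + b i))
      \<le> (\<integral>x. (\<Sum>i<N. (N * (d i)\<^sup>2) * (g (x + b i) * g (x + b i))) \<partial>m)"
      unfolding ip_def
    proof (intro integral_mono integrable_continuous)
      fix x
      have "(\<Sum>i<N. d i * g (x + b i))\<^sup>2 \<le> (\<Sum>i<N. (d i * g (x + b i))\<^sup>2) * card {..<N}"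
        by (rule sum_squared_le_sum_of_squares)
      then show "(\<Sum>i<N. d i * g (x + b i)) * (\<Sum>i<N. d i * g (x + b i)) \<le>
          (\<Sum>i<N. (N * (d i)\<^sup>2) * (g (x + b i) * g (x + b i)))"
        by (simp add: power2_eq_square sum_distrib_left sum_distrib_right mult_ac)
    qed (intro continuous_intros continuous_shift gc)+
    also have "\<dots> = (\<Sum>i<N. (N * (d i)\<^sup>2) * ip g g)"
      using gc ip_shift[OF gc gc] by (simp add: integrable_mult continuous_shift ip_def)
    also have "ip g g = s n * \<delta> n" using s0[of n] by (simp add: \<delta>_def g_def[abs_def])
    finally show ?thesis unfolding diff by (simp add: M_def sum_distrib_left sum_distrib_right)
  qed
  have normalise: "x \<le> (a / \<rho>\<^sup>2) * y + (b / \<rho>\<^sup>2) * \<delta> n"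
    if "\<rho>\<^sup>2 * (s n * x) \<le> a * (s n * y) + b * (s n * \<delta> n)" for x y a b n
  proof -
    have "s n * (\<rho>\<^sup>2 * x) \<le> s n * (a * y + b * \<delta> n)" using that by (simp add: algebra_simps)
    then have "\<rho>\<^sup>2 * x \<le> a * y + b * \<delta> n" using s0[of n] by (simp only: mult_le_cancel_left_pos)
    then have "x \<le> (a * y + b * \<delta> n) / \<rho>\<^sup>2" using \<rho> by (simp add: pos_le_divide_eq mult.commute)
    then show ?thesis by (simp add: add_divide_distrib)
  qed
  \<comment> \<open>Spectrally the aims are
    \<open>|1 - \<gamma>(a)|^2 \<le> A * sqn (k - k(. + a))\<close> and
    \<open>1 \<le> B * |1 - \<gamma>(c)|^2\<close>. The 2 and the \<open>\<rho>\<^sup>2\<close> come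
    from \<open>ip_parallelogram_le\<close>, and each factor \<open>sqn\<close> from one
    convolution.\<close>
  define A where "A = 2 * sqn k / \<rho>\<^sup>2"
  define B where "B = 2 * sqn k * sqn l / \<rho>\<^sup>2"
  have sqn_nonneg: "0 \<le> sqn f" for f by (simp add: sqn_def ip_nonneg)
  have form_diff: "form (w * s1 - s2) (w * t1 - t2) a \<psi> N b d = w * form s1 t1 a \<psi> N b d - form s2 t2 a \<psi> N b d"
    for w s1 s2 t1 t2 a \<psi> N b d
    by (simp add: form_def sum_distrib_left flip: sum_subtractf) (simp add: algebra_simps)

  have "\<exists>K. \<forall>n. - (K * \<delta> n) \<le> form (A * sqn (\<lambda>z. k z - k (z + a)) - 2) 1 a (\<psi> n) N b d" for a N b d
  proof (intro exI allI)
    fix n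
    define V where "V = M N d * (s n * \<delta> n)"
    define \<kappa> where "\<kappa> = sqn (\<lambda>z. k z - k (z + a))"
    define D where "D f = (\<lambda>x. f x - f (x + a) :: real)" for f :: "'a \<Rightarrow> real"
    have Dc: "continuous_on UNIV (D f)" if "continuous_on UNIV f" for f
      unfolding D_def using that by (intro continuous_intros continuous_shift)
    let ?H = "H N b d"
    \<comment> \<open>Of the two convolutions that lead from \<open>?H n\<close> to
      \<open>?H (n + 2)\<close>, the last absorbs the difference into its kernel and the first costs
      a factor \<open>sqn k\<close>.\<close>
    have "D (?H (n + 2)) = conv (\<lambda>z. k z - k (z + a)) (?H (n + 1))"
      using HS[of N b d "n + 1"] conv_diff_left[OF k Hc[of N b d "n + 1"], of _ a] by (simp add: D_def fun_eq_iff)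
    then have 1: "ip (D (?H (n + 2))) (D (?H (n + 2))) \<le> \<kappa> * ip (?H (n + 1)) (?H (n + 1))"
      unfolding \<kappa>_def using conv_bound[OF Dc[OF k, unfolded D_def] Hc] by simp
    have 2: "ip (?H (n + 1)) (?H (n + 1)) \<le> sqn k * ip (?H n) (?H n)"
      using conv_bound[OF k Hc[of N b d n]] by (simp add: HS)
    have 3: "ip (\<lambda>x. D (?H (n + 2)) x - \<rho> * D (?H n) x) (\<lambda>x. D (?H (n + 2)) x - \<rho> * D (?H n) x) \<le> 4 * V"
    proof -
      define E where "E x = ?H (n + 2) x - \<rho> * ?H n x" for x
      have Ec: "continuous_on UNIV E" unfolding E_def by (intro continuous_intros Hc)
      have "(\<lambda>x. D (?H (n + 2)) x - \<rho> * D (?H n) x) = (\<lambda>x. E x - E (x + a))"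
        by (simp add: D_def E_def fun_eq_iff algebra_simps)
      moreover have "ip E E \<le> V" using Herr[of N b d n] unfolding E_def V_def .
      ultimately show ?thesis using ip_shift_diff_le[OF Ec, of a] by simp
    qed
    have "\<rho>\<^sup>2 * ip (D (?H n)) (D (?H n)) \<le> 2 * (\<kappa> * (sqn k * ip (?H n) (?H n))) + 8 * V"
      using ip_parallelogram_le[OF Dc[OF Hc] Dc[OF Hc], of \<rho> N b d n N b d "n + 2"] 1 3
        mult_left_mono[OF 2 sqn_nonneg[of "\<lambda>z. k z - k (z + a)"]] unfolding \<kappa>_def by linarith
    then have "\<rho>\<^sup>2 * (s n * form 2 (-1) a (\<psi> n) N b d) \<le>
      2 * (\<kappa> * (sqn k * (s n * form 1 0 a (\<psi> n) N b d))) + 8 * V"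
      unfolding D_def H1 H0[of _ _ _ _ a] .
    then have "form 2 (-1) a (\<psi> n) N b d \<le>
      (2 * \<kappa> * sqn k / \<rho>\<^sup>2) * form 1 0 a (\<psi> n) N b d + (8 * M N d / \<rho>\<^sup>2) * \<delta> n"
      by (intro normalise) (simp add: V_def algebra_simps)
    then show "- ((8 * M N d / \<rho>\<^sup>2) * \<delta> n)
        \<le> form (A * sqn (\<lambda>z. k z - k (z + a)) - 2) 1 a (\<psi> n) N b d"
      using form_diff[of "A * \<kappa>" 1 2 0 "-1" a "\<psi> n" N b d] by (simp add: \<kappa>_def A_def mult_ac)
  qed
  then have pdA: "pos_def (sym_shift (A * sqn (\<lambda>z. k z - k (z + a)) - 2) 1 a (\<lambda>x. of_real (\<Psi> x)))" for a
    by (rule pd_limit)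

  have "\<exists>K. \<forall>n. - (K * \<delta> n) \<le> form (2 * B - 1) (- B) c (\<psi> n) N b d" for N b d
  proof (intro exI allI)
    fix n
    define V where "V = M N d * (s n * \<delta> n)"
    let ?H = "H N b d"
    have Dc: "continuous_on UNIV (\<lambda>x. ?H n x - ?H n (x + c))" by (intro continuous_intros continuous_shift Hc)
    \<comment> \<open>As the kernel is itself a difference of \<open>l\<close>, that difference
      passes to the function, and the next iterate is bounded by the difference of
      \<open>?H n\<close> by \<open>c\<close>.\<close>
    have "conv k f = conv (\<lambda>z. l z - l (z + c)) f" for f by (simp add: conv_def kl)
    then have "?H (n + 1) = conv l (\<lambda>x. ?H n x - ?H n (x + c))"
      using HS[of N b d n] conv_diff_left[OF l Hc[of N b d n], of _ c]
        conv_diff_right[OF l Hc[of N b d n], of c] by (simp add: fun_eq_iff)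
    then have 1: "ip (?H (n + 1)) (?H (n + 1)) \<le> sqn l *
        ip (\<lambda>x. ?H n x - ?H n (x + c)) (\<lambda>x. ?H n x - ?H n (x + c))"
      using conv_bound[OF l Dc] by simp
    have 2: "ip (?H (n + 2)) (?H (n + 2)) \<le> sqn k * ip (?H (n + 1)) (?H (n + 1))"
      using conv_bound[OF k Hc[of N b d "n + 1"]] by (simp add: HS)
    have 3: "ip (\<lambda>x. ?H (n + 2) x - \<rho> * ?H n x) (\<lambda>x. ?H (n + 2) x - \<rho> * ?H n x) \<le> V"
      unfolding V_def by (rule Herr)
    have "\<rho>\<^sup>2 * ip (?H n) (?H n) \<le> 2 * (sqn k * (sqn l *
        ip (\<lambda>x. ?H n x - ?H n (x + c)) (\<lambda>x. ?H n x - ?H n (x + c)))) + 2 * V"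
      using ip_parallelogram_le[OF Hc Hc, of \<rho> N b d n N b d "n + 2"] 2 3
        mult_left_mono[OF 1 sqn_nonneg[of k]] by linarith
    then have "\<rho>\<^sup>2 * (s n * form 1 0 c (\<psi> n) N b d) \<le>
      2 * (sqn k * (sqn l * (s n * form 2 (-1) c (\<psi> n) N b d))) + 2 * V"
      unfolding H1 H0[of _ _ _ _ c] .
    then have "form 1 0 c (\<psi> n) N b d \<le>
      (2 * sqn k * sqn l / \<rho>\<^sup>2) * form 2 (-1) c (\<psi> n) N b d + (2 * M N d / \<rho>\<^sup>2) * \<delta> n"
      by (intro normalise) (simp add: V_def algebra_simps)
    then show "- ((2 * M N d / \<rho>\<^sup>2) * \<delta> n) \<le> form (2 * B - 1) (- B) c (\<psi> n) N b d"
      using form_diff[of B 2 1 "-1" 0 c "\<psi> n" N b d] by (simp add: B_def mult_ac)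
  qed
  then have pdB: "pos_def (sym_shift (2 * B - 1) (- B) c (\<lambda>x. of_real (\<Psi> x)))"
    by (rule pd_limit)
  \<comment> \<open>Positive definiteness of the cluster point itself, as the condition
    \<open>(1, 0, 0)\<close>, where no error occurs.\<close>
  have "\<exists>K. \<forall>n. - (K * \<delta> n) \<le> form 1 0 0 (\<psi> n) N b d" for N b d
  proof (intro exI allI)
    fix n
    have "0 \<le> s n * form 1 0 0 (\<psi> n) N b d" using ip_nonneg H0[of N b d n 0] by metis
    then show "- (0 * \<delta> n) \<le> form 1 0 0 (\<psi> n) N b d" using s0[of n] by (simp add: zero_le_mult_iff)
  qed
  then have "pos_def (sym_shift 1 0 0 (\<lambda>x. of_real (\<Psi> x)))" by (rule pd_limit)
  then have "(\<lambda>x. of_real (\<Psi> x)) \<in>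
    pd_states (insert (2 * B - 1, - B, c) (range (\<lambda>a. (A * sqn (\<lambda>z. k z - k (z + a)) - 2, 1, a))))"
    using pdA pdB \<Psi>0 by (auto simp: pd_states_def sym_shift_1_0)
  then show thesis using that by blast
qed

end

subsection \<open>Characters\<close>

text \<open>A type of its own, so that the dual group can be written additively and the results on
  lattices apply to it.\<close>

typedef (overloaded) 'a character =
  "{\<gamma> :: 'a::topological_ab_group_add \<Rightarrow> complex.
     continuous_on UNIV \<gamma> \<and> (\<forall>x y. \<gamma> (x + y) = \<gamma> x * \<gamma> y) \<and> (\<forall>x. norm (\<gamma> x) = 1)}"
  morphisms chr Character
  by (intro exI[of _ "\<lambda>_. 1"]) auto

lemma continuous_chr: "continuous_on UNIV (chr \<gamma>)"
  and chr_add: "chr \<gamma> (x + y) = chr \<gamma> x * chr \<gamma> y"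
  and norm_chr [simp]: "norm (chr \<gamma> x) = 1"
  using chr[of \<gamma>] by auto

lemma chr_nonzero [simp]: "chr \<gamma> x \<noteq> 0"
  using norm_chr[of \<gamma> x] by (metis norm_zero zero_neq_one)

lemma chr_at_0 [simp]: "chr \<gamma> 0 = 1"
  using chr_add[of \<gamma> 0 0] by simp

lemma chr_mult_cnj [simp]: "chr \<gamma> x * cnj (chr \<gamma> x) = 1"
  by (simp flip: complex_norm_square)

lemma chr_uminus: "chr \<gamma> (- x) = cnj (chr \<gamma> x)"
proof -
  have "chr \<gamma> x * chr \<gamma> (- x) = 1" by (simp flip: chr_add)
  then have "chr \<gamma> x * chr \<gamma> (- x) = chr \<gamma> x * cnj (chr \<gamma> x)" by simp
  then show ?thesis unfolding mult_left_cancel[OF chr_nonzero] .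
qed

lemma chr_diff: "chr \<gamma> (x - y) = chr \<gamma> x * cnj (chr \<gamma> y)"
  using chr_add[of \<gamma> x "- y"] by (simp add: chr_uminus)

instantiation character :: (topological_ab_group_add) ab_group_add
begin

definition "0 = Character (\<lambda>_. 1)"
definition "\<gamma> + \<delta> = Character (\<lambda>x. chr \<gamma> x * chr \<delta> x)"
definition "- \<gamma> = Character (\<lambda>x. cnj (chr \<gamma> x))"
definition "\<gamma> - \<delta> = Character (\<lambda>x. chr \<gamma> x * cnj (chr \<delta> x))" for \<gamma> \<delta> :: "'a character"

lemma chr_zero: "chr 0 = (\<lambda>_. 1)"
  unfolding zero_character_def by (rule Character_inverse) auto

lemma chr_plus: "chr (\<gamma> + \<delta>) = (\<lambda>x. chr \<gamma> x * chr \<delta> x)"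
  unfolding plus_character_def
  by (rule Character_inverse) (auto simp: chr_add norm_mult intro!: continuous_intros continuous_chr)

lemma chr_neg: "chr (- \<gamma>) = (\<lambda>x. cnj (chr \<gamma> x))"
  unfolding uminus_character_def
  by (rule Character_inverse) (auto simp: chr_add intro!: continuous_intros continuous_chr)

lemma chr_minus: "chr (\<gamma> - \<delta>) = (\<lambda>x. chr \<gamma> x * cnj (chr \<delta> x))"
  unfolding minus_character_def
  by (rule Character_inverse) (auto simp: chr_add norm_mult intro!: continuous_intros continuous_chr)

instance
  by standard (simp_all add: chr_inject[symmetric] chr_zero chr_plus chr_neg chr_minus fun_eq_iff mult.commute)

end

lemma character_eqI: "(\<And>x. chr \<gamma> x = chr \<delta> x) \<Longrightarrow> \<gamma> = \<delta>"
  by (simp add: chr_inject[symmetric] fun_eq_iff)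

lemma chr_sum: "chr (sum f I) x = (\<Prod>i\<in>I. chr (f i) x)"
  by (induction I rule: infinite_finite_induct) (auto simp: chr_zero chr_plus)

text \<open>A torsion character takes values in the roots of unity of a fixed order, a finite set,
  and a connected finite image is a point.\<close>

lemma zmul_character_torsion_free:
  fixes \<gamma> :: "'a::topological_ab_group_add character"
  assumes "connected (UNIV :: 'a set)" "zmul k \<gamma> = 0"
  shows "k = 0 \<or> \<gamma> = 0"
proof (cases "k = 0")
  case False
  define n where "n = nat \<bar>k\<bar>"
  have n: "n \<ge> 1" using False by (simp add: n_def)
  have "zmul (int n) \<gamma> = 0"
    using assms(2) zmul_minus_left[of k \<gamma>] by (cases "k \<ge> 0") (auto simp: n_def)
  then have "chr (\<Sum>i<n. \<gamma>) x = chr 0 x" for x by (simp add: zmul_of_nat)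
  then have pow: "chr \<gamma> x ^ n = 1" for x by (simp add: chr_sum chr_zero)
  then have "range (chr \<gamma>) \<subseteq> {z. z ^ n = 1}" by auto
  then have "finite (range (chr \<gamma>))" using finite_roots_unity[OF n] finite_subset by blast
  moreover have "connected (range (chr \<gamma>))" by (rule connected_continuous_image[OF continuous_chr assms(1)])
  ultimately obtain w where "range (chr \<gamma>) = {w}" using connected_finite_iff_sing[of "range (chr \<gamma>)"] by auto
  then have "chr \<gamma> x = chr \<gamma> 0" for x by (metis rangeI singletonD)
  then have "\<gamma> = 0" by (intro character_eqI) (simp add: chr_zero)
  then show ?thesis ..
qed simp

section \<open>Trigonometric polynomials and their twists\<close>

text \<open>Pairs of a trigonometric polynomial and the one obtained by multiplying its coefficient at
  each character \<open>\<gamma>\<close> by \<open>\<phi> \<gamma>\<close>.\<close>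

inductive twisted :: "('a::topological_ab_group_add character \<Rightarrow> complex) \<Rightarrow> ('a \<Rightarrow> complex) \<Rightarrow> ('a \<Rightarrow> complex) \<Rightarrow> bool"
  for \<phi> where
  base: "twisted \<phi> (\<lambda>x. c * chr \<gamma> x) (\<lambda>x. c * \<phi> \<gamma> * chr \<gamma> x)"
| add: "twisted \<phi> p q \<Longrightarrow> twisted \<phi> p' q' \<Longrightarrow> twisted \<phi> (\<lambda>x. p x + p' x) (\<lambda>x. q x + q' x)"

text \<open>Multiplicativity of \<open>\<phi>\<close> makes twisting compatible with products, so a
  Riesz product can be twisted factor by factor.\<close>

lemma twisted_mult:
  assumes hom: "\<And>\<gamma> \<delta>. \<phi> (\<gamma> + \<delta>) = \<phi> \<gamma> * \<phi> \<delta>" and "twisted \<phi> p q" "twisted \<phi> p' q'"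
  shows "twisted \<phi> (\<lambda>x. p x * p' x) (\<lambda>x. q x * q' x)"
  using assms(2)
proof induction
  case (base c \<gamma>)
  from assms(3) show ?case
  proof induction
    case (base c' \<gamma>')
    show ?case using twisted.base[of \<phi> "c * c'" "\<gamma> + \<gamma>'"] by (simp add: hom chr_plus mult_ac)
  next
    case (add p q p' q')
    then show ?case using twisted.add[OF add.IH] by (simp add: distrib_left)
  qed
next
  case (add p q p' q')
  then show ?case using twisted.add[OF add.IH] by (simp add: distrib_right)
qed

lemma twisted_chr: "twisted \<phi> (chr \<gamma>) (\<lambda>x. \<phi> \<gamma> * chr \<gamma> x)"
  using twisted.base[of \<phi> 1 \<gamma>] by simp

lemma twisted_const: "\<phi> 0 = 1 \<Longrightarrow> twisted \<phi> (\<lambda>_. c) (\<lambda>_. c)"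
  using twisted.base[of \<phi> c 0] by (simp add: chr_zero)

lemma twisted_prod:
  assumes hom: "\<And>\<gamma> \<delta>. \<phi> (\<gamma> + \<delta>) = \<phi> \<gamma> * \<phi> \<delta>" and "\<phi> 0 = 1" "\<And>i. i \<in> I \<Longrightarrow> twisted \<phi> (p i) (q i)"
  shows "twisted \<phi> (\<lambda>x. \<Prod>i\<in>I. p i x) (\<lambda>x. \<Prod>i\<in>I. q i x)"
  using assms(3)
  by (induction I rule: infinite_finite_induct)
     (auto intro!: twisted_const[of \<phi> 1, OF assms(2)] twisted_mult[of \<phi>, OF hom])

definition trig :: "('a::topological_ab_group_add \<Rightarrow> complex) \<Rightarrow> bool" where
  "trig p \<longleftrightarrow> twisted (\<lambda>_. 1) p p"

lemma trig_cmult_chr: "trig (\<lambda>x. c * chr \<gamma> x)"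
  using twisted.base[of "\<lambda>_. 1" c \<gamma>] by (simp add: trig_def)

lemma trig_add: "trig p \<Longrightarrow> trig q \<Longrightarrow> trig (\<lambda>x. p x + q x)"
  unfolding trig_def by (rule twisted.add)

lemma trig_mult: "trig p \<Longrightarrow> trig q \<Longrightarrow> trig (\<lambda>x. p x * q x)"
  unfolding trig_def by (rule twisted_mult) simp

lemma trig_const: "trig (\<lambda>_. c)"
  using trig_cmult_chr[of c 0] by (simp add: chr_zero)

lemma trig_cmult: "trig p \<Longrightarrow> trig (\<lambda>x. c * p x)"
  by (rule trig_mult[OF trig_const])

lemma trig_induct [consumes 1, case_names base add]:
  assumes "trig p" "\<And>c \<gamma>. P (\<lambda>x. c * chr \<gamma> x)" "\<And>p q. P p \<Longrightarrow> P q \<Longrightarrow> P (\<lambda>x. p x + q x)"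
  shows "P p"
  using assms(1) unfolding trig_def by (induction rule: twisted.induct) (use assms in auto)

lemma twisted_continuous: "twisted \<phi> p q \<Longrightarrow> continuous_on UNIV p \<and> continuous_on UNIV q"
  by (induction rule: twisted.induct) (auto intro!: continuous_intros continuous_chr)

lemma trig_continuous: "trig p \<Longrightarrow> continuous_on UNIV p"
  by (auto simp: trig_def dest: twisted_continuous)

context compact_haar
begin

lemma integral_chr: "\<gamma> \<noteq> 0 \<Longrightarrow> (\<integral>x. chr \<gamma> x \<partial>m) = 0"
proof -
  assume "\<gamma> \<noteq> 0"
  then obtain a where a: "chr \<gamma> a \<noteq> 1" using character_eqI[of \<gamma> 0] by (auto simp: chr_zero)
  have "(\<integral>x. chr \<gamma> x \<partial>m) = (\<integral>x. chr \<gamma> (x + a) \<partial>m)"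
    by (rule integral_translate[symmetric]) (intro measurable_continuous continuous_chr)
  also have "\<dots> = (\<integral>x. chr \<gamma> x \<partial>m) * chr \<gamma> a" by (simp add: chr_add)
  finally show ?thesis using a by simp
qed

text \<open>Only the trivial character contributes to the integral, and there the twist multiplies
  by \<open>\<phi> 0 = 1\<close>.\<close>

lemma integral_twisted:
  assumes "twisted \<phi> p q" "\<phi> 0 = 1"
  shows "(\<integral>x. p x \<partial>m) = (\<integral>x. q x \<partial>m)"
  using assms(1)
proof induction
  case (base c \<gamma>)
  then show ?case using assms(2) by (cases "\<gamma> = 0") (auto simp: integral_chr)
next
  case (add p q p' q')
  then show ?case using twisted_continuous[OF add.hyps(1)] twisted_continuous[OF add.hyps(2)]
    by (simp add: integrable_continuous)
qed

text \<open>The negated second difference, with step \<open>c\<close>, of an even bump that is 2 at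
  0 and vanishes at \<open>c\<close> and \<open>- c\<close>: it is even, a first difference, and
  equal to 4 at 0.\<close>

lemma kernel_exists:
  assumes "c \<noteq> (0 :: 'a)"
  obtains k l x0 where "continuous_on UNIV k" "\<And>x. k (- x) = k x" "k x0 \<noteq> (0::real)"
    "continuous_on UNIV l" "\<And>x. k x = l x - l (x + c)"
proof -
  have sep: "closed {c, - c}" "closed {0 :: 'a}" "{c, - c} \<inter> {0} = {}"
    using assms neg_equal_0_iff_equal[of c] by (auto intro: finite_imp_closed)
  obtain u :: "'a \<Rightarrow> real" where u: "continuous_on UNIV u" "\<And>x. x \<in> {c, - c} \<Longrightarrow> u x = 0" "\<And>x. x \<in> {0} \<Longrightarrow> u x = 1"
    by (rule urysohn[OF sep]) blast
  define v where "v x = u x + u (- x)" for x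
  have vc: "continuous_on UNIV v" unfolding v_def by (intro continuous_intros u(1) continuous_shift(4))
  define l where "l x = v x - v (x - c)" for x
  define k where "k x = l x - l (x + c)" for x
  have lc: "continuous_on UNIV l" unfolding l_def by (intro continuous_intros vc continuous_shift)
  have even: "v (- x) = v x" for x by (simp add: v_def)
  show thesis
  proof (rule that[of k 0 l])
    show "continuous_on UNIV k" unfolding k_def by (intro continuous_intros lc continuous_shift)
    show "k (- x) = k x" for x
    proof -
      have "v (- x - c) = v (x + c)" "v (- x + c) = v (x - c)"
        using even[of "x + c"] even[of "x - c"] by (simp_all add: add.commute[of "- x"])
      then show ?thesis by (simp add: k_def l_def even)
    qed
    show "k 0 \<noteq> 0" using u by (simp add: k_def l_def v_def)
  qed (use lc k_def in auto)
qed

text \<open>The multiplicative function found among the states is a priori discontinuous. Its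
  continuity comes from the conditions with \<open>A\<close>, which bound
  \<open>|1 - \<gamma> a|^2\<close> by a continuous function of \<open>a\<close> that vanishes at
  0.\<close>

theorem character_separates:
  assumes "c \<noteq> (0 :: 'a)"
  obtains \<gamma> where "chr \<gamma> c \<noteq> 1"
proof -
  obtain k l x0 where k: "continuous_on UNIV k" and even: "\<And>x. k (- x) = k x" and k0: "k x0 \<noteq> (0::real)"
    and l: "continuous_on UNIV l" and kl: "\<And>x. k x = l x - l (x + c)"
    by (rule kernel_exists[OF assms]) (rule that)
  obtain A B where ne:
    "pd_states (insert (2 * B - 1, - B, c) (range (\<lambda>a. (A * sqn (\<lambda>z. k z - k (z + a)) - 2, 1, a)))) \<noteq> {}"
    by (rule kernel_pd_states[OF k even k0 l kl]) (rule that)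
  obtain \<gamma> where \<gamma>: "\<gamma> \<in> pd_states (insert (2 * B - 1, - B, c) (range (\<lambda>a. (A * sqn (\<lambda>z. k z - k (z + a)) - 2, 1, a))))"
    and mult: "\<And>x y. \<gamma> (x + y) = \<gamma> x * \<gamma> y"
    by (rule pd_states_character[OF ne]) (rule that)
  have pd: "pos_def \<gamma>" "\<gamma> 0 = 1" using \<gamma> by (auto simp: pd_states_def)
  have neg: "\<gamma> (- a) = cnj (\<gamma> a)" for a by (rule pos_def_hermitian[OF pd(1)])
  have norm1: "norm (\<gamma> a) = 1" for a
  proof -
    have "\<gamma> a * cnj (\<gamma> a) = 1" using mult[of a "- a"] pd(2) by (simp add: neg)
    then have "(norm (\<gamma> a))\<^sup>2 = 1" by (metis complex_norm_square of_real_eq_1_iff)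
    then show ?thesis using power2_eq_imp_eq[of "norm (\<gamma> a)" 1] by simp
  qed
  \<comment> \<open>A positive definite function is nonnegative at 0; evaluated there, the condition
    becomes an inequality for \<open>\<gamma> a\<close>.\<close>
  have cond: "0 \<le> s + 2 * t * Re (\<gamma> a)" if "pos_def (sym_shift s t a \<gamma>)" for s t a
    using pos_def_zero(2)[OF that] pd(2) by (simp add: sym_shift_def neg)
  define w where "w a = A * sqn (\<lambda>z. k z - k (z + a))" for a
  have "pos_def (sym_shift (w a - 2) 1 a \<gamma>)" for a using \<gamma> by (auto simp: pd_states_def w_def)
  then have w: "2 - 2 * Re (\<gamma> a) \<le> w a" for a using cond[of "w a - 2" 1 a] by simp
  have norm_diff: "(norm (1 - \<gamma> a))\<^sup>2 = 2 - 2 * Re (\<gamma> a)" for a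
  proof -
    have "(norm (1 - \<gamma> a))\<^sup>2 = 1 - 2 * Re (\<gamma> a) + ((Re (\<gamma> a))\<^sup>2 + (Im (\<gamma> a))\<^sup>2)"
      unfolding cmod_power2 by (simp add: power2_eq_square algebra_simps)
    also have "(Re (\<gamma> a))\<^sup>2 + (Im (\<gamma> a))\<^sup>2 = 1" using norm1[of a] by (simp flip: cmod_power2)
    finally show ?thesis by simp
  qed
  have "continuous_on UNIV (\<lambda>p :: 'a \<times> 'a. (k (- snd p) - k (- snd p + fst p)) * (k (- snd p) - k (- snd p + fst p)))"
    by (intro continuous_intros continuous_on_compose2[OF k]) auto
  from continuous_integral[OF this] have wc: "continuous_on UNIV w"
    unfolding w_def sqn_def ip_def by (simp add: continuous_intros)
  have w0: "w 0 = 0" by (simp add: w_def sqn_def ip_def)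
  have cont: "continuous_on UNIV \<gamma>"
  proof -
    have "\<gamma> \<midarrow>x\<rightarrow> \<gamma> x" for x
    proof -
      have "((\<lambda>y. sqrt (w (y - x))) \<longlongrightarrow> sqrt (w (x - x))) (at x)"
        using continuous_shift(2)[OF wc, of x] unfolding continuous_on_def
        by (intro tendsto_intros) blast
      then have lim0: "((\<lambda>y. sqrt (w (y - x))) \<longlongrightarrow> 0) (at x)" by (simp add: w0)
      have "norm (\<gamma> y - \<gamma> x) \<le> sqrt (w (y - x))" for y
      proof -
        have "\<gamma> y = \<gamma> x * \<gamma> (y - x)" using mult[of x "y - x"] by simp
        then have "\<gamma> y - \<gamma> x = - (\<gamma> x * (1 - \<gamma> (y - x)))" by (simp add: algebra_simps)
        then have "norm (\<gamma> y - \<gamma> x) = norm (1 - \<gamma> (y - x))" by (simp add: norm_mult norm1)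
        also have "\<dots> \<le> sqrt (w (y - x))" using w[of "y - x"] norm_diff by (intro real_le_rsqrt) simp
        finally show ?thesis .
      qed
      then have "((\<lambda>y. \<gamma> y - \<gamma> x) \<longlongrightarrow> 0) (at x)" by (intro Lim_null_comparison[OF _ lim0]) auto
      then show ?thesis by (simp add: LIM_zero_iff)
    qed
    then show ?thesis by (simp add: continuous_on_def)
  qed
  have "pos_def (sym_shift (2 * B - 1) (- B) c \<gamma>)" using \<gamma> by (auto simp: pd_states_def)
  \<comment> \<open>If \<open>\<gamma> c\<close> were 1, the condition would read
    \<open>0 \<le> 2 * B - 1 - 2 * B\<close>.\<close>
  then have "\<gamma> c \<noteq> 1" using cond[of "2 * B - 1" "- B" c] by auto
  moreover have "chr (Character \<gamma>) = \<gamma>" by (rule Character_inverse) (use cont mult norm1 in auto)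
  ultimately show thesis using that by metis
qed

lemma characters_separate_points:
  assumes "x \<noteq> (y :: 'a)"
  obtains \<gamma> where "chr \<gamma> x \<noteq> chr \<gamma> y"
proof -
  obtain \<gamma> where "chr \<gamma> (x - y) \<noteq> 1" using character_separates[of "x - y"] assms by auto
  then have "chr \<gamma> x \<noteq> chr \<gamma> y" by (auto simp: chr_diff)
  then show thesis using that by blast
qed

lemma trig_approx:
  fixes u :: "'a \<Rightarrow> real"
  assumes u: "continuous_on UNIV u" and e: "e > 0"
  obtains p where "trig p" "\<And>x. norm (of_real (u x) - p x) < e"
proof -
  have "\<exists>g. trig (\<lambda>x. of_real (g x)) \<and> (\<forall>x\<in>UNIV. \<bar>u x - g x\<bar> < e)"
  proof (rule Stone_Weierstrass_HOL[where P = "\<lambda>g. trig (\<lambda>x. of_real (g x))", OF compact_UNIV])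
    show "continuous_on UNIV f" if "trig (\<lambda>x. complex_of_real (f x))" for f :: "'a \<Rightarrow> real"
      using continuous_on_Re[OF trig_continuous[OF that]] by simp
    fix x y :: 'a assume "x \<in> UNIV \<and> y \<in> UNIV \<and> x \<noteq> y"
    then obtain \<gamma> where "chr \<gamma> x \<noteq> chr \<gamma> y" using characters_separate_points by blast
    then consider "Re (chr \<gamma> x) \<noteq> Re (chr \<gamma> y)" | "Im (chr \<gamma> x) \<noteq> Im (chr \<gamma> y)" using complex_eqI by blast
    then show "\<exists>f. trig (\<lambda>x. complex_of_real (f x)) \<and> f x \<noteq> f y"
    proof cases
      case 1
      have "complex_of_real (Re (chr \<gamma> x)) = 1 / 2 * chr \<gamma> x + 1 / 2 * chr (- \<gamma>) x" for x
        by (simp add: chr_neg complex_eq_iff)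
      then have "trig (\<lambda>x. complex_of_real (Re (chr \<gamma> x)))"
        by (simp only:) (intro trig_add trig_cmult_chr)
      then show ?thesis using 1 by (intro exI[of _ "\<lambda>x. Re (chr \<gamma> x)"] conjI)
    next
      case 2
      have "complex_of_real (Im (chr \<gamma> x)) = (- \<i> / 2) * chr \<gamma> x + (\<i> / 2) * chr (- \<gamma>) x" for x
        by (simp add: chr_neg complex_eq_iff)
      then have "trig (\<lambda>x. complex_of_real (Im (chr \<gamma> x)))"
        by (simp only:) (intro trig_add trig_cmult_chr)
      then show ?thesis using 2 by (intro exI[of _ "\<lambda>x. Im (chr \<gamma> x)"] conjI)
    qed
  qed (use u e in \<open>auto intro: trig_const trig_add trig_mult\<close>)
  then obtain g where g: "trig (\<lambda>x. complex_of_real (g x))" "\<And>x. \<bar>u x - g x\<bar> < e" by auto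
  have "norm (complex_of_real (u x) - complex_of_real (g x)) < e" for x
    using g(2)[of x] by (metis norm_of_real of_real_diff)
  then show thesis using that g(1) by blast
qed

lemma chr_add_norm: "(norm (1 + z))\<^sup>2 / 4 \<le> 1" "z \<noteq> 1 \<Longrightarrow> (norm (1 + z))\<^sup>2 / 4 < 1" if "norm z = 1" for z :: complex
proof -
  have eq: "(norm (1 + z))\<^sup>2 = 2 + 2 * Re z"
  proof -
    have "(norm (1 + z))\<^sup>2 = 1 + 2 * Re z + ((Re z)\<^sup>2 + (Im z)\<^sup>2)"
      unfolding cmod_power2 by (simp add: power2_eq_square algebra_simps)
    also have "(Re z)\<^sup>2 + (Im z)\<^sup>2 = 1" using that by (simp flip: cmod_power2)
    finally show ?thesis by simp
  qed
  have le: "Re z \<le> 1" using complex_Re_le_cmod[of z] that by simp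
  then show "(norm (1 + z))\<^sup>2 / 4 \<le> 1" by (simp add: eq)
  show "(norm (1 + z))\<^sup>2 / 4 < 1" if "z \<noteq> 1"
  proof -
    have "Re z \<noteq> 1"
    proof
      assume "Re z = 1"
      then have "Im z = 0" using cmod_power2[of z] \<open>norm z = 1\<close> by simp
      then show False using \<open>Re z = 1\<close> \<open>z \<noteq> 1\<close> by (simp add: complex_eq_iff)
    qed
    then show ?thesis using le by (simp add: eq)
  qed
qed

text \<open>Otherwise finitely many characters of a point never agree with \<open>\<phi>\<close>, and a Riesz product
  twisted by \<open>\<phi>\<close> would have exponentially smaller integral than the untwisted one, although
  twisting preserves the integral.\<close>

theorem character_duality:
  fixes \<phi> :: "'a character \<Rightarrow> complex"
  assumes hom: "\<And>\<gamma> \<delta>. \<phi> (\<gamma> + \<delta>) = \<phi> \<gamma> * \<phi> \<delta>" and norm1: "\<And>\<gamma>. norm (\<phi> \<gamma>) = 1"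
  shows "\<exists>x. \<forall>\<gamma>. chr \<gamma> x = \<phi> \<gamma>"
proof (rule ccontr)
  assume contr: "\<not> ?thesis"
  have "\<exists>F. finite F \<and> UNIV \<inter> (\<Inter>\<gamma>\<in>F. {x. chr \<gamma> x = \<phi> \<gamma>}) = {}"
  proof (rule ccontr)
    assume none: "\<not> ?thesis"
    have "UNIV \<inter> (\<Inter>\<gamma>\<in>UNIV. {x. chr \<gamma> x = \<phi> \<gamma>}) \<noteq> {}"
    proof (rule compact_imp_fip_image[OF compact_UNIV])
      show "closed {x. chr \<gamma> x = \<phi> \<gamma>}" for \<gamma>
        by (intro closed_Collect_eq continuous_chr continuous_on_const)
      fix F :: "'a character set" assume "finite F"
      then show "UNIV \<inter> (\<Inter>\<gamma>\<in>F. {x. chr \<gamma> x = \<phi> \<gamma>}) \<noteq> {}" using none by blast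
    qed
    then obtain x where "x \<in> (\<Inter>\<gamma>\<in>UNIV. {x. chr \<gamma> x = \<phi> \<gamma>})" by blast
    then have "\<forall>\<gamma>. chr \<gamma> x = \<phi> \<gamma>" by simp
    then show False using contr by blast
  qed
  then obtain F where F: "finite F" "UNIV \<inter> (\<Inter>\<gamma>\<in>F. {x. chr \<gamma> x = \<phi> \<gamma>}) = {}" by (elim exE conjE)
  have F_sep: "\<exists>\<gamma>\<in>F. chr \<gamma> x \<noteq> \<phi> \<gamma>" for x
  proof -
    have "x \<notin> UNIV \<inter> (\<Inter>\<gamma>\<in>F. {x. chr \<gamma> x = \<phi> \<gamma>})" unfolding F(2) by simp
    then show ?thesis by simp
  qed
  have \<phi>\<phi>: "\<phi> \<gamma> * cnj (\<phi> \<gamma>) = 1" for \<gamma> using norm1[of \<gamma>] by (metis complex_norm_square of_real_1 power_one)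
  have \<phi>nz: "\<phi> \<gamma> \<noteq> 0" for \<gamma> using norm1[of \<gamma>] by auto
  have \<phi>0: "\<phi> 0 = 1" using hom[of 0 0] \<phi>nz[of 0] by simp
  have \<phi>neg: "\<phi> (- \<gamma>) = cnj (\<phi> \<gamma>)" for \<gamma>
  proof -
    have "\<phi> \<gamma> * \<phi> (- \<gamma>) = \<phi> \<gamma> * cnj (\<phi> \<gamma>)" using hom[of \<gamma> "- \<gamma>"] \<phi>\<phi> \<phi>0 by simp
    then show ?thesis using \<phi>nz by simp
  qed
  define \<theta> where "\<theta> \<gamma> = cnj (\<phi> \<gamma>)" for \<gamma>
  \<comment> \<open>For weights of modulus 1 each factor is at most 1, with equality only where
    weight times character is 1. With trivial weights the product is 1 at the point 0; with
    \<open>\<theta>\<close>, the conjugate of \<open>\<phi>\<close>, it would be 1 only where all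
    characters in \<open>F\<close> agree with \<open>\<phi>\<close>, that is nowhere.\<close>
  define g where "g \<phi> x = (\<Prod>\<gamma>\<in>F. (norm (1 + \<phi> \<gamma> * chr \<gamma> x))\<^sup>2 / 4)" for \<phi> x
  have g_eq: "of_real (g \<theta> x) = (\<Prod>\<gamma>\<in>F. (1 / 4) * ((1 + \<theta> \<gamma> * chr \<gamma> x) * (1 + \<theta> (- \<gamma>) * chr (- \<gamma>) x)))"
    if "\<And>\<gamma>. \<theta> (- \<gamma>) = cnj (\<theta> \<gamma>)" for \<theta> x
    unfolding g_def of_real_prod
  proof (intro prod.cong refl)
    fix \<gamma>
    have "complex_of_real ((norm z)\<^sup>2 / 4) = 1 / 4 * (z * cnj z)" for z
      by (simp flip: complex_norm_square)
    then show "complex_of_real ((norm (1 + \<theta> \<gamma> * chr \<gamma> x))\<^sup>2 / 4) =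
        1 / 4 * ((1 + \<theta> \<gamma> * chr \<gamma> x) * (1 + \<theta> (- \<gamma>) * chr (- \<gamma>) x))"
      by (simp add: that chr_neg)
  qed
  have cg: "continuous_on UNIV (g \<theta>)" for \<theta>
    unfolding g_def by (intro continuous_intros continuous_chr ballI) simp
  have g_nonneg: "0 \<le> g \<theta> x" for \<theta> x unfolding g_def by (intro prod_nonneg) auto
  have tw: "twisted \<theta> (\<lambda>x. of_real (g (\<lambda>_. 1) x) ^ N) (\<lambda>x. of_real (g \<theta> x) ^ N)" for N
  proof -
    have \<theta>hom: "\<theta> (\<gamma> + \<delta>) = \<theta> \<gamma> * \<theta> \<delta>" and \<theta>0: "\<theta> 0 = 1" for \<gamma> \<delta> by (simp_all add: \<theta>_def hom \<phi>0)
    have "twisted \<theta> (\<lambda>x. \<Prod>\<gamma>\<in>F. (1 / 4) * ((1 + 1 * chr \<gamma> x) * (1 + 1 * chr (- \<gamma>) x)))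
       (\<lambda>x. \<Prod>\<gamma>\<in>F. (1 / 4) * ((1 + \<theta> \<gamma> * chr \<gamma> x) * (1 + \<theta> (- \<gamma>) * chr (- \<gamma>) x)))"
      unfolding mult_1
      by (intro twisted_prod twisted_mult twisted.add twisted_chr twisted_const \<theta>hom \<theta>0)
    then have "twisted \<theta> (\<lambda>x. of_real (g (\<lambda>_. 1) x)) (\<lambda>x. of_real (g \<theta> x))"
      using g_eq[of "\<lambda>_. 1"] g_eq[of \<theta>] by (simp add: \<theta>_def \<phi>neg)
    then have "twisted \<theta> (\<lambda>x. \<Prod>i<N. of_real (g (\<lambda>_. 1) x)) (\<lambda>x. \<Prod>i<N. of_real (g \<theta> x))"
      by (intro twisted_prod \<theta>hom \<theta>0)
    then show ?thesis by simp
  qed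
  have int_eq: "(\<integral>x. g (\<lambda>_. 1) x ^ N \<partial>m) = (\<integral>x. g \<theta> x ^ N \<partial>m)" for N
  proof -
    have "(\<integral>x. complex_of_real (g (\<lambda>_. 1) x ^ N) \<partial>m) = (\<integral>x. complex_of_real (g \<theta> x ^ N) \<partial>m)"
      using integral_twisted[OF tw[of N]] by (simp add: \<theta>_def \<phi>0)
    then show ?thesis by (simp only: integral_complex_of_real of_real_eq_iff)
  qed
  obtain z where z: "\<And>x. g \<theta> x \<le> g \<theta> z"
    using continuous_attains_sup[OF compact_UNIV _ cg[of \<theta>]] by auto
  define \<rho> where "\<rho> = g \<theta> z"
  have "\<rho> < 1"
  proof -
    have n1: "norm (\<theta> \<gamma> * chr \<gamma> z) = 1" for \<gamma> by (simp add: \<theta>_def norm_mult norm1)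
    obtain \<delta> where \<delta>: "\<delta> \<in> F" "chr \<delta> z \<noteq> \<phi> \<delta>" using F_sep by blast
    have "\<theta> \<delta> * chr \<delta> z \<noteq> 1"
    proof
      assume "\<theta> \<delta> * chr \<delta> z = 1"
      then have "\<phi> \<delta> * (cnj (\<phi> \<delta>) * chr \<delta> z) = \<phi> \<delta>" by (simp add: \<theta>_def)
      then show False using \<delta>(2) \<phi>\<phi>[of \<delta>] by (simp flip: mult.assoc)
    qed
    then have lt: "(norm (1 + \<theta> \<delta> * chr \<delta> z))\<^sup>2 / 4 < 1" by (rule chr_add_norm(2)[OF n1])
    have "\<rho> = (norm (1 + \<theta> \<delta> * chr \<delta> z))\<^sup>2 / 4 * (\<Prod>\<gamma>\<in>F - {\<delta>}. (norm (1 + \<theta> \<gamma> * chr \<gamma> z))\<^sup>2 / 4)"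
      unfolding \<rho>_def g_def using \<delta>(1) F(1) by (rule prod.remove[rotated])
    also have "\<dots> \<le> (norm (1 + \<theta> \<delta> * chr \<delta> z))\<^sup>2 / 4 * 1"
      by (intro mult_left_mono prod_le_1) (use chr_add_norm(1)[OF n1] in simp_all)
    finally show ?thesis using lt by simp
  qed
  moreover have "0 \<le> \<rho>" by (simp add: \<rho>_def g_nonneg)
  moreover obtain \<eta> where "\<rho> < \<eta>" "\<eta> < 1" using dense[OF \<open>\<rho> < 1\<close>] by blast
  ultimately have \<eta>: "\<rho> < \<eta>" "\<eta> < 1" "0 < \<eta>" by linarith+
  define U where "U = {x. \<eta> < g (\<lambda>_. 1) x}"
  have "g (\<lambda>_. 1) 0 = 1" by (simp add: g_def)
  then have "0 \<in> U" using \<eta> by (simp add: U_def)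
  moreover have oU: "open U" unfolding U_def by (intro open_Collect_less cg continuous_intros)
  ultimately have "emeasure m U > 0" using emeasure_open_pos by blast
  then have mU: "measure m U > 0" by (simp add: emeasure_eq_measure)
  have mU_sets: "U \<in> sets m" using oU by (simp add: sets_m)
  \<comment> \<open>The two \<open>N\<close>-th powers have equal integrals, yet the untwisted one
    is at least \<open>\<eta> ^ N\<close> on \<open>U\<close> and the twisted one at most
    \<open>\<rho> ^ N\<close> everywhere.\<close>
  have "measure m U \<le> (\<rho> / \<eta>) ^ N" for N
  proof -
    have "\<eta> ^ N * measure m U = (\<integral>x. \<eta> ^ N * indicator U x \<partial>m)" using mU_sets by simp
    also have "\<dots> \<le> (\<integral>x. g (\<lambda>_. 1) x ^ N \<partial>m)"
    proof (rule integral_mono)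
      show "integrable m (\<lambda>x. \<eta> ^ N * indicat_real U x)" using mU_sets by (simp add: emeasure_eq_measure)
      show "integrable m (\<lambda>x. g (\<lambda>_. 1) x ^ N)" by (intro integrable_continuous continuous_intros cg)
      show "\<eta> ^ N * indicator U x \<le> g (\<lambda>_. 1) x ^ N" for x
        using \<eta>(3) g_nonneg[of "\<lambda>_. 1" x] by (auto simp: U_def indicator_def intro!: power_mono)
    qed
    also have "\<dots> = (\<integral>x. g \<theta> x ^ N \<partial>m)" by (rule int_eq)
    also have "\<dots> \<le> (\<integral>x. \<rho> ^ N \<partial>m)"
      by (intro integral_mono integrable_continuous continuous_intros cg)
         (auto simp: \<rho>_def intro!: power_mono z g_nonneg)
    finally show ?thesis using \<eta>(3) by (simp add: power_divide field_simps)
  qed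
  moreover have "(\<lambda>N. (\<rho> / \<eta>) ^ N) \<longlonglongrightarrow> 0"
    using \<eta> \<open>0 \<le> \<rho>\<close> by (intro LIMSEQ_power_zero) simp
  ultimately have "measure m U \<le> 0" by (intro LIMSEQ_le_const) auto
  then show False using mU by simp
qed

end

subsection \<open>Rank of the character group\<close>

lemma zmul_real: "zmul k (v :: real) = of_int k * v"
  by (simp add: zmul_def)

lemma fst_zmul: "fst (zmul k p) = zmul k (fst p)" and snd_zmul: "snd (zmul k p) = zmul k (snd p)"
  by (simp_all add: additive_zmul)

text \<open>Zorn's lemma for graphs of partial homomorphisms: since the reals are divisible, a maximal one
  is total.\<close>

lemma real_hom_extension:
  fixes G :: "('g::ab_group_add \<times> real) set"
  assumes G0: "0 \<in> G" and Gdiff: "\<And>p q. p \<in> G \<Longrightarrow> q \<in> G \<Longrightarrow> p - q \<in> G"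
    and single: "\<And>v. (0, v) \<in> G \<Longrightarrow> v = 0"
  obtains h where "\<And>x y. h (x + y) = h x + h y" "\<And>x v. (x, v) \<in> G \<Longrightarrow> h x = v"
proof -
  \<comment> \<open>Subgroups that are graphs of functions: given closure under differences,
    single-valuedness need only be required at 0.\<close>
  define ok where "ok S \<longleftrightarrow> G \<subseteq> S \<and> (\<forall>p\<in>S. \<forall>q\<in>S. p - q \<in> S) \<and> (\<forall>v. (0, v) \<in> S \<longrightarrow> v = 0)" for S
  have "\<exists>M\<in>Collect ok. \<forall>X\<in>Collect ok. M \<subseteq> X \<longrightarrow> X = M"
  proof (rule subset_Zorn_nonempty)
    have "ok G" using Gdiff single by (auto simp: ok_def)
    then show "Collect ok \<noteq> {}" by blast
    fix \<C> assume ne: "\<C> \<noteq> {}" and ch: "subset.chain (Collect ok) \<C>"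
    have ok: "ok S" if "S \<in> \<C>" for S using ch that unfolding subset.chain_def by blast
    have "p - q \<in> \<Union>\<C>" if pq: "p \<in> \<Union>\<C>" "q \<in> \<Union>\<C>" for p q
    proof -
      obtain S S' where S: "S \<in> \<C>" "S' \<in> \<C>" "p \<in> S" "q \<in> S'" using pq by blast
      then have "S \<subseteq> S' \<or> S' \<subseteq> S" using ch unfolding subset_chain_def by blast
      then obtain R where "R \<in> \<C>" "p \<in> R" "q \<in> R" using S by blast
      then show ?thesis using ok[of R] unfolding ok_def by blast
    qed
    moreover have "G \<subseteq> \<Union>\<C>" using ne ok unfolding ok_def by blast
    moreover have "v = 0" if "(0, v) \<in> \<Union>\<C>" for v using that ok unfolding ok_def by blast
    ultimately show "\<Union>\<C> \<in> Collect ok" by (simp add: ok_def)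
  qed
  then obtain S where S: "ok S" and max: "\<And>X. ok X \<Longrightarrow> S \<subseteq> X \<Longrightarrow> X = S" by blast
  have Sdiff: "p - q \<in> S" if "p \<in> S" "q \<in> S" for p q using S that by (simp add: ok_def)
  have S0: "0 \<in> S" using S G0 by (auto simp: ok_def)
  have Sminus: "- p \<in> S" if "p \<in> S" for p using Sdiff[OF S0 that] by simp
  have Sadd: "p + q \<in> S" if "p \<in> S" "q \<in> S" for p q using Sdiff[OF that(1) Sminus[OF that(2)]] by simp
  have Ssum: "(\<Sum>i<n. p) \<in> S" if "p \<in> S" for p and n :: nat
    using that by (induction n) (auto simp: S0 Sadd)
  have Szmul: "zmul k p \<in> S" if "p \<in> S" for k p
    using Ssum[OF that] Sminus by (simp add: zmul_def)
  have uniq: "v = w" if "(x, v) \<in> S" "(x, w) \<in> S" for x v w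
  proof -
    have "(0, v - w) \<in> S" using Sdiff[OF that] by simp
    then have "v - w = 0" using S unfolding ok_def by blast
    then show ?thesis by simp
  qed
  have total: "\<exists>v. (x, v) \<in> S" for x
  proof -
    \<comment> \<open>The value to be assigned to \<open>x\<close>. If a nonzero multiple
      \<open>zmul k x\<close> already has the value \<open>z\<close>, it must be
      \<open>z / k\<close>; otherwise the choice is free and 0 is taken.\<close>
    obtain s where s: "\<And>j y. (zmul j x, y) \<in> S \<Longrightarrow> y = of_int j * s"
    proof (cases "\<exists>k y. k \<noteq> 0 \<and> (zmul k x, y) \<in> S")
      case True
      then obtain k z where k: "k \<noteq> 0" "(zmul k x, z) \<in> S" by blast
      have "y = of_int j * (z / of_int k)" if "(zmul j x, y) \<in> S" for j y
      proof -
        have "zmul k (zmul j x, y) = (zmul (j * k) x, of_int k * y)"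
          by (simp add: prod_eq_iff fst_zmul snd_zmul zmul_real mult.commute flip: zmul_mult)
        moreover have "zmul j (zmul k x, z) = (zmul (j * k) x, of_int j * z)"
          by (simp add: prod_eq_iff fst_zmul snd_zmul zmul_real flip: zmul_mult)
        ultimately have "of_int k * y = of_int j * z"
          using uniq Szmul[OF that, of k] Szmul[OF k(2), of j] by metis
        then show ?thesis using k(1) by (simp add: field_simps)
      qed
      then show thesis by (rule that)
    next
      case False
      have "y = of_int j * 0" if "(zmul j x, y) \<in> S" for j y
      proof -
        have "j = 0" using False that by blast
        then show ?thesis using that S by (simp add: ok_def)
      qed
      then show thesis by (rule that)
    qed
    define X where "X = (\<Union>j. (\<lambda>p. p + (zmul j x, of_int j * s)) ` S)"
    have SX: "S \<subseteq> X"
    proof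
      fix p assume "p \<in> S"
      then have "p + (zmul 0 x, of_int 0 * s) \<in> X" unfolding X_def by blast
      then show "p \<in> X" by (simp flip: zero_prod_def)
    qed
    have "p - q \<in> X" if pq: "p \<in> X" "q \<in> X" for p q
    proof -
      obtain i j p' q' where "p' \<in> S" "q' \<in> S" "p = p' + (zmul i x, of_int i * s)" "q = q' + (zmul j x, of_int j * s)"
        using pq unfolding X_def by blast
      then have "p - q = (p' - q') + (zmul (i - j) x, of_int (i - j) * s)" "p' - q' \<in> S"
        by (auto simp: prod_eq_iff zmul_diff_left algebra_simps Sdiff)
      then show ?thesis unfolding X_def by blast
    qed
    moreover have "v = 0" if v: "(0, v) \<in> X" for v
    proof -
      obtain j p where p: "p \<in> S" "(0, v) = p + (zmul j x, of_int j * s)" using v unfolding X_def by blast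
      then have "p = (zmul (- j) x, v - of_int j * s)"
        by (simp add: prod_eq_iff zmul_minus_left eq_neg_iff_add_eq_0)
      then have "v - of_int j * s = of_int (- j) * s" using s p(1) by blast
      then show ?thesis by simp
    qed
    moreover have "G \<subseteq> X" using S SX by (auto simp: ok_def)
    ultimately have "ok X" by (simp add: ok_def)
    then have "X = S" using max SX by blast
    moreover have "0 + (zmul 1 x, of_int 1 * s) \<in> X" using S0 unfolding X_def by blast
    ultimately show ?thesis by auto
  qed
  then obtain h where h: "\<And>x. (x, h x) \<in> S" by metis
  show thesis
  proof (rule that[of h])
    show "h (x + y) = h x + h y" for x y
      using uniq[OF h[of "x + y"]] Sadd[OF h[of x] h[of y]] by simp
    show "h x = v" if "(x, v) \<in> G" for x v
      using uniq[OF h[of x]] that S by (auto simp: ok_def)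
  qed
qed

text \<open>The coordinate function on the span of \<open>e\<close>, given by its graph and extended
  to the whole group; real values are used because an extension needs a divisible target.\<close>

lemma zindep_coordinate_hom:
  fixes e :: "nat \<Rightarrow> 'g::ab_group_add"
  assumes ind: "zindep n e" and i: "i < n"
  obtains h :: "'g \<Rightarrow> real" where "\<And>x y. h (x + y) = h x + h y" "\<And>j. j < n \<Longrightarrow> h (e j) = (if j = i then 1 else 0)"
proof -
  define G where "G = range (\<lambda>c. (\<Sum>j<n. zmul (c j) (e j), real_of_int (c i)))"
  have GI: "(\<Sum>j<n. zmul (c j) (e j), real_of_int (c i)) \<in> G" for c by (simp add: G_def)
  obtain h where h: "\<And>x y. h (x + y) = h x + h y" "\<And>x v. (x, v) \<in> G \<Longrightarrow> h x = v"
  proof (rule real_hom_extension[of G])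
    show "0 \<in> G" using GI[of "\<lambda>_. 0"] by (simp add: zero_prod_def)
    show "p - q \<in> G" if "p \<in> G" "q \<in> G" for p q
    proof -
      obtain c d where "p = (\<Sum>j<n. zmul (c j) (e j), real_of_int (c i))" "q = (\<Sum>j<n. zmul (d j) (e j), real_of_int (d i))"
        using \<open>p \<in> G\<close> \<open>q \<in> G\<close> unfolding G_def by blast
      then show ?thesis using GI[of "\<lambda>j. c j - d j"] by (simp add: zmul_diff_left sum_subtractf)
    qed
    show "v = 0" if v: "(0, v) \<in> G" for v
    proof -
      obtain c where "(\<Sum>j<n. zmul (c j) (e j)) = 0" "v = real_of_int (c i)"
        using v unfolding G_def by auto
      then show ?thesis using ind i by (simp add: zindep_def)
    qed
  qed blast
  show thesis
  proof (rule that[of h])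
    fix j assume j: "j < n"
    have "(\<Sum>l<n. zmul (if l = j then 1 else 0) (e l)) = (\<Sum>l<n. if l = j then e l else 0)"
      by (intro sum.cong) auto
    also have "\<dots> = e j" using j by simp
    finally show "h (e j) = (if j = i then 1 else 0)"
      using h(2)[OF GI[of "\<lambda>l. if l = j then 1 else 0"]] by auto
  qed (rule h(1))
qed

text \<open>Coordinate homomorphisms of \<open>n + 1\<close> independent characters yield one-parameter
  subgroups, hence a cube of dimension \<open>n + 1\<close> inside the group.\<close>

lemma (in compact_haar) character_rank_le_covering_dim:
  assumes dim: "covering_dim_le (euclidean :: 'a topology) n"
  shows "\<not> zindep (Suc n) (e :: nat \<Rightarrow> 'a character)"
proof
  assume ind: "zindep (Suc n) e"
  have "\<exists>h :: 'a character \<Rightarrow> real. (\<forall>\<gamma> \<delta>. h (\<gamma> + \<delta>) = h \<gamma> + h \<delta>) \<and>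
      (\<forall>j<Suc n. h (e j) = (if j = i then 1 else 0))" if "i < Suc n" for i
    by (rule zindep_coordinate_hom[OF ind that]) blast
  then obtain h :: "nat \<Rightarrow> 'a character \<Rightarrow> real"
    where h: "\<And>i \<gamma> \<delta>. i < Suc n \<Longrightarrow> h i (\<gamma> + \<delta>) = h i \<gamma> + h i \<delta>"
      "\<And>i j. i < Suc n \<Longrightarrow> j < Suc n \<Longrightarrow> h i (e j) = (if j = i then 1 else 0)"
    by metis
  \<comment> \<open>With the factor \<open>pi\<close> the character \<open>e j\<close> has the value
    \<open>cis (pi * t j)\<close> at the point with parameter \<open>t\<close>, hence 1 and -1 on
    opposite faces of the cube.\<close>
  define \<phi> where "\<phi> t \<gamma> = cis (pi * (\<Sum>i<Suc n. h i \<gamma> * t i))" for t :: "nat \<Rightarrow> real" and \<gamma>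
  have "\<phi> t (\<gamma> + \<delta>) = \<phi> t \<gamma> * \<phi> t \<delta>" for t \<gamma> \<delta>
    unfolding \<phi>_def cis_mult distrib_left[symmetric] sum.distrib[symmetric]
    by (intro arg_cong[where f = "\<lambda>u. cis (pi * u)"] sum.cong) (auto simp: h(1) distrib_right)
  then have "\<exists>x. \<forall>\<gamma>. chr \<gamma> x = \<phi> t \<gamma>" for t by (intro character_duality) (auto simp: \<phi>_def)
  then obtain g where g: "\<And>t \<gamma>. chr \<gamma> (g t) = \<phi> t \<gamma>" by metis
  \<comment> \<open>Continuity of \<open>g\<close>, which comes from a choice, is recovered through
    the embedding of the compact group into functions on its characters: the inverse of this
    embedding is continuous.\<close>
  define ev :: "'a \<Rightarrow> 'a character \<Rightarrow> complex" where "ev x = (\<lambda>\<gamma>. chr \<gamma> x)" for x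
  have "inj ev"
  proof (rule injI)
    fix x y assume "ev x = ev y"
    then show "x = y" using characters_separate_points[of x y] unfolding ev_def by metis
  qed
  moreover have "continuous_on UNIV ev"
    unfolding ev_def by (intro continuous_on_coordinatewise_then_product continuous_chr)
  ultimately have "continuous_on (range ev) (inv ev)"
    by (intro continuous_on_inv[OF _ compact_UNIV]) auto
  moreover have "continuous_on UNIV \<phi>"
    unfolding \<phi>_def by (intro continuous_on_coordinatewise_then_product continuous_intros continuous_on_product_coordinates)
  moreover have ev_g: "\<phi> t = ev (g t)" for t by (simp add: ev_def g fun_eq_iff)
  then have "range \<phi> \<subseteq> range ev" by blast
  ultimately have "continuous_on UNIV (\<lambda>t. inv ev (\<phi> t))"
    by (rule continuous_on_compose2)
  moreover have "inv ev (\<phi> t) = g t" for t unfolding ev_g using \<open>inj ev\<close> by simp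
  ultimately have "continuous_on UNIV g" by simp
  have \<phi>e: "\<phi> t (e j) = cis (pi * t j)" if "j \<le> n" for t j
  proof -
    have "(\<Sum>i<Suc n. h i (e j) * t i) = (\<Sum>i<Suc n. if i = j then t i else 0)"
      using that by (intro sum.cong) (auto simp: h(2))
    also have "\<dots> = t j" using that by (subst sum.delta) auto
    finally show ?thesis by (simp add: \<phi>_def)
  qed
  show False
  proof (rule covering_dim_opposite_faces[OF dim, of g "\<lambda>i. {x. chr (e i) x = 1}" "\<lambda>i. {x. chr (e i) x = - 1}"])
    show "continuous_on {t. \<forall>i. t i \<in> {0..1}} g"
      using \<open>continuous_on UNIV g\<close> continuous_on_subset by blast
  qed (auto simp: g \<phi>e intro!: closed_Collect_eq continuous_chr continuous_on_const)
qed

subsection \<open>Epimorphisms\<close>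

lemma epimorphism_funpow: "epimorphism T \<Longrightarrow> epimorphism (T ^^ n)"
proof (induction n)
  case (Suc n)
  then have T: "epimorphism T" "epimorphism (T ^^ n)" by auto
  have "continuous_on UNIV (T ^^ Suc n)"
    using T unfolding epimorphism_def funpow.simps comp_def
    by (auto intro: continuous_on_compose2[of UNIV T])
  moreover have "surj (T ^^ Suc n)" using T unfolding epimorphism_def funpow.simps by (metis comp_surj)
  moreover have "(T ^^ Suc n) (x + y) = (T ^^ Suc n) x + (T ^^ Suc n) y" for x y
    using T by (simp add: epimorphism_def)
  ultimately show ?case unfolding epimorphism_def by blast
qed (simp add: epimorphism_def)

definition dual :: "('a \<Rightarrow> 'a::topological_ab_group_add) \<Rightarrow> 'a character \<Rightarrow> 'a character" where
  "dual T \<gamma> = Character (\<lambda>x. chr \<gamma> (T x))"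

lemma chr_dual: "epimorphism T \<Longrightarrow> chr (dual T \<gamma>) x = chr \<gamma> (T x)"
  unfolding dual_def epimorphism_def
  by (subst Character_inverse) (auto simp: chr_add intro!: continuous_on_compose2[OF continuous_chr])

lemma chr_dual_funpow:
  assumes "epimorphism T"
  shows "chr ((dual T ^^ n) \<gamma>) x = chr \<gamma> ((T ^^ n) x)"
proof (induction n arbitrary: x)
  case (Suc n)
  have "chr ((dual T ^^ Suc n) \<gamma>) x = chr ((dual T ^^ n) \<gamma>) (T x)" by (simp add: chr_dual[OF assms])
  also have "\<dots> = chr \<gamma> ((T ^^ n) (T x))" by (rule Suc.IH)
  finally show ?case by (simp add: funpow_swap1)
qed simp

lemma dual_add: "epimorphism T \<Longrightarrow> dual T (\<gamma> + \<delta>) = dual T \<gamma> + dual T \<delta>"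
  by (rule character_eqI) (simp add: chr_dual chr_plus)

lemma dual_inj:
  assumes "epimorphism T"
  shows "inj (dual T)"
proof (rule injI, rule character_eqI)
  fix \<gamma> \<delta> x assume eq: "dual T \<gamma> = dual T \<delta>"
  obtain y where "x = T y" using assms unfolding epimorphism_def surj_def by blast
  then show "chr \<gamma> x = chr \<delta> x" using chr_dual[OF assms, of _ y] eq by metis
qed

lemma dual_eq_0_iff: "epimorphism T \<Longrightarrow> dual T \<gamma> = 0 \<longleftrightarrow> \<gamma> = 0"
  using inj_eq[OF dual_inj, of T \<gamma> 0] additive_0[of "dual T"] by (simp add: dual_add)

section \<open>Invariance of Haar measure under epimorphisms\<close>

context compact_haar
begin

lemma epimorphism_continuous_compose:
  fixes f :: "'a \<Rightarrow> 'b::topological_space"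
  shows "epimorphism T \<Longrightarrow> continuous_on UNIV f \<Longrightarrow> continuous_on UNIV (\<lambda>x. f (T x))"
  unfolding epimorphism_def by (auto intro: continuous_on_compose2)

text \<open>Surjectivity makes \<open>dual T \<gamma>\<close> trivial only when
  \<open>\<gamma>\<close> is, so both integrals of a character are 1 or both are 0. Invariance of
  \<open>m\<close> grows from this instead of from uniqueness of Haar measure.\<close>

lemma integral_trig_epimorphism:
  assumes T: "epimorphism T" and p: "trig p"
  shows "(\<integral>x. p (T x) \<partial>m) = (\<integral>x. p x \<partial>m)"
proof -
  have "continuous_on UNIV p \<and> (\<integral>x. p (T x) \<partial>m) = (\<integral>x. p x \<partial>m)"
    using p
  proof (induction rule: trig_induct)
    case (base c \<gamma>)
    have "(\<integral>x. chr (dual T \<gamma>) x \<partial>m) = (\<integral>x. chr \<gamma> x \<partial>m)"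
    proof (cases "\<gamma> = 0")
      case False
      then have "dual T \<gamma> \<noteq> 0" by (simp add: dual_eq_0_iff[OF T])
      then show ?thesis using False by (simp add: integral_chr)
    next
      case True
      then have "dual T \<gamma> = 0" by (simp add: dual_eq_0_iff[OF T])
      then show ?thesis using True by simp
    qed
    then show ?case by (auto simp: chr_dual[OF T] intro!: continuous_intros continuous_chr)
  next
    case (add p q)
    then show ?case using epimorphism_continuous_compose[OF T, of p] epimorphism_continuous_compose[OF T, of q]
      by (auto simp: integrable_continuous intro!: continuous_intros)
  qed
  then show ?thesis by blast
qed

lemma integral_norm_le:
  fixes f :: "'a \<Rightarrow> complex"
  assumes "continuous_on UNIV f" "\<And>x. norm (f x) \<le> e"
  shows "norm (\<integral>x. f x \<partial>m) \<le> e"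
proof -
  have "norm (\<integral>x. f x \<partial>m) \<le> (\<integral>x. norm (f x) \<partial>m)" by (rule integral_norm_bound)
  also have "\<dots> \<le> (\<integral>x. e \<partial>m)" using assms by (intro integral_mono integrable_continuous continuous_intros)
  finally show ?thesis by simp
qed

lemma integral_continuous_epimorphism:
  fixes u :: "'a \<Rightarrow> real"
  assumes T: "epimorphism T" and u: "continuous_on UNIV u"
  shows "(\<integral>x. u (T x) \<partial>m) = (\<integral>x. u x \<partial>m)"
proof -
  have uT: "continuous_on UNIV (\<lambda>x. u (T x))" by (rule epimorphism_continuous_compose[OF T u])
  have "norm ((\<integral>x. complex_of_real (u (T x)) \<partial>m) - (\<integral>x. complex_of_real (u x) \<partial>m)) \<le> 0 + e" if e: "e > 0" for e
  proof -
    obtain p where p: "trig p" "\<And>x. norm (complex_of_real (u x) - p x) < e / 2"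
      by (rule trig_approx[OF u, of "e / 2"]) (use e in auto)
    note pc = trig_continuous[OF p(1)]
    note pT = epimorphism_continuous_compose[OF T pc]
    have "norm (\<integral>x. complex_of_real (u x) - p x \<partial>m) \<le> e / 2"
      using p(2) by (intro integral_norm_le continuous_intros u pc less_imp_le)
    moreover have "norm (\<integral>x. complex_of_real (u (T x)) - p (T x) \<partial>m) \<le> e / 2"
      using p(2) by (intro integral_norm_le continuous_intros uT pT less_imp_le)
    moreover have "(\<integral>x. complex_of_real (u x) - p x \<partial>m) = (\<integral>x. complex_of_real (u x) \<partial>m) - (\<integral>x. p x \<partial>m)"
      using u pc by (intro Bochner_Integration.integral_diff integrable_continuous continuous_intros)
    moreover have "(\<integral>x. complex_of_real (u (T x)) - p (T x) \<partial>m) = (\<integral>x. complex_of_real (u (T x)) \<partial>m) - (\<integral>x. p x \<partial>m)"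
      using uT pT integral_trig_epimorphism[OF T p(1)]
      by (subst Bochner_Integration.integral_diff) (auto intro!: integrable_continuous continuous_intros)
    ultimately show ?thesis
      using norm_triangle_ineq4[of "(\<integral>x. complex_of_real (u (T x)) \<partial>m) - (\<integral>x. p x \<partial>m)"
        "(\<integral>x. complex_of_real (u x) \<partial>m) - (\<integral>x. p x \<partial>m)"] by simp
  qed
  then have "norm ((\<integral>x. complex_of_real (u (T x)) \<partial>m) - (\<integral>x. complex_of_real (u x) \<partial>m)) \<le> 0"
    by (rule field_le_epsilon)
  then show ?thesis by simp
qed

lemma inner_regular:
  assumes "A \<in> sets borel" "e > 0"
  obtains K where "compact K" "K \<subseteq> A" "measure m A < measure m K + e"
proof (cases "measure m A < e")
  case True
  then show thesis using that[of "{}"] by simp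
next
  case False
  then have "ennreal (measure m A - e) < ennreal (measure m A)" using assms(2) by (simp add: ennreal_less_iff)
  also have "\<dots> = (SUP K\<in>{K. K \<subseteq> A \<and> compact K}. emeasure m K)"
    using haar assms(1) unfolding normalized_haar_def by (metis emeasure_eq_measure)
  finally obtain K where K: "K \<subseteq> A" "compact K" "ennreal (measure m A - e) < emeasure m K"
    unfolding less_SUP_iff by auto
  then have "measure m A - e < measure m K" using False by (simp add: emeasure_eq_measure ennreal_less_iff)
  then show thesis using that K by force
qed

lemma integrable_indicator: "A \<in> sets m \<Longrightarrow> integrable m (indicat_real A)"
  by (simp add: emeasure_eq_measure)

lemma compact_in_sets: "compact K \<Longrightarrow> K \<in> sets m"
  by (simp add: sets_m compact_imp_closed borel_closed)

lemma measure_Compl_UNIV: "A \<in> sets m \<Longrightarrow> measure m (- A) = 1 - measure m A"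
  using finite_measure_compl[of A] by (simp add: Compl_eq_Diff_UNIV)

lemma epimorphism_measurable:
  assumes "epimorphism T"
  shows "T \<in> measurable m m"
  using measurable_continuous[of T] assms
  by (simp add: epimorphism_def measurable_cong_sets[OF refl sets_m])

lemma epimorphism_vimage_sets:
  assumes "epimorphism T" "A \<in> sets m"
  shows "T -` A \<in> sets m"
  using measurable_sets[OF epimorphism_measurable[OF assms(1)] assms(2)] by simp

text \<open>Inner regularity of the complement acts as outer regularity of \<open>K\<close>: a
  continuous function that is 1 on \<open>K\<close> and 0 on a compact set filling most of the
  complement has integral close to \<open>measure m K\<close>, and \<open>T\<close> preserves that
  integral.\<close>

lemma measure_vimage_compact_le:
  assumes T: "epimorphism T" and K: "compact K"
  shows "measure m (T -` K) \<le> measure m K"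
proof (rule field_le_epsilon)
  fix e :: real assume e: "e > 0"
  have Km: "K \<in> sets m" by (rule compact_in_sets[OF K])
  then have "- K \<in> sets borel" by (simp add: sets_m)
  then obtain C where C: "compact C" "C \<subseteq> - K" "measure m (- K) < measure m C + e"
    by (rule inner_regular[OF _ e])
  have Cm: "C \<in> sets m" by (rule compact_in_sets[OF C(1)])
  have sep: "closed C" "closed K" "C \<inter> K = {}" using C K by (auto intro: compact_imp_closed)
  obtain u :: "'a \<Rightarrow> real" where u: "continuous_on UNIV u" "\<And>x. 0 \<le> u x" "\<And>x. u x \<le> 1"
    "\<And>x. x \<in> C \<Longrightarrow> u x = 0" "\<And>x. x \<in> K \<Longrightarrow> u x = 1" by (rule urysohn[OF sep]) blast
  have uT: "continuous_on UNIV (\<lambda>x. u (T x))" by (rule epimorphism_continuous_compose[OF T u(1)])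
  note TK = epimorphism_vimage_sets[OF T Km]
  have "measure m (T -` K) = (\<integral>x. indicator (T -` K) x \<partial>m)" using TK by simp
  also have "\<dots> \<le> (\<integral>x. u (T x) \<partial>m)"
    using u(2,5) by (intro integral_mono[OF integrable_indicator[OF TK] integrable_continuous[OF uT]])
      (auto simp: indicator_def)
  also have "\<dots> = (\<integral>x. u x \<partial>m)" by (rule integral_continuous_epimorphism[OF T u(1)])
  also have "\<dots> \<le> (\<integral>x. indicator (- C) x \<partial>m)"
    using u(3,4) Cm by (intro integral_mono[OF integrable_continuous[OF u(1)] integrable_indicator])
      (auto simp: indicator_def sets_m)
  also have "\<dots> = measure m (- C)" using Cm by (simp add: sets_m)
  finally show "measure m (T -` K) \<le> measure m K + e"
    using C(3) by (simp add: measure_Compl_UNIV[OF Km] measure_Compl_UNIV[OF Cm])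
qed

text \<open>Inner regularity reduces this to compact subsets of the preimage, whose images under
  \<open>T\<close> are compact subsets of \<open>A\<close>.\<close>

lemma measure_vimage_le:
  assumes T: "epimorphism T" and A: "A \<in> sets m"
  shows "measure m (T -` A) \<le> measure m A"
proof (rule field_le_epsilon)
  fix e :: real assume e: "e > 0"
  have "T -` A \<in> sets borel" using epimorphism_vimage_sets[OF T A] by (simp add: sets_m)
  then obtain K where K: "compact K" "K \<subseteq> T -` A" "measure m (T -` A) < measure m K + e"
    by (rule inner_regular[OF _ e])
  have TK: "compact (T ` K)" using T K(1) unfolding epimorphism_def
    by (meson compact_continuous_image continuous_on_subset subset_UNIV)
  have "measure m K \<le> measure m (T -` (T ` K))"
    using epimorphism_vimage_sets[OF T compact_in_sets[OF TK]] by (intro finite_measure_mono) auto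
  also have "\<dots> \<le> measure m (T ` K)" by (rule measure_vimage_compact_le[OF T TK])
  also have "\<dots> \<le> measure m A" using K(2) A by (intro finite_measure_mono) auto
  finally show "measure m (T -` A) \<le> measure m A + e" using K(3) by simp
qed

text \<open>The inequality for a set and the one for its complement together force equality.\<close>

lemma distr_epimorphism:
  assumes T: "epimorphism T"
  shows "distr m m T = m"
proof (rule measure_eqI)
  fix A assume "A \<in> sets (distr m m T)"
  then have A: "A \<in> sets m" by simp
  then have cA: "- A \<in> sets m" by (simp add: sets_m)
  have "1 - measure m (T -` A) \<le> 1 - measure m A"
    using measure_vimage_le[OF T cA] measure_Compl_UNIV[OF A] measure_Compl_UNIV[OF epimorphism_vimage_sets[OF T A]]
    by (simp add: vimage_Compl)
  then have "measure m (T -` A) = measure m A" using measure_vimage_le[OF T A] by simp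
  then show "emeasure (distr m m T) A = emeasure m A"
    using emeasure_distr[OF epimorphism_measurable[OF T] A] by (simp add: emeasure_eq_measure)
qed simp

lemma AE_epimorphism:
  assumes T: "epimorphism T" and P: "AE x in m. P x"
  shows "AE x in m. P (T x)"
proof -
  have "AE x in distr m m T. P x" unfolding distr_epimorphism[OF T] by (rule P)
  then show ?thesis using AE_distrD[OF epimorphism_measurable[OF T]] by blast
qed

lemma integral_epimorphism:
  fixes f :: "'a \<Rightarrow> real"
  assumes T: "epimorphism T" and f: "f \<in> borel_measurable m"
  shows "(\<integral>x. f (T x) \<partial>m) = (\<integral>x. f x \<partial>m)"
  using integral_distr[OF epimorphism_measurable[OF T] f] by (simp add: distr_epimorphism[OF T])

section \<open>Density of trigonometric polynomials in the integrable functions\<close>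

definition trig_limit :: "('a \<Rightarrow> complex) \<Rightarrow> bool" where
  "trig_limit f \<longleftrightarrow> (\<forall>e>0. \<exists>p. trig p \<and> (\<integral>x. norm (f x - p x) \<partial>m) < e)"

lemma trig_limit_add:
  assumes int: "integrable m f" "integrable m g" and "trig_limit f" "trig_limit g"
  shows "trig_limit (\<lambda>x. f x + g x)"
  unfolding trig_limit_def
proof (intro allI impI)
  fix e :: real assume "e > 0"
  then obtain p q where pq: "trig p" "(\<integral>x. norm (f x - p x) \<partial>m) < e / 2" "trig q" "(\<integral>x. norm (g x - q x) \<partial>m) < e / 2"
    using assms(3,4) unfolding trig_limit_def by (metis half_gt_zero)
  have ip: "integrable m p" "integrable m q" using pq by (auto intro: integrable_continuous trig_continuous)
  have "(\<integral>x. norm (f x + g x - (p x + q x)) \<partial>m) \<le> (\<integral>x. norm (f x - p x) + norm (g x - q x) \<partial>m)"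
    using int ip by (intro integral_mono) (auto intro: norm_diff_triangle_ineq)
  also have "\<dots> = (\<integral>x. norm (f x - p x) \<partial>m) + (\<integral>x. norm (g x - q x) \<partial>m)"
    using int ip by (intro Bochner_Integration.integral_add) auto
  finally have "(\<integral>x. norm (f x + g x - (p x + q x)) \<partial>m) < e" using pq by simp
  then show "\<exists>p. trig p \<and> (\<integral>x. norm (f x + g x - p x) \<partial>m) < e"
    using trig_add[OF pq(1,3)] by blast
qed

lemma trig_limit_cmult:
  assumes "trig_limit f"
  shows "trig_limit (\<lambda>x. c * f x)"
  unfolding trig_limit_def
proof (intro allI impI)
  fix e :: real assume "e > 0"
  then have e': "e / (norm c + 1) > 0" by (simp add: add_nonneg_pos)
  then obtain p where p: "trig p" "(\<integral>x. norm (f x - p x) \<partial>m) < e / (norm c + 1)"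
    using assms unfolding trig_limit_def by blast
  have nn: "0 \<le> (\<integral>x. norm (f x - p x) \<partial>m)" by simp
  have "(\<integral>x. norm (c * f x - c * p x) \<partial>m) = norm c * (\<integral>x. norm (f x - p x) \<partial>m)"
    by (simp add: norm_mult flip: right_diff_distrib)
  also have "\<dots> \<le> (norm c + 1) * (\<integral>x. norm (f x - p x) \<partial>m)" using nn by (simp add: distrib_right)
  also have "\<dots> < e"
  proof -
    have "0 < norm c + 1" by (simp add: add_nonneg_pos)
    then show ?thesis using p(2) by (simp only: pos_less_divide_eq mult.commute)
  qed
  finally show "\<exists>p. trig p \<and> (\<integral>x. norm (c * f x - p x) \<partial>m) < e"
    using trig_cmult[OF p(1)] by blast
qed

lemma trig_limit_indicator:
  assumes A: "A \<in> sets m"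
  shows "trig_limit (\<lambda>x. of_real (indicator A x))"
  unfolding trig_limit_def
proof (intro allI impI)
  fix e :: real assume e: "e > 0"
  have e3: "e / 3 > 0" using e by simp
  have A': "A \<in> sets borel" "- A \<in> sets borel" using A by (simp_all add: sets_m)
  obtain K where K: "compact K" "K \<subseteq> A" "measure m A < measure m K + e / 3" by (rule inner_regular[OF A'(1) e3])
  obtain C where C: "compact C" "C \<subseteq> - A" "measure m (- A) < measure m C + e / 3" by (rule inner_regular[OF A'(2) e3])
  have KC: "K \<in> sets m" "C \<in> sets m" using K(1) C(1) compact_in_sets by auto
  have sep: "closed C" "closed K" "C \<inter> K = {}" using C K by (auto intro: compact_imp_closed)
  obtain u :: "'a \<Rightarrow> real" where u: "continuous_on UNIV u" "\<And>x. 0 \<le> u x" "\<And>x. u x \<le> 1"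
    "\<And>x. x \<in> C \<Longrightarrow> u x = 0" "\<And>x. x \<in> K \<Longrightarrow> u x = 1" by (rule urysohn[OF sep]) blast
  obtain p where p: "trig p" "\<And>x. norm (complex_of_real (u x) - p x) < e / 3"
    by (rule trig_approx[OF u(1) e3]) blast
  have pi: "integrable m p" using p(1) by (auto intro: integrable_continuous trig_continuous)
  \<comment> \<open>On \<open>K \<union> C\<close> the function \<open>u\<close> equals the
    indicator of \<open>A\<close>; elsewhere it is off by at most 1, on a set of measure below
    \<open>2 * e / 3\<close>.\<close>
  have "(\<integral>x. norm (complex_of_real (indicator A x) - p x) \<partial>m) \<le> (\<integral>x. indicator (- (K \<union> C)) x + e / 3 \<partial>m)"
  proof (rule integral_mono)
    show "integrable m (\<lambda>x. cmod (complex_of_real (indicat_real A x) - p x))"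
      using A pi by (intro integrable_norm Bochner_Integration.integrable_diff integrable_of_real integrable_indicator)
    show "integrable m (\<lambda>x. indicat_real (- (K \<union> C)) x + e / 3)"
      using KC by (intro Bochner_Integration.integrable_add) (auto simp: emeasure_eq_measure sets_m)
    fix x
    have "\<bar>indicator A x - u x\<bar> \<le> indicator (- (K \<union> C)) x"
      using u(2,3)[of x] u(4,5)[of x] K(2) C(2) by (auto simp: indicator_def)
    moreover have "norm (complex_of_real (indicator A x) - p x) \<le>
      norm (complex_of_real (indicator A x - u x)) + norm (complex_of_real (u x) - p x)"
      using norm_triangle_ineq[of "complex_of_real (indicator A x - u x)" "complex_of_real (u x) - p x"] by simp
    ultimately show "norm (complex_of_real (indicator A x) - p x) \<le> indicator (- (K \<union> C)) x + e / 3"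
      using p(2)[of x] unfolding norm_of_real by linarith
  qed
  also have "\<dots> = measure m (- (K \<union> C)) + e / 3"
    using KC by (subst Bochner_Integration.integral_add) (auto simp: emeasure_eq_measure sets_m)
  also have "measure m (- (K \<union> C)) = 1 - (measure m K + measure m C)"
    using KC sep(3) by (subst measure_Compl_UNIV) (auto simp: finite_measure_Union Int_commute)
  also have "\<dots> + e / 3 < e" using K(3) C(3) measure_Compl_UNIV[OF A] by simp
  finally show "\<exists>p. trig p \<and> (\<integral>x. norm (complex_of_real (indicator A x) - p x) \<partial>m) < e" using p(1) by blast
qed

lemma trig_limit_integrable:
  assumes "integrable m f"
  shows "trig_limit f"
  using assms
proof (induction rule: integrable_induct)
  case (base A c)
  then show ?case using trig_limit_cmult[OF trig_limit_indicator[of A], of c]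
    by (simp add: scaleR_conv_of_real mult.commute)
next
  case (add f g)
  then show ?case by (intro trig_limit_add)
next
  case (lim f s)
  have "(\<lambda>i. \<integral>x. norm (f x - s i x) \<partial>m) \<longlonglongrightarrow> (\<integral>x. 0 \<partial>m)"
  proof (rule integral_dominated_convergence)
    \<comment> \<open>The approximants in \<open>integrable_induct\<close> satisfy
      \<open>norm (s i x) \<le> 2 * norm (f x)\<close>, whence the factor 3.\<close>
    show "integrable m (\<lambda>x. 3 * norm (f x))" using lim by auto
    show "AE x in m. (\<lambda>i. norm (f x - s i x)) \<longlonglongrightarrow> 0"
    proof (rule AE_I2)
      fix x assume "x \<in> space m"
      then have "(\<lambda>i. norm (f x - s i x)) \<longlonglongrightarrow> norm (f x - f x)" by (intro tendsto_intros lim)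
      then show "(\<lambda>i. norm (f x - s i x)) \<longlonglongrightarrow> 0" by simp
    qed
    show "AE x in m. norm (norm (f x - s i x)) \<le> 3 * norm (f x)" for i
    proof (rule AE_I2)
      fix x assume "x \<in> space m"
      then have "norm (s i x) \<le> 2 * norm (f x)" by (rule lim)
      then show "norm (norm (f x - s i x)) \<le> 3 * norm (f x)"
        using norm_triangle_ineq4[of "f x" "s i x"] by simp
    qed
  qed (use lim in \<open>auto intro: borel_measurable_integrable\<close>)
  then have l0: "(\<lambda>i. \<integral>x. norm (f x - s i x) \<partial>m) \<longlonglongrightarrow> 0" by simp
  show ?case unfolding trig_limit_def
  proof (intro allI impI)
    fix e :: real assume "e > 0"
    then have "\<forall>\<^sub>F i in sequentially. (\<integral>x. norm (f x - s i x) \<partial>m) < e / 2"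
      using order_tendstoD(2)[OF l0, of "e / 2"] by simp
    then obtain i where i: "(\<integral>x. norm (f x - s i x) \<partial>m) < e / 2"
      using eventually_happens'[OF sequentially_bot] by blast
    obtain p where p: "trig p" "(\<integral>x. norm (s i x - p x) \<partial>m) < e / 2"
      using lim.IH[of i] \<open>e > 0\<close> unfolding trig_limit_def by (metis half_gt_zero)
    have ip: "integrable m p" using p by (auto intro: integrable_continuous trig_continuous)
    have "(\<integral>x. norm (f x - p x) \<partial>m) \<le> (\<integral>x. norm (f x - s i x) + norm (s i x - p x) \<partial>m)"
    proof (rule integral_mono)
      show "norm (f x - p x) \<le> norm (f x - s i x) + norm (s i x - p x)" for x
        using norm_triangle_ineq[of "f x - s i x" "s i x - p x"] by simp
    qed (use lim.hyps(1)[of i] lim.hyps(4) ip in auto)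
    also have "\<dots> = (\<integral>x. norm (f x - s i x) \<partial>m) + (\<integral>x. norm (s i x - p x) \<partial>m)"
      using lim.hyps(1)[of i] lim.hyps(4) ip by (intro Bochner_Integration.integral_add) auto
    finally show "\<exists>p. trig p \<and> (\<integral>x. norm (f x - p x) \<partial>m) < e" using i p by force
  qed
qed

end

subsection \<open>Convergence of correlations\<close>

lemma tendsto_at_top_residue:
  assumes "k < l" "(\<lambda>j. F (k + j * l)) \<longlonglongrightarrow> L"
  shows "(F \<longlongrightarrow> L) (at_top_residue k l)"
proof (rule topological_tendstoI)
  fix S assume "open S" "L \<in> S"
  then have "\<forall>\<^sub>F j in sequentially. F (k + j * l) \<in> S" using assms(2) by (simp add: topological_tendstoD)
  then obtain J where J: "\<And>j. j \<ge> J \<Longrightarrow> F (k + j * l) \<in> S" unfolding eventually_sequentially by blast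
  have "F n \<in> S" if n: "n \<ge> J * l" "[n = k] (mod l)" for n
  proof -
    have "n mod l = k" using n(2) assms(1) by (simp add: cong_def)
    then have "n = k + (n div l) * l" by (metis add.commute div_mult_mod_eq)
    moreover have "n div l \<ge> J" using n(1) assms(1) by (simp add: less_eq_div_iff_mult_less_eq)
    ultimately show ?thesis using J by metis
  qed
  then have "\<forall>\<^sub>F n in sequentially. [n = k] (mod l) \<longrightarrow> F n \<in> S"
    unfolding eventually_sequentially by blast
  then show "\<forall>\<^sub>F n in at_top_residue k l. F n \<in> S"
    by (simp add: at_top_residue_def eventually_inf_principal)
qed

lemma convergent_uniform_approx:
  fixes c :: "nat \<Rightarrow> complex"
  assumes "\<And>e. e > 0 \<Longrightarrow> \<exists>d. convergent d \<and> (\<forall>j. norm (c j - d j) \<le> e)"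
  shows "convergent c"
  unfolding Cauchy_convergent_iff[symmetric]
proof (rule metric_CauchyI)
  fix e :: real assume e: "e > 0"
  then obtain d where d: "convergent d" "\<And>j. norm (c j - d j) \<le> e / 3" using assms[of "e / 3"] by auto
  obtain M where M: "\<And>i j. i \<ge> M \<Longrightarrow> j \<ge> M \<Longrightarrow> dist (d i) (d j) < e / 3"
    using metric_CauchyD[OF convergent_Cauchy[OF d(1)], of "e / 3"] e by auto
  have "dist (c i) (c j) < e" if "i \<ge> M" "j \<ge> M" for i j
    using M[OF that] d(2)[of i] d(2)[of j] dist_triangle_third[of "c i" "d i" e "d j" "c j"]
      dist_triangle[of "c i" "c j" "d i"] dist_triangle[of "d i" "c j" "d j"]
    by (simp add: dist_norm norm_minus_commute)
  then show "\<exists>M. \<forall>m\<ge>M. \<forall>n\<ge>M. dist (c m) (c n) < e" by blast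
qed

context compact_haar
begin

lemma L_inf_integrable:
  assumes "f \<in> L_inf m"
  shows "integrable m f"
  using assms unfolding L_inf_def by (auto intro: integrable_const_bound)

lemma chr_L_inf: "chr \<gamma> \<in> L_inf m"
  by (auto simp: L_inf_def intro!: measurable_continuous continuous_chr exI[of _ 1])

lemma L_inf_epimorphism:
  assumes T: "epimorphism T" and f: "f \<in> L_inf m"
  shows "(\<lambda>x. f (T x)) \<in> L_inf m"
proof -
  obtain C where C: "AE x in m. norm (f x) \<le> C" and fm: "f \<in> borel_measurable m"
    using f by (auto simp: L_inf_def)
  have "(\<lambda>x. f (T x)) \<in> borel_measurable m"
    by (rule measurable_compose[OF epimorphism_measurable[OF T] fm])
  then show ?thesis using AE_epimorphism[OF T C] by (auto simp: L_inf_def)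
qed

lemma L_inf_prod_bound:
  fixes f :: "'i \<Rightarrow> 'a \<Rightarrow> complex"
  assumes "finite I" "\<And>i. i \<in> I \<Longrightarrow> AE x in m. norm (f i x) \<le> C i"
  shows "AE x in m. norm (\<Prod>i\<in>I. f i x) \<le> (\<Prod>i\<in>I. C i :: real)"
proof -
  have "AE x in m. \<forall>i\<in>I. norm (f i x) \<le> C i" using assms by (intro AE_finite_allI)
  then show ?thesis
    by eventually_elim (auto simp: prod_norm[symmetric] intro!: prod_mono)
qed

lemma L_inf_prod:
  assumes "finite I" "\<And>i. i \<in> I \<Longrightarrow> f i \<in> L_inf m"
  shows "(\<lambda>x. \<Prod>i\<in>I. f i x) \<in> L_inf m"
proof -
  have "\<forall>i\<in>I. \<exists>C. AE x in m. norm (f i x) \<le> C" using assms(2) by (auto simp: L_inf_def)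
  then obtain C where "\<And>i. i \<in> I \<Longrightarrow> AE x in m. norm (f i x) \<le> C i" by metis
  then have "AE x in m. norm (\<Prod>i\<in>I. f i x) \<le> (\<Prod>i\<in>I. C i)" by (rule L_inf_prod_bound[OF assms(1)])
  moreover have "(\<lambda>x. \<Prod>i\<in>I. f i x) \<in> borel_measurable m"
    using assms(2) by (intro borel_measurable_prod) (auto simp: L_inf_def)
  ultimately show ?thesis by (auto simp: L_inf_def)
qed

text \<open>Passes from characters to a general function in one factor while \<open>G\<close>
  collects the others. Replacing \<open>f\<close> by a trigonometric polynomial \<open>p\<close>
  costs at most \<open>\<bar>B\<bar>\<close> times the \<open>L^1\<close> distance of
  \<open>f\<close> and \<open>p\<close>, uniformly in \<open>j\<close>, because every
  \<open>S j\<close> preserves \<open>m\<close>.\<close>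

lemma correlation_convergent_slot:
  fixes G :: "nat \<Rightarrow> 'a \<Rightarrow> complex" and S :: "nat \<Rightarrow> 'a \<Rightarrow> 'a"
  assumes S: "\<And>j. epimorphism (S j)" and f: "f \<in> L_inf m"
    and Gm: "\<And>j. G j \<in> borel_measurable m" and GB: "\<And>j. AE x in m. norm (G j x) \<le> B"
    and conv: "\<And>\<gamma>. convergent (\<lambda>j. \<integral>x. chr \<gamma> (S j x) * G j x \<partial>m)"
  shows "convergent (\<lambda>j. \<integral>x. f (S j x) * G j x \<partial>m)"
proof -
  have int: "integrable m (\<lambda>x. g (S j x) * G j x)" if "g \<in> L_inf m" for g j
  proof -
    have "G j \<in> L_inf m" using Gm GB by (auto simp: L_inf_def)
    \<comment> \<open>The product of two factors is written as a product over the booleans, so that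
      \<open>L_inf_prod\<close> covers it.\<close>
    then have "(\<lambda>x. if b then g (S j x) else G j x) \<in> L_inf m" for b
      using L_inf_epimorphism[OF S[of j] that] by (cases b) auto
    then have "(\<lambda>x. \<Prod>b\<in>UNIV. if b then g (S j x) else G j x) \<in> L_inf m"
      by (intro L_inf_prod) auto
    then show ?thesis by (intro L_inf_integrable) (simp add: UNIV_bool mult.commute)
  qed
  have trigL: "p \<in> L_inf m" if "trig p" for p
    using continuous_bounded[OF trig_continuous[OF that]] measurable_continuous[OF trig_continuous[OF that]]
    by (metis (mono_tags, lifting) AE_I2 L_inf_def mem_Collect_eq)
  have trig_conv: "convergent (\<lambda>j. \<integral>x. p (S j x) * G j x \<partial>m)" if "trig p" for p
  proof -
    have "p \<in> L_inf m \<and> convergent (\<lambda>j. \<integral>x. p (S j x) * G j x \<partial>m)"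
      using that
    proof (induction rule: trig_induct)
      case (base c \<gamma>)
      have "convergent (\<lambda>j. c * (\<integral>x. chr \<gamma> (S j x) * G j x \<partial>m))"
        using conv[of \<gamma>] by (rule convergent_mult[OF convergent_const])
      then show ?case using trigL[OF trig_cmult_chr] by (simp add: mult.assoc)
    next
      case (add p q)
      then have "convergent (\<lambda>j. (\<integral>x. p (S j x) * G j x \<partial>m) + (\<integral>x. q (S j x) * G j x \<partial>m))"
        by (intro convergent_add) auto
      moreover have "(\<lambda>x. p x + q x) \<in> L_inf m"
      proof -
        obtain C D where "AE x in m. norm (p x) \<le> C" "AE x in m. norm (q x) \<le> D"
          using add.IH by (auto simp: L_inf_def)
        then have "AE x in m. norm (p x + q x) \<le> C + D"
          by eventually_elim (auto intro: norm_triangle_le)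
        then show ?thesis using add.IH by (auto simp: L_inf_def)
      qed
      ultimately show ?case using add.IH int by (simp add: distrib_right)
    qed
    then show ?thesis by blast
  qed
  show ?thesis
  proof (rule convergent_uniform_approx)
    fix e :: real assume e: "e > 0"
    have "e / (\<bar>B\<bar> + 1) > 0" using e by (simp add: add_nonneg_pos)
    then obtain p where p: "trig p" "(\<integral>x. norm (f x - p x) \<partial>m) < e / (\<bar>B\<bar> + 1)"
      using trig_limit_integrable[OF L_inf_integrable[OF f]] unfolding trig_limit_def by blast
    have fp: "integrable m (\<lambda>x. f x - p x)"
      using L_inf_integrable[OF f] L_inf_integrable[OF trigL[OF p(1)]] by auto
    have "norm ((\<integral>x. f (S j x) * G j x \<partial>m) - (\<integral>x. p (S j x) * G j x \<partial>m)) \<le> e" for j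
    proof -
      have fpS: "integrable m (\<lambda>x. norm (f (S j x) - p (S j x)))"
        using L_inf_integrable[OF L_inf_epimorphism[OF S f]] L_inf_integrable[OF L_inf_epimorphism[OF S trigL[OF p(1)]]]
        by auto
      have d: "integrable m (\<lambda>x. f (S j x) * G j x - p (S j x) * G j x)"
        using int[OF f] int[OF trigL[OF p(1)]] by auto
      have "norm ((\<integral>x. f (S j x) * G j x \<partial>m) - (\<integral>x. p (S j x) * G j x \<partial>m)) =
          norm (\<integral>x. f (S j x) * G j x - p (S j x) * G j x \<partial>m)"
        using int[OF f] int[OF trigL[OF p(1)]] by simp
      also have "\<dots> \<le> (\<integral>x. norm (f (S j x) * G j x - p (S j x) * G j x) \<partial>m)" by (rule integral_norm_bound)
      also have "\<dots> \<le> (\<integral>x. \<bar>B\<bar> * norm (f (S j x) - p (S j x)) \<partial>m)"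
      proof (rule integral_mono_AE)
        show "AE x in m. norm (f (S j x) * G j x - p (S j x) * G j x) \<le> \<bar>B\<bar> * norm (f (S j x) - p (S j x))"
          using GB[of j]
        proof eventually_elim
          case (elim x)
          have "f (S j x) * G j x - p (S j x) * G j x = G j x * (f (S j x) - p (S j x))"
            by (simp add: algebra_simps)
          then show ?case using elim by (simp add: norm_mult mult_right_mono)
        qed
      qed (use d fpS in auto)
      also have "\<dots> = \<bar>B\<bar> * (\<integral>x. norm (f x - p x) \<partial>m)"
        using integral_epimorphism[OF S[of j], of "\<lambda>x. norm (f x - p x)"] fp by simp
      also have "\<dots> \<le> \<bar>B\<bar> * (e / (\<bar>B\<bar> + 1))" using p(2) by (intro mult_left_mono) auto
      also have "\<dots> \<le> e"
      proof -
        have "\<bar>B\<bar> * e \<le> e * (\<bar>B\<bar> + 1)" using e by (simp add: algebra_simps)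
        then show ?thesis by (simp add: pos_divide_le_eq add_nonneg_pos)
      qed
      finally show ?thesis .
    qed
    then show "\<exists>d. convergent d \<and> (\<forall>j. norm ((\<integral>x. f (S j x) * G j x \<partial>m) - d j) \<le> e)"
      using trig_conv[OF p(1)] by blast
  qed
qed

text \<open>Induction on the set of factors that carry general functions, all others being
  characters; each step frees one factor. Only an \<open>L^1\<close> approximation in that factor is
  needed, since the others stay bounded.\<close>

lemma correlation_convergent:
  fixes S :: "nat \<Rightarrow> 'i \<Rightarrow> 'a \<Rightarrow> 'a"
  assumes I: "finite I" and S: "\<And>j i. i \<in> I \<Longrightarrow> epimorphism (S j i)"
    and chr: "\<And>v. convergent (\<lambda>j. \<integral>x. (\<Prod>i\<in>I. chr (v i) (S j i x)) \<partial>m)"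
    and f: "\<And>i. i \<in> I \<Longrightarrow> f i \<in> L_inf m"
  shows "convergent (\<lambda>j. \<integral>x. (\<Prod>i\<in>I. f i (S j i x)) \<partial>m)"
proof -
  have "convergent (\<lambda>j. \<integral>x. (\<Prod>i\<in>I. f i (S j i x)) \<partial>m)"
    if "finite J" "J \<subseteq> I" "\<And>i. i \<in> J \<Longrightarrow> f i \<in> L_inf m" "\<And>i. i \<in> I - J \<Longrightarrow> f i \<in> range chr" for J f
    using that
  proof (induction J arbitrary: f rule: finite_induct)
    case empty
    then have "\<forall>i\<in>I. \<exists>\<gamma>. f i = chr \<gamma>" by auto
    then obtain v where "\<And>i. i \<in> I \<Longrightarrow> f i = chr (v i)" by metis
    then show ?case using chr[of v] by simp
  next
    case (insert a J)
    have a: "a \<in> I" using insert.prems(1) by simp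
    have split: "(\<Prod>i\<in>I. g i (S j i x)) = g a (S j a x) * (\<Prod>i\<in>I - {a}. g i (S j i x))" for g :: "'i \<Rightarrow> 'a \<Rightarrow> complex" and j x
      using I a by (rule prod.remove)
    have fL: "f i \<in> L_inf m" if i: "i \<in> I" for i
    proof (cases "i \<in> insert a J")
      case False
      then obtain \<gamma> where "f i = chr \<gamma>" using insert.prems(3) i by blast
      then show ?thesis by (simp add: chr_L_inf)
    qed (rule insert.prems(2))
    have SL: "(\<lambda>x. f i (S j i x)) \<in> L_inf m" if "i \<in> I" for i j
      by (rule L_inf_epimorphism[OF S[OF that] fL[OF that]])
    have "\<forall>i\<in>I. \<exists>C. AE x in m. norm (f i x) \<le> C" using fL by (auto simp: L_inf_def)
    then obtain C where C: "\<And>i. i \<in> I \<Longrightarrow> AE x in m. norm (f i x) \<le> C i" by metis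
    show ?case
      unfolding split
    proof (rule correlation_convergent_slot)
      show "epimorphism (S j a)" for j by (rule S[OF a])
      show "f a \<in> L_inf m" by (rule fL[OF a])
      have "(\<lambda>x. \<Prod>i\<in>I - {a}. f i (S j i x)) \<in> L_inf m" for j using I SL by (intro L_inf_prod) auto
      then show "(\<lambda>x. \<Prod>i\<in>I - {a}. f i (S j i x)) \<in> borel_measurable m" for j by (simp add: L_inf_def)
      show "AE x in m. norm (\<Prod>i\<in>I - {a}. f i (S j i x)) \<le> (\<Prod>i\<in>I - {a}. C i)" for j
        using I AE_epimorphism[OF S C] by (intro L_inf_prod_bound) auto
      fix \<gamma>
      define g where "g = f(a := chr \<gamma>)"
      have "convergent (\<lambda>j. \<integral>x. (\<Prod>i\<in>I. g i (S j i x)) \<partial>m)"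
        by (rule insert.IH) (use insert.prems insert.hyps in \<open>auto simp: g_def\<close>)
      moreover have "(\<Prod>i\<in>I - {a}. g i (S j i x)) = (\<Prod>i\<in>I - {a}. f i (S j i x))" for j x
        by (intro prod.cong) (auto simp: g_def)
      ultimately show "convergent (\<lambda>j. \<integral>x. chr \<gamma> (S j a x) * (\<Prod>i\<in>I - {a}. f i (S j i x)) \<partial>m)"
        unfolding split by (simp add: g_def)
    qed
  qed
  from this[OF I order_refl f] show ?thesis by simp
qed

end

theorem corollary1p9:
  fixes m :: "'a::{topological_ab_group_add, t2_space} measure"
    and s :: nat
    and T :: "nat \<Rightarrow> 'a \<Rightarrow> 'a"
  assumes "compact (UNIV :: 'a set)"
    and "connected (UNIV :: 'a set)"
    and "finite_covering_dim (euclidean :: 'a topology)"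
    and "normalized_haar m"
    and "\<forall>i\<in>{1..s}. epimorphism (T i)"
  shows "\<exists>l\<ge>1. \<forall>k<l. \<forall>f :: nat \<Rightarrow> 'a \<Rightarrow> complex. (\<forall>i\<in>{1..s}. f i \<in> L_inf m) \<longrightarrow>
           (\<exists>L. ((\<lambda>n. \<integral>x. (\<Prod>i=1..s. f i ((T i ^^ n) x)) \<partial>m) \<longlongrightarrow> L) (at_top_residue k l))"
proof -
  interpret compact_haar m by standard (rule assms)+
  obtain n where dim: "covering_dim_le (euclidean :: 'a topology) n"
    using assms(3) by (auto simp: finite_covering_dim_def)
  have T: "epimorphism (T i)" if "i \<in> {1..s}" for i using assms(5) that by blast
  have "\<exists>N\<ge>1. \<forall>k v. (\<forall>n. (\<Sum>i\<in>{1..s}. (dual (T i) ^^ (k + n * N)) (v i)) = 0) \<or>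
      finite {n. (\<Sum>i\<in>{1..s}. (dual (T i) ^^ (k + n * N)) (v i)) = 0}"
    by (rule additive_orbit_sum_zeros[OF zmul_character_torsion_free[OF assms(2)]
        character_rank_le_covering_dim[OF dim]]) (auto simp: T dual_add dual_inj)
  then obtain N where N: "N \<ge> 1" and zeros: "\<And>k v. (\<forall>n. (\<Sum>i\<in>{1..s}. (dual (T i) ^^ (k + n * N)) (v i)) = 0) \<or>
      finite {n. (\<Sum>i\<in>{1..s}. (dual (T i) ^^ (k + n * N)) (v i)) = 0}" by blast
  have chr: "convergent (\<lambda>j. \<integral>x. (\<Prod>i\<in>{1..s}. chr (v i) ((T i ^^ (k + j * N)) x)) \<partial>m)" for k v
  proof -
    \<comment> \<open>The product of the characters is the single character
      \<open>\<sigma> j\<close>, so the integrals are zeros and ones, and \<open>zeros\<close> makes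
      this sequence eventually constant.\<close>
    define \<sigma> where "\<sigma> j = (\<Sum>i\<in>{1..s}. (dual (T i) ^^ (k + j * N)) (v i))" for j
    have "(\<Prod>i\<in>{1..s}. chr (v i) ((T i ^^ (k + j * N)) x)) = chr (\<sigma> j) x" for j x
      unfolding \<sigma>_def chr_sum by (intro prod.cong refl) (simp add: chr_dual_funpow T)
    then have eq: "(\<integral>x. (\<Prod>i\<in>{1..s}. chr (v i) ((T i ^^ (k + j * N)) x)) \<partial>m) = (if \<sigma> j = 0 then 1 else 0)" for j
      by (simp add: integral_chr chr_zero)
    have "(\<forall>j. \<sigma> j = 0) \<or> finite {j. \<sigma> j = 0}" using zeros[of k v] by (simp add: \<sigma>_def)
    then show ?thesis
    proof
      assume "\<forall>j. \<sigma> j = 0"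
      then show ?thesis unfolding eq by (simp add: convergent_const)
    next
      assume "finite {j. \<sigma> j = 0}"
      then have "\<forall>\<^sub>F j in sequentially. \<sigma> j \<noteq> 0"
        by (simp add: eventually_cofinite flip: cofinite_eq_sequentially)
      then have "\<forall>\<^sub>F j in sequentially. (if \<sigma> j = 0 then 1 else 0) = (0 :: complex)"
        by eventually_elim simp
      then have "(\<lambda>j. if \<sigma> j = 0 then 1 else 0 :: complex) \<longlonglongrightarrow> 0" by (rule tendsto_eventually)
      then show ?thesis unfolding eq by (rule convergentI)
    qed
  qed
  have "\<exists>L. ((\<lambda>n. \<integral>x. (\<Prod>i=1..s. f i ((T i ^^ n) x)) \<partial>m) \<longlongrightarrow> L) (at_top_residue k N)"
    if k: "k < N" and f: "\<forall>i\<in>{1..s}. f i \<in> L_inf m" for k and f :: "nat \<Rightarrow> 'a \<Rightarrow> complex"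
  proof -
    have "convergent (\<lambda>j. \<integral>x. (\<Prod>i\<in>{1..s}. f i ((T i ^^ (k + j * N)) x)) \<partial>m)"
    proof (rule correlation_convergent[where S = "\<lambda>j i. T i ^^ (k + j * N)"])
      show "convergent (\<lambda>j. \<integral>x. (\<Prod>i\<in>{1..s}. chr (v i) ((T i ^^ (k + j * N)) x)) \<partial>m)" for v by (rule chr)
      show "epimorphism (T i ^^ (k + j * N))" if "i \<in> {1..s}" for i j by (rule epimorphism_funpow[OF T[OF that]])
      show "f i \<in> L_inf m" if "i \<in> {1..s}" for i using f that by blast
    qed simp
    then obtain L where "(\<lambda>j. \<integral>x. (\<Prod>i=1..s. f i ((T i ^^ (k + j * N)) x)) \<partial>m) \<longlonglongrightarrow> L"
      by (auto simp: convergent_def)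
    then show ?thesis using tendsto_at_top_residue[OF k, of "\<lambda>n. \<integral>x. (\<Prod>i=1..s. f i ((T i ^^ n) x)) \<partial>m"] by blast
  qed
  then show ?thesis using N by blast
qed

end
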